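(* Let $(\Omega,\mathcal F,\mu)$ be a probability space and $m\in\mathbb N$. The couple $\big(U^1_m(\Omega^\infty),\,U^2_m(\Omega^\infty)\big)$ is $K$-closed in $\big(L^1(\Omega^\infty),\,L^2(\Omega^\infty)\big)$.
   Context: $\Omega^\infty=\Omega^{\mathbb N}$ carries the product probability measure. $U^2_{\le m}(\Omega^\infty)\subset L^2(\Omega^\infty)$ is the closed span of the functions in $L^2(\Omega^\infty)$ depending on at most $m$ coordinates, $U^2_0=U^2_{\le0}$ (constants), $U^2_m=U^2_{\le m}\cap(U^2_{\le m-1})^\perp$ for $m\ge1$, and $U^1_m(\Omega^\infty)$ is the closure of $U^2_m$ in $L^1(\Omega^\infty)$. For a compatible couple $(X_0,X_1)$ of Banach spaces, $K(f,t;X_0,X_1)=\inf_{f=f_0+f_1}\|f_0\|_{X_0}+t\|f_1\|_{X_1}$ for $f\in X_0+X_1$, $t>0$. For closed subspaces $Y_0\subset X_0$, $Y_1\subset X_1$ (with inherited norms), $(Y_0,Y_1)$ is $K$-closed in $(X_0,X_1)$ if there is a constant $C$ with $K(f,t;Y_0,Y_1)\le C\,K(f,t;X_0,X_1)$ for all $f\in Y_0+Y_1$ and $t>0$. *)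

theory Defs
  imports "HOL-Probability.Probability"
begin

text \<open>
  Elements of the spaces \<open>L\<^sup>p\<close> are represented by measurable functions rather than classes. Closures
  are taken in the \<open>L\<^sup>p\<close> seminorm and decompositions hold almost everywhere, so the closed subspaces
  below and the K-functional are invariant under equality almost everywhere. The scalar type \<open>'b\<close>
  is used with \<^typ>\<open>real\<close> and \<^typ>\<open>complex\<close>.
\<close>

definition Lp :: "'a measure \<Rightarrow> real \<Rightarrow> ('a \<Rightarrow> 'b::{real_normed_field,banach,second_countable_topology}) set"
  where "Lp P p = {f \<in> borel_measurable P. integrable P (\<lambda>x. norm (f x) powr p)}"

definition Lp_norm :: "'a measure \<Rightarrow> real \<Rightarrow> ('a \<Rightarrow> 'b::{real_normed_field,banach,second_countable_topology}) \<Rightarrow> real"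
  where "Lp_norm P p f = (\<integral>x. norm (f x) powr p \<partial>P) powr (1 / p)"

definition Lp_closure :: "'a measure \<Rightarrow> real \<Rightarrow> ('a \<Rightarrow> 'b::{real_normed_field,banach,second_countable_topology}) set \<Rightarrow> ('a \<Rightarrow> 'b) set"
  where "Lp_closure P p S = {f \<in> Lp P p. \<forall>e>0. \<exists>g\<in>S. Lp_norm P p (\<lambda>x. f x - g x) < e}"

definition fun_span :: "('a \<Rightarrow> 'b::field) set \<Rightarrow> ('a \<Rightarrow> 'b) set"
  where "fun_span S = {(\<lambda>x. \<Sum>g\<in>F. c g * g x) |F c. finite F \<and> F \<subseteq> S}"

abbreviation inf_power :: "'a measure \<Rightarrow> (nat \<Rightarrow> 'a) measure"
  where "inf_power M \<equiv> PiM (UNIV :: nat set) (\<lambda>_. M)"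

definition depends_on :: "'a measure \<Rightarrow> nat set \<Rightarrow> ((nat \<Rightarrow> 'a) \<Rightarrow> 'b) \<Rightarrow> bool"
  where "depends_on M J f \<longleftrightarrow>
    (\<forall>x\<in>space (inf_power M). \<forall>y\<in>space (inf_power M). (\<forall>j\<in>J. x j = y j) \<longrightarrow> f x = f y)"

definition U2_le :: "'a measure \<Rightarrow> nat \<Rightarrow> ((nat \<Rightarrow> 'a) \<Rightarrow> 'b::{real_normed_field,banach,second_countable_topology}) set"
  where "U2_le M m = Lp_closure (inf_power M) 2
    (fun_span {f \<in> Lp (inf_power M) 2. \<exists>J. finite J \<and> card J \<le> m \<and> depends_on M J f})"

text \<open>
  The argument \<open>cj\<close> is the conjugation of the scalar field: the identity on \<^typ>\<open>real\<close> and
  \<^const>\<open>cnj\<close> on \<^typ>\<open>complex\<close>.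
\<close>

definition L2_inner :: "('b \<Rightarrow> 'b) \<Rightarrow> 'a measure \<Rightarrow> ('a \<Rightarrow> 'b::{real_normed_field,banach,second_countable_topology}) \<Rightarrow> ('a \<Rightarrow> 'b) \<Rightarrow> 'b"
  where "L2_inner cj P f g = (\<integral>x. f x * cj (g x) \<partial>P)"

fun U2 :: "('b \<Rightarrow> 'b) \<Rightarrow> 'a measure \<Rightarrow> nat \<Rightarrow> ((nat \<Rightarrow> 'a) \<Rightarrow> 'b::{real_normed_field,banach,second_countable_topology}) set"
  where
    "U2 cj M 0 = U2_le M 0"
  | "U2 cj M (Suc m) = {f \<in> U2_le M (Suc m). \<forall>g\<in>U2_le M m. L2_inner cj (inf_power M) f g = 0}"

definition U1 :: "('b \<Rightarrow> 'b) \<Rightarrow> 'a measure \<Rightarrow> nat \<Rightarrow> ((nat \<Rightarrow> 'a) \<Rightarrow> 'b::{real_normed_field,banach,second_countable_topology}) set"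
  where "U1 cj M m = Lp_closure (inf_power M) 1 (U2 cj M m)"

definition decompositions ::
    "'a measure \<Rightarrow> ('a \<Rightarrow> 'b) set \<Rightarrow> ('a \<Rightarrow> 'b) set \<Rightarrow> ('a \<Rightarrow> 'b::plus) \<Rightarrow> (('a \<Rightarrow> 'b) \<times> ('a \<Rightarrow> 'b)) set"
  where "decompositions P X0 X1 f = {(f0, f1). f0 \<in> X0 \<and> f1 \<in> X1 \<and> (AE x in P. f x = f0 x + f1 x)}"

definition sum_space :: "'a measure \<Rightarrow> ('a \<Rightarrow> 'b::{plus,topological_space}) set \<Rightarrow> ('a \<Rightarrow> 'b) set \<Rightarrow> ('a \<Rightarrow> 'b) set"
  where "sum_space P X0 X1 = {f \<in> borel_measurable P. decompositions P X0 X1 f \<noteq> {}}"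

definition K_functional ::
    "'a measure \<Rightarrow> (('a \<Rightarrow> 'b) \<Rightarrow> real) \<Rightarrow> (('a \<Rightarrow> 'b) \<Rightarrow> real) \<Rightarrow> ('a \<Rightarrow> 'b::plus) set \<Rightarrow> ('a \<Rightarrow> 'b) set
      \<Rightarrow> ('a \<Rightarrow> 'b) \<Rightarrow> real \<Rightarrow> real"
  where "K_functional P n0 n1 X0 X1 f t = (INF (f0, f1)\<in>decompositions P X0 X1 f. n0 f0 + t * n1 f1)"

definition K_closed ::
    "'a measure \<Rightarrow> (('a \<Rightarrow> 'b) \<Rightarrow> real) \<Rightarrow> (('a \<Rightarrow> 'b) \<Rightarrow> real) \<Rightarrow> ('a \<Rightarrow> 'b::{plus,topological_space}) set \<Rightarrow> ('a \<Rightarrow> 'b) set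
      \<Rightarrow> ('a \<Rightarrow> 'b) set \<Rightarrow> ('a \<Rightarrow> 'b) set \<Rightarrow> bool"
  where "K_closed P n0 n1 Y0 Y1 X0 X1 \<longleftrightarrow>
    (\<exists>C. \<forall>f\<in>sum_space P Y0 Y1. \<forall>t>0.
      K_functional P n0 n1 Y0 Y1 f t \<le> C * K_functional P n0 n1 X0 X1 f t)"

end

theory Submission
  imports Defs
begin

text \<open>
  Let \<open>Q\<close> denote the projection onto the chaos of order \<open>m\<close>, let \<open>f\<close> be a bounded function in
  this chaos that depends on finitely many coordinates, and let \<open>f = g + h\<close> be any splitting with
  \<open>\<kappa> = \<parallel>g\<parallel>\<^sub>1 + t\<parallel>h\<parallel>\<^sub>2\<close>. The point is to find \<open>u\<close> in the chaos with
  \<open>\<parallel>f - u\<parallel>\<^sub>1 + t\<parallel>u\<parallel>\<^sub>2 \<le> C\<kappa>\<close>, up to an arbitrarily small error. The projection of \<open>h\<close> is not a good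
  choice, because \<open>Q\<close> is in general unbounded on \<open>L\<^sup>1\<close>. Instead \<open>u\<close> is taken to be a near-minimiser of
  (a smooth version of) \<open>\<parallel>f - u\<parallel>\<^sub>1 + t\<parallel>u\<parallel>\<^sub>2\<close> over the chaos. The Euler equation says that for the sign
  \<open>s = (f - u)/|f - u|\<close> the function \<open>\<phi> = Q s\<close> is nearly \<open>t u/\<parallel>u\<parallel>\<^sub>2\<close>, whence
  \<open>\<langle>f, \<phi>\<rangle>\<close> is nearly \<open>\<parallel>f - u\<parallel>\<^sub>1 + t\<parallel>u\<parallel>\<^sub>2\<close>. So everything reduces to the dual estimate
  \<open>\<langle>f, \<phi>\<rangle> \<le> C\<kappa>\<close> for functions \<open>\<phi> = Q s\<close> with \<open>|s| \<le> 1\<close> and \<open>\<parallel>\<phi>\<parallel>\<^sub>2 \<le> 2t\<close>.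

  If \<open>\<phi> = Q k\<close> with \<open>|k| \<le> C\<close> and \<open>\<parallel>k\<parallel>\<^sub>2 \<le> C t\<close>, the dual estimate is clear, since then
  \<open>\<langle>f, \<phi>\<rangle> = \<langle>f, k\<rangle> = \<langle>g, k\<rangle> + \<langle>h, k\<rangle>\<close>. Such a \<open>k\<close> is approximated by truncation. Being the
  projection of a bounded function, \<open>\<phi>\<close> is \<^emph>\<open>global\<close>: whenever at most \<open>m\<close> coordinates are frozen, its
  \<open>L\<^sup>2\<close> norm over the remaining coordinates stays below a constant (lemma \<open>global_chaos\<close>). Global
  functions in a chaos of bounded order are hypercontractive: if \<open>\<phi>\<close> is global with squared bound \<open>c\<close>
  then \<open>E|\<phi>|\<^sup>4 \<le> C c E|\<phi>|\<^sup>2\<close>, and similarly after freezing coordinates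
  (lemmas \<open>fourth_moment_le_of_global\<close> and \<open>fourth_moment_chaos_le_of_global\<close>). Hence, when \<open>c\<close> is
  small, truncating \<open>\<phi>\<close> at height \<open>1\<close> removes so little that twice the projected error is again global
  with the same bound \<open>c\<close> and no larger in \<open>L\<^sup>2\<close> (lemma \<open>dual_ball_truncate\<close>). The
  supremum \<open>S\<close> of \<open>\<langle>f, \<phi>\<rangle>\<close> over all such \<open>\<phi>\<close> therefore satisfies \<open>S \<le> \<kappa> + S/2\<close>, that is,
  \<open>S \<le> 2\<kappa>\<close> (lemma \<open>dual_ball_bound\<close>).

  Finally, every function in \<open>U\<^sup>1\<^sub>m\<close> is an \<open>L\<^sup>1\<close> limit of bounded functions of finitely many
  coordinates in the chaos (lemma \<open>U1_approximable\<close>), and so the estimate passes to the whole couple.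

  The estimates use only the real inner product on the scalars, and so the real and the complex case are
  treated at once.
\<close>

section \<open>Averaging over coordinates\<close>

text \<open>
  The point with the coordinates in \<open>J\<close> taken from \<open>y\<close> and the others from \<open>x\<close>. Resampling the
  coordinates in \<open>J\<close> means integrating over \<open>y\<close>.
\<close>

definition merge_coords :: "nat set \<Rightarrow> (nat \<Rightarrow> 'a) \<Rightarrow> (nat \<Rightarrow> 'a) \<Rightarrow> nat \<Rightarrow> 'a"
  where "merge_coords J x y = (\<lambda>i. if i \<in> J then y i else x i)"

lemma merge_coords_empty [simp]: "merge_coords {} x y = x"
  by (auto simp: merge_coords_def)

lemma merge_coords_merge_coords:
  "merge_coords K (merge_coords J x y) z = merge_coords (J \<union> K) x (merge_coords K y z)"
  by (auto simp: merge_coords_def fun_eq_iff)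

lemma merge_coords_same_left: "merge_coords J (merge_coords J x y) z = merge_coords J x z"
  by (auto simp: merge_coords_def fun_eq_iff)

locale coordinate_space = prob_space M for M :: "'a measure"
begin

abbreviation P :: "(nat \<Rightarrow> 'a) measure" where "P \<equiv> inf_power M"

sublocale P: prob_space P
  by (rule prob_space_PiM) unfold_locales

sublocale PP: product_prob_space "\<lambda>_. M" "UNIV :: nat set"
  by unfold_locales

sublocale P2: pair_prob_space P P
  by unfold_locales

lemma merge_coords_space [simp, intro]:
  "x \<in> space P \<Longrightarrow> y \<in> space P \<Longrightarrow> merge_coords J x y \<in> space P"
  by (auto simp: space_PiM merge_coords_def PiE_iff)

lemma measurable_merge_coords [measurable]:
  "(\<lambda>p. merge_coords J (fst p) (snd p)) \<in> P \<Otimes>\<^sub>M P \<rightarrow>\<^sub>M P"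
  unfolding merge_coords_def
  apply (rule measurable_PiM_single')
  subgoal for i by (cases "i \<in> J") simp_all
  by (auto simp: space_pair_measure space_PiM PiE_iff)

lemma measurable_merge_coords_right [measurable]:
  "x \<in> space P \<Longrightarrow> (\<lambda>y. merge_coords J x y) \<in> P \<rightarrow>\<^sub>M P"
  using measurable_compose[OF measurable_Pair1' measurable_merge_coords[of J], of x] by simp

text \<open>
  Resampling some coordinates of a random point by those of an independent copy does not change its
  distribution. All facts about conditional expectations below come from this one.
\<close>

lemma distr_merge_coords:
  "distr (P \<Otimes>\<^sub>M P) P (\<lambda>p. merge_coords J (fst p) (snd p)) = P" (is "?L = _")
proof (rule PP.PiM_eq)
  fix K :: "nat set" and F assume K: "finite K" and F: "\<And>j. j \<in> K \<Longrightarrow> F j \<in> sets M"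
  let ?X = "prod_emb UNIV (\<lambda>_. M) K (Pi\<^sub>E K F)"
  let ?E = "\<lambda>K. prod_emb UNIV (\<lambda>_. M) K (Pi\<^sub>E K F)"
  have sets: "?E K' \<in> sets P" if "K' \<subseteq> K" for K'
    using that K F by (intro sets_PiM_I) (auto intro: finite_subset)
  have "(\<lambda>p. merge_coords J (fst p) (snd p)) -` ?X \<inter> space (P \<Otimes>\<^sub>M P) = ?E (K - J) \<times> ?E (K \<inter> J)"
    by (auto simp: prod_emb_def space_pair_measure space_PiM merge_coords_def PiE_iff split: if_splits)
  then have "emeasure ?L ?X = emeasure (P \<Otimes>\<^sub>M P) (?E (K - J) \<times> ?E (K \<inter> J))"
    using sets[of K] by (simp add: emeasure_distr)
  also have "\<dots> = emeasure P (?E (K - J)) * emeasure P (?E (K \<inter> J))"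
    by (intro P.emeasure_pair_measure_Times sets) auto
  also have "\<dots> = (\<Prod>j\<in>K - J. emeasure M (F j)) * (\<Prod>j\<in>K \<inter> J. emeasure M (F j))"
    using K F by (subst (1 2) PP.emeasure_PiM_emb) auto
  also have "\<dots> = (\<Prod>j\<in>K. emeasure M (F j))"
    using K by (subst prod.union_disjoint[symmetric]) (auto intro!: arg_cong2[where f=prod])
  finally show "emeasure ?L ?X = (\<Prod>j\<in>K. emeasure M (F j))" .
qed simp

lemma
  fixes F :: "(nat \<Rightarrow> 'a) \<Rightarrow> 'b::{banach,second_countable_topology}"
  assumes "integrable P F"
  shows integrable_merge_coords: "integrable (P \<Otimes>\<^sub>M P) (\<lambda>p. F (merge_coords J (fst p) (snd p)))"
    and integral_merge_coords: "(\<integral>x. \<integral>y. F (merge_coords J x y) \<partial>P \<partial>P) = integral\<^sup>L P F"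
proof -
  have F [measurable]: "F \<in> borel_measurable P" using assms by simp
  show *: "integrable (P \<Otimes>\<^sub>M P) (\<lambda>p. F (merge_coords J (fst p) (snd p)))"
    using assms by (subst (asm) distr_merge_coords[of J, symmetric]) (simp add: integrable_distr_eq)
  have "integral\<^sup>L P F = (\<integral>p. F (merge_coords J (fst p) (snd p)) \<partial>(P \<Otimes>\<^sub>M P))"
    by (subst distr_merge_coords[of J, symmetric]) (simp add: integral_distr)
  also have "\<dots> = (\<integral>x. \<integral>y. F (merge_coords J x y) \<partial>P \<partial>P)"
    using P2.integral_fst'[of "\<lambda>p. F (merge_coords J (fst p) (snd p))"] * by simp
  finally show "(\<integral>x. \<integral>y. F (merge_coords J x y) \<partial>P \<partial>P) = integral\<^sup>L P F" ..
qed

text \<open>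
  Bounded measurable functions, normalised to vanish outside the space of the measure. Boundedness makes
  all partial integrals exist at every point, and the normalisation turns identities that hold on the space
  into equations between functions.
\<close>

definition bmf :: "((nat \<Rightarrow> 'a) \<Rightarrow> 'b::real_normed_vector) \<Rightarrow> bool"
  where "bmf f \<longleftrightarrow> f \<in> borel_measurable P \<and> (\<forall>x. x \<notin> space P \<longrightarrow> f x = 0) \<and> (\<exists>c. \<forall>x. norm (f x) \<le> c)"

text \<open>
  The conditional expectation given the coordinates outside \<open>J\<close>.
\<close>

definition avg :: "nat set \<Rightarrow> ((nat \<Rightarrow> 'a) \<Rightarrow> 'b::{banach,second_countable_topology}) \<Rightarrow> (nat \<Rightarrow> 'a) \<Rightarrow> 'b"
  where "avg J f = (\<lambda>x. if x \<in> space P then \<integral>y. f (merge_coords J x y) \<partial>P else 0)"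

lemma bmfI:
  assumes "f \<in> borel_measurable P" "\<And>x. x \<notin> space P \<Longrightarrow> f x = 0" "\<And>x. x \<in> space P \<Longrightarrow> norm (f x) \<le> c"
  shows "bmf f"
proof -
  have "norm (f x) \<le> max c 0" for x using assms(2,3)[of x] by (cases "x \<in> space P") auto
  then show ?thesis using assms(1,2) unfolding bmf_def by blast
qed

lemma bmf_measurable [measurable_dest]: "bmf f \<Longrightarrow> f \<in> borel_measurable P"
  by (simp add: bmf_def)

lemma bmf_outside: "bmf f \<Longrightarrow> x \<notin> space P \<Longrightarrow> f x = 0"
  by (simp add: bmf_def)

lemma bmf_bounded:
  assumes "bmf f" obtains c where "c \<ge> 0" "\<And>x. norm (f x) \<le> c"
  using assms norm_ge_zero order_trans unfolding bmf_def by blast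

lemma bmf_integrable [simp]:
  fixes f :: "(nat \<Rightarrow> 'a) \<Rightarrow> 'b::{banach,second_countable_topology}"
  assumes "bmf f" shows "integrable P f"
proof -
  obtain c where "c \<ge> 0" "\<And>x. norm (f x) \<le> c" using bmf_bounded[OF assms] by blast
  then show ?thesis
    using assms by (intro P.integrable_const_bound[of f c]) auto
qed

lemma bmf_section_integrable:
  fixes f :: "(nat \<Rightarrow> 'a) \<Rightarrow> 'b::{banach,second_countable_topology}"
  assumes "bmf f" "x \<in> space P" shows "integrable P (\<lambda>y. f (merge_coords J x y))"
proof -
  obtain c where "c \<ge> 0" "\<And>x. norm (f x) \<le> c" using bmf_bounded[OF assms(1)] by blast
  moreover have [measurable]: "f \<in> borel_measurable P" "x \<in> space P" using assms by (auto simp: bmf_def)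
  ultimately show ?thesis by (intro P.integrable_const_bound[of _ c]) auto
qed

lemma bmf_zero [simp, intro]: "bmf (\<lambda>_. 0)"
  by (rule bmfI[of _ 0]) auto

lemma bmf_add [simp, intro]:
  fixes f g :: "(nat \<Rightarrow> 'a) \<Rightarrow> 'b::{real_normed_vector,second_countable_topology}"
  assumes f: "bmf f" and g: "bmf g" shows "bmf (\<lambda>x. f x + g x)"
proof -
  obtain c where c: "\<And>x. norm (f x) \<le> c" using bmf_bounded[OF f] by blast
  obtain d where d: "\<And>x. norm (g x) \<le> d" using bmf_bounded[OF g] by blast
  show ?thesis
    by (rule bmfI[of _ "c + d"])
      (use f g c d in \<open>auto simp: bmf_outside intro!: norm_triangle_le add_mono\<close>)
qed

lemma bmf_scaleR [simp, intro]:
  fixes f :: "(nat \<Rightarrow> 'a) \<Rightarrow> 'b::{real_normed_vector,second_countable_topology}"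
  assumes f: "bmf f" shows "bmf (\<lambda>x. a *\<^sub>R f x)"
proof -
  obtain c where c: "\<And>x. norm (f x) \<le> c" using bmf_bounded[OF f] by blast
  show ?thesis
    by (rule bmfI[of _ "\<bar>a\<bar> * c"]) (use f c in \<open>auto simp: bmf_outside intro!: mult_left_mono\<close>)
qed

lemma bmf_uminus [simp, intro]:
  fixes f :: "(nat \<Rightarrow> 'a) \<Rightarrow> 'b::{real_normed_vector,second_countable_topology}"
  shows "bmf f \<Longrightarrow> bmf (\<lambda>x. - f x)"
  using bmf_scaleR[of f "-1"] by simp

lemma bmf_diff [simp, intro]:
  fixes f g :: "(nat \<Rightarrow> 'a) \<Rightarrow> 'b::{real_normed_vector,second_countable_topology}"
  shows "bmf f \<Longrightarrow> bmf g \<Longrightarrow> bmf (\<lambda>x. f x - g x)"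
  using bmf_add[of f "\<lambda>x. - g x"] by simp

lemma bmf_sum [simp, intro]:
  fixes f :: "'i \<Rightarrow> (nat \<Rightarrow> 'a) \<Rightarrow> 'b::{real_normed_vector,second_countable_topology}"
  assumes "\<And>i. i \<in> A \<Longrightarrow> bmf (f i)" shows "bmf (\<lambda>x. \<Sum>i\<in>A. f i x)"
  using assms by (induction A rule: infinite_finite_induct) auto

lemma bmf_inner [simp, intro]:
  fixes f g :: "(nat \<Rightarrow> 'a) \<Rightarrow> 'b::{real_inner,second_countable_topology}"
  assumes f: "bmf f" and g: "bmf g" shows "bmf (\<lambda>x. f x \<bullet> g x)"
proof -
  obtain c where c: "c \<ge> 0" "\<And>x. norm (f x) \<le> c" using bmf_bounded[OF f] by blast
  obtain d where d: "\<And>x. norm (g x) \<le> d" using bmf_bounded[OF g] by blast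
  show ?thesis
  proof (rule bmfI[of _ "c * d"])
    fix x
    have "\<bar>f x \<bullet> g x\<bar> \<le> norm (f x) * norm (g x)" by (rule Cauchy_Schwarz_ineq2)
    also have "\<dots> \<le> c * d" using c d by (intro mult_mono) auto
    finally show "norm (f x \<bullet> g x) \<le> c * d" by simp
  qed (use f g in \<open>auto simp: bmf_outside\<close>)
qed

lemma bmf_mult [simp, intro]:
  fixes f g :: "(nat \<Rightarrow> 'a) \<Rightarrow> real"
  shows "bmf f \<Longrightarrow> bmf g \<Longrightarrow> bmf (\<lambda>x. f x * g x)"
  using bmf_inner[of f g] by simp

lemma bmf_power2 [simp, intro]:
  fixes f :: "(nat \<Rightarrow> 'a) \<Rightarrow> real"
  shows "bmf f \<Longrightarrow> bmf (\<lambda>x. (f x)\<^sup>2)"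
  using bmf_mult[of f f] by (simp add: power2_eq_square)

lemma bmf_cmult [simp, intro]: "bmf f \<Longrightarrow> bmf (\<lambda>x. (a::real) * f x)"
  using bmf_scaleR[of f a] by simp

lemma bmf_avg [simp, intro]:
  fixes f :: "(nat \<Rightarrow> 'a) \<Rightarrow> 'b::{banach,second_countable_topology}"
  assumes f: "bmf f" shows "bmf (avg J f)"
proof -
  obtain c where c: "c \<ge> 0" "\<And>x. norm (f x) \<le> c" using bmf_bounded[OF f] by blast
  have [measurable]: "f \<in> borel_measurable P" using f by (rule bmf_measurable)
  have "(\<lambda>p. f (merge_coords J (fst p) (snd p))) \<in> borel_measurable (P \<Otimes>\<^sub>M P)" by measurable
  then have [measurable]: "(\<lambda>x. \<integral>y. f (merge_coords J x y) \<partial>P) \<in> borel_measurable P"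
    by (intro P.borel_measurable_lebesgue_integral) (simp add: case_prod_unfold)
  show ?thesis
  proof (rule bmfI[of _ c])
    show "avg J f \<in> borel_measurable P"
      by (subst measurable_cong[of _ _ "\<lambda>x. \<integral>y. f (merge_coords J x y) \<partial>P"]) (auto simp: avg_def)
    fix x assume x: "x \<in> space P"
    have "norm (\<integral>y. f (merge_coords J x y) \<partial>P) \<le> (\<integral>y. norm (f (merge_coords J x y)) \<partial>P)" by simp
    also have "\<dots> \<le> (\<integral>y. c \<partial>P)"
      using bmf_section_integrable[OF f x, of J] c by (intro integral_mono) auto
    finally show "norm (avg J f x) \<le> c" using x by (simp add: avg_def P.prob_space)
  qed (auto simp: avg_def)
qed

lemma avg_empty [simp]: "bmf f \<Longrightarrow> avg {} f = f"
  by (rule ext) (auto simp: avg_def bmf_outside P.prob_space)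

lemma avg_avg:
  fixes f :: "(nat \<Rightarrow> 'a) \<Rightarrow> 'b::{banach,second_countable_topology}"
  assumes f: "bmf f" shows "avg J (avg K f) = avg (J \<union> K) f"
proof
  fix x show "avg J (avg K f) x = avg (J \<union> K) f x"
  proof (cases "x \<in> space P")
    case True
    have "avg J (avg K f) x = (\<integral>y. \<integral>z. f (merge_coords K (merge_coords J x y) z) \<partial>P \<partial>P)"
      using True by (auto simp: avg_def intro!: Bochner_Integration.integral_cong)
    also have "\<dots> = (\<integral>y. \<integral>z. f (merge_coords (J \<union> K) x (merge_coords K y z)) \<partial>P \<partial>P)"
      by (simp add: merge_coords_merge_coords)
    also have "\<dots> = (\<integral>y. f (merge_coords (J \<union> K) x y) \<partial>P)"
      by (rule integral_merge_coords, rule bmf_section_integrable) (use f True in auto)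
    finally show ?thesis using True by (simp add: avg_def)
  qed (simp add: avg_def)
qed

lemma integral_avg:
  fixes f :: "(nat \<Rightarrow> 'a) \<Rightarrow> 'b::{banach,second_countable_topology}"
  assumes f: "bmf f" shows "integral\<^sup>L P (avg J f) = integral\<^sup>L P f"
proof -
  have "integral\<^sup>L P (avg J f) = (\<integral>x. \<integral>y. f (merge_coords J x y) \<partial>P \<partial>P)"
    by (auto simp: avg_def intro!: Bochner_Integration.integral_cong)
  then show ?thesis using integral_merge_coords[OF bmf_integrable[OF f]] by simp
qed

lemma avg_zero [simp]: "avg J (\<lambda>_. 0) = (\<lambda>_. 0)"
  by (auto simp: avg_def)

lemma avg_add:
  fixes f g :: "(nat \<Rightarrow> 'a) \<Rightarrow> 'b::{banach,second_countable_topology}"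
  assumes "bmf f" "bmf g" shows "avg J (\<lambda>x. f x + g x) = (\<lambda>x. avg J f x + avg J g x)"
  by (rule ext) (simp add: avg_def Bochner_Integration.integral_add bmf_section_integrable assms)

lemma avg_diff:
  fixes f g :: "(nat \<Rightarrow> 'a) \<Rightarrow> 'b::{banach,second_countable_topology}"
  assumes "bmf f" "bmf g" shows "avg J (\<lambda>x. f x - g x) = (\<lambda>x. avg J f x - avg J g x)"
  by (rule ext) (simp add: avg_def Bochner_Integration.integral_diff bmf_section_integrable assms)

lemma avg_scaleR:
  fixes f :: "(nat \<Rightarrow> 'a) \<Rightarrow> 'b::{banach,second_countable_topology}"
  shows "avg J (\<lambda>x. a *\<^sub>R f x) = (\<lambda>x. a *\<^sub>R avg J f x)"
  by (rule ext) (simp add: avg_def)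

lemma avg_cmult: "avg J (\<lambda>x. (a::real) * f x) = (\<lambda>x. a * avg J f x)"
  using avg_scaleR[of J a f] by simp

lemma avg_sum:
  fixes f :: "'i \<Rightarrow> (nat \<Rightarrow> 'a) \<Rightarrow> 'b::{banach,second_countable_topology}"
  assumes "\<And>i. i \<in> A \<Longrightarrow> bmf (f i)"
  shows "avg J (\<lambda>x. \<Sum>i\<in>A. f i x) = (\<lambda>x. \<Sum>i\<in>A. avg J (f i) x)"
  using assms by (induction A rule: infinite_finite_induct) (auto simp: avg_add)

lemma avg_mono:
  fixes f g :: "(nat \<Rightarrow> 'a) \<Rightarrow> real"
  assumes "bmf f" "bmf g" "\<And>x. x \<in> space P \<Longrightarrow> f x \<le> g x" shows "avg J f x \<le> avg J g x"
  using assms by (auto simp: avg_def bmf_section_integrable intro!: integral_mono)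

lemma avg_le_const:
  assumes "bmf f" "\<And>x. x \<in> space P \<Longrightarrow> f x \<le> c" "(0::real) \<le> c" shows "avg J f x \<le> c"
proof (cases "x \<in> space P")
  case True
  have "(\<integral>y. f (merge_coords J x y) \<partial>P) \<le> (\<integral>y. c \<partial>P)"
    using assms True by (intro integral_mono) (auto simp: bmf_section_integrable)
  then show ?thesis using True by (simp add: avg_def P.prob_space)
qed (simp add: avg_def assms)

lemma avg_nonneg:
  fixes f :: "(nat \<Rightarrow> 'a) \<Rightarrow> real"
  assumes "\<And>x. 0 \<le> f x" shows "0 \<le> avg J f x"
  using assms by (auto simp: avg_def intro!: integral_nonneg)

text \<open>
  The function \<open>avg J f\<close> is constant in the coordinates over which the outer average is taken.
\<close>

lemma avg_inner_left:
  fixes f g :: "(nat \<Rightarrow> 'a) \<Rightarrow> 'b::{real_inner,banach,second_countable_topology}"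
  assumes "bmf f" "bmf g"
  shows "avg J (\<lambda>x. avg J f x \<bullet> g x) = (\<lambda>x. avg J f x \<bullet> avg J g x)"
proof
  fix x show "avg J (\<lambda>x. avg J f x \<bullet> g x) x = avg J f x \<bullet> avg J g x"
  proof (cases "x \<in> space P")
    case True
    have "avg J (\<lambda>x. avg J f x \<bullet> g x) x = (\<integral>y. avg J f x \<bullet> g (merge_coords J x y) \<partial>P)"
      using True by (auto simp: avg_def merge_coords_same_left intro!: Bochner_Integration.integral_cong)
    also have "\<dots> = avg J f x \<bullet> (\<integral>y. g (merge_coords J x y) \<partial>P)"
      using assms True by (intro integral_inner_right) (auto simp: bmf_section_integrable)
    finally show ?thesis using True by (simp add: avg_def)
  qed (simp add: avg_def)
qed

lemma avg_inner_right:
  fixes f g :: "(nat \<Rightarrow> 'a) \<Rightarrow> 'b::{real_inner,banach,second_countable_topology}"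
  assumes "bmf f" "bmf g"
  shows "avg J (\<lambda>x. g x \<bullet> avg J f x) = (\<lambda>x. avg J g x \<bullet> avg J f x)"
  using avg_inner_left[OF assms, of J] by (simp add: inner_commute)

lemma integral_avg_inner:
  fixes f g :: "(nat \<Rightarrow> 'a) \<Rightarrow> 'b::{real_inner,banach,second_countable_topology}"
  assumes "bmf f" "bmf g"
  shows "(\<integral>x. avg J f x \<bullet> g x \<partial>P) = (\<integral>x. f x \<bullet> avg J g x \<partial>P)"
proof -
  have "(\<integral>x. avg J f x \<bullet> g x \<partial>P) = (\<integral>x. avg J (\<lambda>x. avg J f x \<bullet> g x) x \<partial>P)"
    using assms by (subst integral_avg) auto
  also have "\<dots> = (\<integral>x. avg J (\<lambda>x. f x \<bullet> avg J g x) x \<partial>P)"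
    using assms by (simp add: avg_inner_left avg_inner_right)
  also have "\<dots> = (\<integral>x. f x \<bullet> avg J g x \<partial>P)"
    using assms by (subst integral_avg) auto
  finally show ?thesis .
qed

definition nsq :: "((nat \<Rightarrow> 'a) \<Rightarrow> 'b::real_inner) \<Rightarrow> (nat \<Rightarrow> 'a) \<Rightarrow> real"
  where "nsq f = (\<lambda>x. f x \<bullet> f x)"

lemma bmf_nsq [simp, intro]:
  fixes f :: "(nat \<Rightarrow> 'a) \<Rightarrow> 'b::{real_inner,second_countable_topology}"
  shows "bmf f \<Longrightarrow> bmf (nsq f)"
  unfolding nsq_def by auto

lemma nsq_nonneg [simp]: "0 \<le> nsq f x"
  by (simp add: nsq_def)

text \<open>
  Expand the variance \<open>avg J (nsq (f - avg J f))\<close>, which is nonnegative.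
\<close>

lemma nsq_avg_le:
  fixes f :: "(nat \<Rightarrow> 'a) \<Rightarrow> 'b::{real_inner,banach,second_countable_topology}"
  assumes f: "bmf f" shows "nsq (avg J f) x \<le> avg J (nsq f) x"
proof -
  have "0 \<le> avg J (nsq (\<lambda>x. f x - avg J f x)) x" by (rule avg_nonneg) simp
  also have "nsq (\<lambda>x. f x - avg J f x) = (\<lambda>x. nsq f x - 2 * (avg J f x \<bullet> f x) + avg J f x \<bullet> avg J f x)"
    by (auto simp: nsq_def inner_diff_left inner_diff_right inner_commute)
  also have "avg J \<dots> = (\<lambda>x. avg J (nsq f) x - nsq (avg J f) x)"
    using f avg_inner_left[of f "avg J f" J]
    by (simp add: avg_add avg_diff avg_cmult avg_inner_left avg_avg nsq_def)
  finally show ?thesis by simp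
qed

lemma nsq_add_le:
  fixes f g :: "(nat \<Rightarrow> 'a) \<Rightarrow> 'b::real_inner"
  shows "nsq (\<lambda>x. f x + g x) x \<le> 2 * nsq f x + 2 * nsq g x"
    and nsq_diff_le: "nsq (\<lambda>x. f x - g x) x \<le> 2 * nsq f x + 2 * nsq g x"
  using inner_ge_zero[of "f x - g x"] inner_ge_zero[of "f x + g x"]
  by (simp_all add: nsq_def inner_diff_left inner_diff_right inner_add_left inner_add_right inner_commute)

lemma nsq_scaleR: "nsq (\<lambda>x. a *\<^sub>R f x) = (\<lambda>x. a\<^sup>2 * nsq f x)"
  by (simp add: nsq_def power2_eq_square mult.assoc)

end

section \<open>Chaos projections\<close>

lemma sum_Pow_insert:
  assumes "finite B" "b \<notin> B"
  shows "sum F (Pow (insert b B)) = sum F (Pow B) + (\<Sum>J\<in>Pow B. F (insert b J))"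
proof -
  have "inj_on (insert b) (Pow B)" using assms(2) by (auto simp: inj_on_def)
  moreover have "Pow B \<inter> insert b ` Pow B = {}" using assms(2) by auto
  ultimately show ?thesis
    using assms by (simp add: Pow_insert sum.union_disjoint sum.reindex)
qed

lemma sum_card_subsets_insert:
  assumes "finite B" "b \<notin> B"
  shows "sum F {A. A \<subseteq> insert b B \<and> card A = Suc k}
    = sum F {A. A \<subseteq> B \<and> card A = Suc k} + (\<Sum>A | A \<subseteq> B \<and> card A = k. F (insert b A))"
proof -
  let ?S = "\<lambda>k. {A. A \<subseteq> B \<and> card A = k}"
  have fin: "finite (?S k)" for k using assms(1) by (auto intro: finite_subset[of _ "Pow B"])
  have "inj_on (insert b) (?S k)" using assms(2) by (auto simp: inj_on_def)
  moreover have "?S (Suc k) \<inter> insert b ` ?S k = {}" using assms(2) by auto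
  moreover have "{A. A \<subseteq> insert b B \<and> card A = Suc k} = ?S (Suc k) \<union> insert b ` ?S k" (is "?L = ?R")
  proof
    show "?R \<subseteq> ?L"
      using assms by (auto simp: card_insert_if finite_subset)
    show "?L \<subseteq> ?R"
    proof
      fix A assume A: "A \<in> ?L"
      show "A \<in> ?R"
      proof (cases "b \<in> A")
        case True
        have "A - {b} \<in> ?S k" using A True assms by (auto simp: card_Diff_singleton finite_subset)
        moreover have "A = insert b (A - {b})" using True by auto
        ultimately show ?thesis by blast
      qed (use A in auto)
    qed
  qed
  ultimately show ?thesis
    by (simp add: sum.union_disjoint sum.reindex fin)
qed

context coordinate_space
begin

definition centre :: "nat \<Rightarrow> ((nat \<Rightarrow> 'a) \<Rightarrow> 'b::{banach,second_countable_topology}) \<Rightarrow> (nat \<Rightarrow> 'a) \<Rightarrow> 'b"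
  where "centre b f = (\<lambda>x. f x - avg {b} f x)"

text \<open>
  The product of the operators \<open>centre b\<close> over \<open>b \<in> B\<close>, multiplied out.
\<close>

definition centre_all :: "nat set \<Rightarrow> ((nat \<Rightarrow> 'a) \<Rightarrow> 'b::{banach,second_countable_topology}) \<Rightarrow> (nat \<Rightarrow> 'a) \<Rightarrow> 'b"
  where "centre_all B f = (\<lambda>x. \<Sum>J\<in>Pow B. (- 1) ^ card J *\<^sub>R avg J f x)"

text \<open>
  The sum of the Hoeffding components of order \<open>k\<close> with respect to the coordinates in \<open>I\<close>; the
  coordinates outside \<open>I\<close> are parameters. Letting \<open>I\<close> vary allows to split off one coordinate at a time.
\<close>

definition chaos :: "nat set \<Rightarrow> nat \<Rightarrow> ((nat \<Rightarrow> 'a) \<Rightarrow> 'b::{banach,second_countable_topology}) \<Rightarrow> (nat \<Rightarrow> 'a) \<Rightarrow> 'b"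
  where "chaos I k f = (\<lambda>x. \<Sum>A | A \<subseteq> I \<and> card A = k. centre_all A (avg (I - A) f) x)"

lemma bmf_centre [simp, intro]: "bmf f \<Longrightarrow> bmf (centre b f)"
  unfolding centre_def by auto

lemma bmf_centre_all [simp, intro]: "bmf f \<Longrightarrow> bmf (centre_all B f)"
  unfolding centre_all_def by auto

lemma bmf_chaos [simp, intro]: "bmf f \<Longrightarrow> bmf (chaos I k f)"
  unfolding chaos_def by auto

lemma centre_all_add:
  assumes "bmf f" "bmf g" shows "centre_all B (\<lambda>x. f x + g x) = (\<lambda>x. centre_all B f x + centre_all B g x)"
  using assms by (simp add: centre_all_def avg_add scaleR_add_right sum.distrib)

lemma centre_all_scaleR: "centre_all B (\<lambda>x. a *\<^sub>R f x) = (\<lambda>x. a *\<^sub>R centre_all B f x)"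
  by (simp add: centre_all_def avg_scaleR scaleR_sum_right mult.commute)

lemma centre_all_zero [simp]: "centre_all B (\<lambda>x. 0) = (\<lambda>x. 0)"
  by (simp add: centre_all_def)

lemma centre_all_empty [simp]: "bmf f \<Longrightarrow> centre_all {} f = f"
  by (simp add: centre_all_def)

lemma avg_centre_all:
  assumes "bmf f" shows "avg J (centre_all B f) = centre_all B (avg J f)"
  using assms by (simp add: centre_all_def avg_sum avg_scaleR avg_avg Un_commute)

lemma avg_centre:
  assumes "bmf f" shows "avg J (centre b f) = centre b (avg J f)"
  using assms by (simp add: centre_def avg_diff avg_avg Un_commute)

lemma avg_centre_eq_0: "bmf f \<Longrightarrow> b \<in> J \<Longrightarrow> avg J (centre b f) = (\<lambda>x. 0)"
  by (simp add: centre_def avg_diff avg_avg insert_absorb)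

lemma centre_add:
  assumes "bmf f" "bmf g" shows "centre b (\<lambda>x. f x + g x) = (\<lambda>x. centre b f x + centre b g x)"
  using assms by (simp add: centre_def avg_add algebra_simps)

lemma centre_idem: "bmf f \<Longrightarrow> centre b (centre b f) = centre b f"
  unfolding centre_def[of b "centre b f"] by (simp add: avg_centre_eq_0)

lemma centre_avg_eq_0: "bmf f \<Longrightarrow> b \<in> J \<Longrightarrow> centre b (avg J f) = (\<lambda>x. 0)"
  by (simp add: centre_def avg_avg insert_absorb)

lemma centre_all_insert:
  assumes "bmf f" "finite B" "b \<notin> B"
  shows "centre_all (insert b B) f = centre_all B (centre b f)"
proof
  fix x
  have "(\<Sum>J\<in>Pow B. (- 1) ^ card (insert b J) *\<^sub>R avg (insert b J) f x)
      = (\<Sum>J\<in>Pow B. - ((- 1) ^ card J *\<^sub>R avg J (avg {b} f) x))"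
    using assms by (intro sum.cong) (auto simp: avg_avg card_insert_if finite_subset insert_absorb)
  then show "centre_all (insert b B) f x = centre_all B (centre b f) x"
    using assms
    by (simp add: centre_all_def centre_def avg_diff sum_Pow_insert scaleR_diff_right sum_subtractf sum_negf)
qed

lemma centre_all_Diff:
  assumes "bmf f" "finite B" "b \<in> B"
  shows "centre_all B f = centre_all (B - {b}) (centre b f)"
  using centre_all_insert[of f "B - {b}" b] assms by (simp add: insert_absorb)

lemma chaos_empty_0 [simp]: "bmf f \<Longrightarrow> chaos {} 0 f = f"
proof -
  have "{A :: nat set. A \<subseteq> {} \<and> card A = 0} = {{}}" by auto
  then show "bmf f \<Longrightarrow> chaos {} 0 f = f" unfolding chaos_def by (simp only: sum.insert) simp
qed

lemma chaos_empty_Suc [simp]: "chaos {} (Suc k) f = (\<lambda>x. 0)"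
proof -
  have "{A :: nat set. A \<subseteq> {} \<and> card A = Suc k} = {}" by auto
  then show ?thesis unfolding chaos_def by (simp only: sum.empty)
qed

lemma chaos_0: "bmf f \<Longrightarrow> finite I \<Longrightarrow> chaos I 0 f = avg I f"
proof -
  assume "finite I" "bmf f"
  then have "{A. A \<subseteq> I \<and> card A = 0} = {{}}" by (auto dest: finite_subset)
  then show ?thesis using \<open>bmf f\<close> unfolding chaos_def by simp
qed

lemma chaos_insert_0:
  assumes "bmf f" "finite I"
  shows "chaos (insert b I) 0 f = chaos I 0 (avg {b} f)"
  using assms by (simp add: chaos_0 avg_avg)

text \<open>
  A Hoeffding component of order \<open>k + 1\<close> either ignores the coordinate \<open>b\<close> or is centred in it. This
  recursion, together with \<open>chaos_insert_0\<close>, drives all inductions over \<open>I\<close> below.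
\<close>

lemma chaos_insert_Suc:
  assumes f: "bmf f" and I: "finite I" "b \<notin> I"
  shows "chaos (insert b I) (Suc k) f = (\<lambda>x. chaos I (Suc k) (avg {b} f) x + chaos I k (centre b f) x)"
proof
  fix x
  have "chaos (insert b I) (Suc k) f x
      = (\<Sum>A | A \<subseteq> I \<and> card A = Suc k. centre_all A (avg (insert b I - A) f) x)
      + (\<Sum>A | A \<subseteq> I \<and> card A = k. centre_all (insert b A) (avg (insert b I - insert b A) f) x)"
    unfolding chaos_def by (rule sum_card_subsets_insert[OF I])
  also have "(\<Sum>A | A \<subseteq> I \<and> card A = Suc k. centre_all A (avg (insert b I - A) f) x)
      = chaos I (Suc k) (avg {b} f) x"
    unfolding chaos_def using f I(2)
    by (intro sum.cong refl) (auto simp: avg_avg insert_Diff_if)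
  also have "(\<Sum>A | A \<subseteq> I \<and> card A = k. centre_all (insert b A) (avg (insert b I - insert b A) f) x)
      = chaos I k (centre b f) x"
    unfolding chaos_def
  proof (intro sum.cong refl)
    fix A assume "A \<in> {A. A \<subseteq> I \<and> card A = k}"
    then have "finite A" "b \<notin> A" "insert b I - insert b A = I - A" using I by (auto intro: finite_subset)
    then show "centre_all (insert b A) (avg (insert b I - insert b A) f) x = centre_all A (avg (I - A) (centre b f)) x"
      using f by (simp add: centre_all_insert avg_centre)
  qed
  finally show "chaos (insert b I) (Suc k) f x = chaos I (Suc k) (avg {b} f) x + chaos I k (centre b f) x" .
qed

lemma chaos_add:
  assumes "bmf f" "bmf g" shows "chaos I k (\<lambda>x. f x + g x) = (\<lambda>x. chaos I k f x + chaos I k g x)"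
  using assms by (simp add: chaos_def avg_add centre_all_add sum.distrib)

lemma chaos_scaleR: "chaos I k (\<lambda>x. a *\<^sub>R f x) = (\<lambda>x. a *\<^sub>R chaos I k f x)"
  by (simp add: chaos_def avg_scaleR centre_all_scaleR scaleR_sum_right)

lemma chaos_diff:
  assumes "bmf f" "bmf g" shows "chaos I k (\<lambda>x. f x - g x) = (\<lambda>x. chaos I k f x - chaos I k g x)"
  using chaos_add[of f "\<lambda>x. - g x" I k] chaos_scaleR[of I k "-1" g] assms by simp

lemma chaos_zero [simp]: "chaos I k (\<lambda>x. 0) = (\<lambda>x. 0)"
  by (simp add: chaos_def)

lemma avg_chaos:
  assumes "bmf f" shows "avg J (chaos I k f) = chaos I k (avg J f)"
  using assms by (simp add: chaos_def avg_sum avg_centre_all avg_avg Un_commute)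

lemma centre_chaos:
  assumes "bmf f" shows "centre b (chaos I k f) = chaos I k (centre b f)"
  using assms by (simp add: centre_def chaos_diff avg_chaos)

lemma integral_centre_all_inner:
  fixes f g :: "(nat \<Rightarrow> 'a) \<Rightarrow> 'b::{real_inner,banach,second_countable_topology}"
  assumes "bmf f" "bmf g"
  shows "(\<integral>x. centre_all B f x \<bullet> g x \<partial>P) = (\<integral>x. f x \<bullet> centre_all B g x \<partial>P)"
  using assms by (simp add: centre_all_def inner_sum_left inner_sum_right integral_avg_inner)

lemma integral_chaos_inner:
  fixes f g :: "(nat \<Rightarrow> 'a) \<Rightarrow> 'b::{real_inner,banach,second_countable_topology}"
  assumes "bmf f" "bmf g"
  shows "(\<integral>x. chaos I k f x \<bullet> g x \<partial>P) = (\<integral>x. f x \<bullet> chaos I k g x \<partial>P)"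
  using assms
  by (simp add: chaos_def inner_sum_left inner_sum_right integral_centre_all_inner integral_avg_inner avg_centre_all)

lemma chaos_idem:
  assumes "bmf f" "finite I" shows "chaos I k (chaos I k f) = chaos I k f"
  using assms(2,1)
proof (induction I arbitrary: k f rule: finite_induct)
  case empty then show ?case by (cases k) auto
next
  case (insert b I)
  show ?case
  proof (cases k)
    case 0
    then show ?thesis using insert by (simp add: chaos_insert_0 avg_chaos avg_avg)
  next
    case (Suc j)
    have "avg {b} (chaos (insert b I) k f) = chaos I k (avg {b} f)"
      using insert.prems insert.hyps
      by (simp add: Suc chaos_insert_Suc avg_add avg_chaos avg_avg avg_centre_eq_0)
    moreover have "centre b (chaos (insert b I) k f) = chaos I j (centre b f)"
      using insert.prems insert.hyps
      by (simp add: Suc chaos_insert_Suc centre_add centre_chaos centre_idem centre_avg_eq_0)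
    ultimately show ?thesis
      using insert.prems insert.hyps insert.IH by (simp add: Suc chaos_insert_Suc)
  qed
qed

lemma avg_insert: "bmf f \<Longrightarrow> avg (insert b J) f = avg J (avg {b} f)"
  by (simp add: avg_avg)

text \<open>
  Pythagoras in the coordinates \<open>J\<close>: a function that ignores them is orthogonal to one with vanishing
  average over them.
\<close>

lemma avg_nsq_orthogonal:
  fixes u v :: "(nat \<Rightarrow> 'a) \<Rightarrow> 'b::{real_inner,banach,second_countable_topology}"
  assumes "bmf u" "bmf v" and u: "avg J u = u" and v: "avg J v = (\<lambda>x. 0)"
  shows "avg J (nsq (\<lambda>x. u x + v x)) = (\<lambda>x. nsq u x + avg J (nsq v) x)"
proof -
  have "nsq (\<lambda>x. u x + v x) = (\<lambda>x. (u x \<bullet> u x + 2 * (u x \<bullet> v x)) + v x \<bullet> v x)"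
    by (auto simp: nsq_def inner_add_left inner_add_right inner_commute)
  moreover have "avg J (\<lambda>x. u x \<bullet> u x) = (\<lambda>x. u x \<bullet> u x)"
    using avg_inner_left[of u u J] assms by simp
  moreover have "avg J (\<lambda>x. u x \<bullet> v x) = (\<lambda>x. 0)"
    using avg_inner_left[of u v J] assms by simp
  ultimately show ?thesis using assms(1,2)
    by (simp add: avg_add avg_cmult nsq_def)
qed

lemma avg_nsq_avg_centre:
  fixes f :: "(nat \<Rightarrow> 'a) \<Rightarrow> 'b::{real_inner,banach,second_countable_topology}"
  assumes "bmf f"
  shows "avg {b} (nsq f) = (\<lambda>x. nsq (avg {b} f) x + avg {b} (nsq (centre b f)) x)"
  using avg_nsq_orthogonal[of "avg {b} f" "centre b f" "{b}"] assms
  by (simp add: avg_avg avg_centre_eq_0) (simp add: centre_def)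

lemma avg_nsq_chaos_insert:
  fixes f :: "(nat \<Rightarrow> 'a) \<Rightarrow> 'b::{real_inner,banach,second_countable_topology}"
  assumes f: "bmf f" and I: "finite I" "b \<notin> I"
  shows "avg {b} (nsq (chaos (insert b I) (Suc k) f))
    = (\<lambda>x. nsq (chaos I (Suc k) (avg {b} f)) x + avg {b} (nsq (chaos I k (centre b f))) x)"
  unfolding chaos_insert_Suc[OF f I]
  by (rule avg_nsq_orthogonal) (use f in \<open>auto simp: avg_chaos avg_avg avg_centre_eq_0\<close>)

text \<open>
  The two terms of the recursion are orthogonal in the coordinate \<open>b\<close>, as are \<open>avg {b} f\<close> and
  \<open>centre b f\<close>, so that the contraction property is inherited from \<open>I\<close> to \<open>insert b I\<close>. The estimate holds
  pointwise in the parameters.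
\<close>

lemma avg_nsq_chaos_le:
  fixes f :: "(nat \<Rightarrow> 'a) \<Rightarrow> 'b::{real_inner,banach,second_countable_topology}"
  assumes "finite I" "bmf f" shows "avg I (nsq (chaos I k f)) x \<le> avg I (nsq f) x"
  using assms
proof (induction I arbitrary: k f x rule: finite_induct)
  case empty then show ?case by (cases k) (auto simp: nsq_def)
next
  case (insert b I)
  show ?case
  proof (cases k)
    case 0
    have "avg (insert b I) (nsq (chaos (insert b I) k f)) x \<le> avg (insert b I) (avg (insert b I) (nsq f)) x"
      using insert by (intro avg_mono) (auto simp: 0 chaos_0 nsq_avg_le)
    then show ?thesis using insert by (simp add: avg_avg)
  next
    case (Suc j)
    have "avg (insert b I) (nsq (chaos (insert b I) k f)) x
        = avg I (\<lambda>x. nsq (chaos I (Suc j) (avg {b} f)) x + avg {b} (nsq (chaos I j (centre b f))) x) x"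
      using insert by (simp add: avg_insert[of _ b I] Suc avg_nsq_chaos_insert)
    also have "\<dots> = avg I (nsq (chaos I (Suc j) (avg {b} f))) x + avg {b} (avg I (nsq (chaos I j (centre b f)))) x"
      using insert by (simp add: avg_add avg_avg Un_commute)
    also have "\<dots> \<le> avg I (nsq (avg {b} f)) x + avg {b} (avg I (nsq (centre b f))) x"
      using insert by (intro add_mono insert.IH avg_mono) auto
    also have "\<dots> = avg I (avg {b} (nsq f)) x"
      unfolding avg_nsq_avg_centre[OF insert.prems, of b]
      using insert by (simp add: avg_add) (simp add: avg_avg)
    finally show ?thesis using insert by (simp add: avg_avg)
  qed
qed

lemma integral_nsq_chaos_le:
  fixes f :: "(nat \<Rightarrow> 'a) \<Rightarrow> 'b::{real_inner,banach,second_countable_topology}"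
  assumes "finite I" "bmf f" shows "integral\<^sup>L P (nsq (chaos I k f)) \<le> integral\<^sup>L P (nsq f)"
proof -
  have "integral\<^sup>L P (avg I (nsq (chaos I k f))) \<le> integral\<^sup>L P (avg I (nsq f))"
    using assms by (intro integral_mono avg_nsq_chaos_le) auto
  then show ?thesis using assms by (simp add: integral_avg)
qed

section \<open>Global functions\<close>

text \<open>
  For every value of any \<open>k\<close> or fewer frozen coordinates in \<open>I\<close>, the mean square over the remaining ones is
  at most \<open>c\<close>. Since \<open>avg (I - K)\<close> leaves the coordinates in \<open>K\<close> as variables, freezing is expressed by a
  pointwise bound.
\<close>

definition global :: "nat set \<Rightarrow> nat \<Rightarrow> real \<Rightarrow> ((nat \<Rightarrow> 'a) \<Rightarrow> 'b::real_inner) \<Rightarrow> bool"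
  where "global I k c f \<longleftrightarrow> (\<forall>K\<subseteq>I. card K \<le> k \<longrightarrow> (\<forall>x. avg (I - K) (nsq f) x \<le> c))"

lemma globalD: "global I k c f \<Longrightarrow> K \<subseteq> I \<Longrightarrow> card K \<le> k \<Longrightarrow> avg (I - K) (nsq f) x \<le> c"
  by (simp add: global_def)

lemma global_nonneg: "global I k c f \<Longrightarrow> c \<ge> 0"
  using globalD[of I k c f "{}"] avg_nonneg[of "nsq f" I] by (force intro: order_trans)

lemma global_avg:
  fixes f :: "(nat \<Rightarrow> 'a) \<Rightarrow> 'b::{real_inner,banach,second_countable_topology}"
  assumes f: "bmf f" and g: "global (insert b I) k c f" and b: "b \<notin> I"
  shows "global I k c (avg {b} f)"
  unfolding global_def
proof safe
  fix K x assume K: "K \<subseteq> I" "card K \<le> k"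
  have "avg (I - K) (nsq (avg {b} f)) x \<le> avg (I - K) (avg {b} (nsq f)) x"
    using f by (intro avg_mono nsq_avg_le) auto
  also have "\<dots> = avg (insert b I - K) (nsq f) x"
    using f b K by (auto simp: avg_avg intro!: arg_cong[where f="\<lambda>J. avg J (nsq f) x"])
  also have "\<dots> \<le> c" using K by (intro globalD[OF g]) auto
  finally show "avg (I - K) (nsq (avg {b} f)) x \<le> c" .
qed

text \<open>
  Centring in \<open>b\<close> freezes \<open>b\<close> once and averages over it once. As this uses up one of the frozen
  coordinates, the admissible number drops from \<open>k + 1\<close> to \<open>k\<close>; this is exactly the drop of the order in
  the recursion for \<open>chaos\<close>.
\<close>

lemma global_centre:
  fixes f :: "(nat \<Rightarrow> 'a) \<Rightarrow> 'b::{real_inner,banach,second_countable_topology}"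
  assumes f: "bmf f" and g: "global (insert b I) (Suc k) c f" and b: "b \<notin> I" and I: "finite I"
  shows "global I k (4 * c) (centre b f)"
  unfolding global_def
proof safe
  fix K x assume K: "K \<subseteq> I" "card K \<le> k"
  have fin: "finite K" using K I finite_subset by auto
  have "avg (I - K) (nsq (centre b f)) x \<le> avg (I - K) (\<lambda>x. 2 * nsq f x + 2 * avg {b} (nsq f) x) x"
  proof (rule avg_mono)
    fix x
    have "nsq (centre b f) x \<le> 2 * nsq f x + 2 * nsq (avg {b} f) x"
      unfolding centre_def by (rule nsq_diff_le)
    also have "\<dots> \<le> 2 * nsq f x + 2 * avg {b} (nsq f) x" using nsq_avg_le[OF f] by simp
    finally show "nsq (centre b f) x \<le> 2 * nsq f x + 2 * avg {b} (nsq f) x" .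
  qed (use f in auto)
  also have "\<dots> = 2 * avg (I - K) (nsq f) x + 2 * avg (I - K) (avg {b} (nsq f)) x"
    using f by (simp add: avg_add avg_cmult)
  also have "avg (I - K) (avg {b} (nsq f)) x = avg (insert b I - K) (nsq f) x"
    using f b K by (auto simp: avg_avg intro!: arg_cong[where f="\<lambda>J. avg J (nsq f) x"])
  also have "\<dots> \<le> c" using K by (intro globalD[OF g]) auto
  finally have 1: "avg (I - K) (nsq (centre b f)) x \<le> 2 * avg (I - K) (nsq f) x + 2 * c" by simp
  have "avg (insert b I - insert b K) (nsq f) x \<le> c"
    using K fin by (intro globalD[OF g]) (auto simp: card_insert_if)
  moreover have "insert b I - insert b K = I - K" using b by auto
  ultimately show "avg (I - K) (nsq (centre b f)) x \<le> 4 * c" using 1 by simp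
qed

text \<open>
  Freezing the coordinates in \<open>B\<close> in a projection is undone one coordinate at a time by the recursion:
  each step replaces the function by \<open>avg {b} f\<close> and \<open>centre b f\<close>, at the price of the factor
  \<open>2 (1 + 4)\<close>. At the end the contraction property in the remaining coordinates applies.
\<close>

lemma nsq_chaos_le_of_global:
  fixes f :: "(nat \<Rightarrow> 'a) \<Rightarrow> 'b::{real_inner,banach,second_countable_topology}"
  assumes "finite B" "finite I" "B \<inter> I = {}" "bmf f" "global (I \<union> B) k c f"
  shows "avg I (nsq (chaos (I \<union> B) k f)) x \<le> 10 ^ card B * c"
  using assms
proof (induction B arbitrary: k c f x rule: finite_induct)
  case empty
  then show ?case using avg_nsq_chaos_le[of I f k x] globalD[of I k c f "{}" x] by simp
next
  case (insert b B)
  note [simp] = insert.prems(3)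
  have fin: "finite (I \<union> B)" and b: "b \<notin> I \<union> B" using insert by auto
  have g: "global (insert b (I \<union> B)) k c f" using insert.prems by simp
  note c = global_nonneg[OF g]
  have *: "avg I (nsq (chaos (I \<union> B) k (avg {b} f))) x \<le> 10 ^ card B * c"
    by (rule insert.IH) (use insert.prems global_avg[OF _ g b] in auto)
  show ?case
  proof (cases k)
    case 0
    have "10 ^ card B * c \<le> 10 ^ card (insert b B) * c"
      using c insert.hyps by (intro mult_right_mono power_increasing) auto
    then show ?thesis using * fin by (simp add: 0 chaos_insert_0)
  next
    case (Suc j)
    have **: "avg I (nsq (chaos (I \<union> B) j (centre b f))) x \<le> 10 ^ card B * (4 * c)"
      by (rule insert.IH) (use insert.prems global_centre[OF _ g[unfolded Suc] b fin] in auto)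
    have "avg I (nsq (chaos (I \<union> insert b B) k f)) x
        \<le> avg I (\<lambda>x. 2 * nsq (chaos (I \<union> B) k (avg {b} f)) x + 2 * nsq (chaos (I \<union> B) j (centre b f)) x) x"
      using fin b by (intro avg_mono) (auto simp: Suc chaos_insert_Suc nsq_add_le)
    also have "\<dots> = 2 * avg I (nsq (chaos (I \<union> B) k (avg {b} f))) x + 2 * avg I (nsq (chaos (I \<union> B) j (centre b f))) x"
      by (simp add: avg_add avg_cmult)
    also have "\<dots> \<le> 2 * (10 ^ card B * c) + 2 * (10 ^ card B * (4 * c))"
      using * ** by (intro add_mono mult_left_mono) auto
    finally show ?thesis using insert.hyps by (simp add: algebra_simps)
  qed
qed

text \<open>
  Although the projection does not preserve boundedness, it preserves globalness. In particular it maps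
  functions bounded by \<open>1\<close> to global ones.
\<close>

lemma global_chaos:
  fixes f :: "(nat \<Rightarrow> 'a) \<Rightarrow> 'b::{real_inner,banach,second_countable_topology}"
  assumes I: "finite I" and f: "bmf f" and g: "global I k c f"
  shows "global I k (10 ^ k * c) (chaos I k f)"
  unfolding global_def
proof safe
  fix K x assume K: "K \<subseteq> I" "card K \<le> k"
  then have eq: "I - K \<union> K = I" and "finite K" using I finite_subset by auto
  then have "avg (I - K) (nsq (chaos I k f)) x \<le> 10 ^ card K * c"
    using nsq_chaos_le_of_global[of K "I - K" f k c x] I f g by auto
  also have "\<dots> \<le> 10 ^ k * c"
    using K global_nonneg[OF g] by (intro mult_right_mono power_increasing) auto
  finally show "avg (I - K) (nsq (chaos I k f)) x \<le> 10 ^ k * c" .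
qed

section \<open>Fourth moments of global functions in a chaos\<close>

lemma centre_centre_all:
  "bmf f \<Longrightarrow> centre b (centre_all B f) = centre_all B (centre b f)"
  using centre_all_add[of f "\<lambda>x. - avg {b} f x" B] centre_all_scaleR[of B "-1" "avg {b} f"]
  by (simp add: centre_def avg_centre_all)

lemma avg_mult_left:
  fixes f g :: "(nat \<Rightarrow> 'a) \<Rightarrow> real"
  assumes "bmf f" "bmf g" "avg J f = f"
  shows "avg J (\<lambda>x. f x * g x) = (\<lambda>x. f x * avg J g x)"
  using avg_inner_left[of f g J] assms by simp

lemma avg_nsq_invariant:
  fixes f :: "(nat \<Rightarrow> 'a) \<Rightarrow> 'b::{real_inner,banach,second_countable_topology}"
  assumes "bmf f" "avg J f = f" shows "avg J (nsq f) = nsq f"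
  using avg_inner_left[of f f J] assms by (simp add: nsq_def)

text \<open>
  The generalised influence of the set \<open>B\<close>, as a function of the coordinates in \<open>B\<close>.
\<close>

definition influence :: "nat set \<Rightarrow> nat set \<Rightarrow> ((nat \<Rightarrow> 'a) \<Rightarrow> 'b::{real_inner,banach,second_countable_topology}) \<Rightarrow> (nat \<Rightarrow> 'a) \<Rightarrow> real"
  where "influence I B f = avg (I - B) (nsq (centre_all B f))"

definition energy :: "nat set \<Rightarrow> ((nat \<Rightarrow> 'a) \<Rightarrow> 'b::{real_inner,banach,second_countable_topology}) \<Rightarrow> ((nat \<Rightarrow> 'a) \<Rightarrow> 'b) \<Rightarrow> (nat \<Rightarrow> 'a) \<Rightarrow> real"
  where "energy I f g = (\<lambda>x. \<Sum>B\<in>Pow I. avg I (\<lambda>x. influence I B f x * influence I B g x) x)"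

lemma bmf_influence [simp, intro]: "bmf f \<Longrightarrow> bmf (influence I B f)"
  by (simp add: influence_def)

lemma influence_nonneg [simp]: "0 \<le> influence I B f x"
  by (simp add: influence_def avg_nonneg)

lemma bmf_energy [simp, intro]: "bmf f \<Longrightarrow> bmf g \<Longrightarrow> bmf (energy I f g)"
  by (auto simp: energy_def)

lemma energy_nonneg [simp]: "0 \<le> energy I f g x"
  by (auto simp: energy_def intro!: sum_nonneg avg_nonneg)

lemma influence_insert_notin:
  fixes f :: "(nat \<Rightarrow> 'a) \<Rightarrow> 'b::{real_inner,banach,second_countable_topology}"
  assumes f: "bmf f" and b: "b \<notin> I" "B \<subseteq> I"
  shows "influence (insert b I) B f = (\<lambda>x. influence I B (avg {b} f) x + avg {b} (influence I B (centre b f)) x)"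
proof -
  have "insert b I - B = insert b (I - B)" using b by auto
  then have "influence (insert b I) B f = avg (I - B) (avg {b} (nsq (centre_all B f)))"
    using f by (simp add: influence_def avg_avg)
  also have "\<dots> = avg (I - B) (\<lambda>x. nsq (centre_all B (avg {b} f)) x + avg {b} (nsq (centre_all B (centre b f))) x)"
    using f avg_nsq_avg_centre[of "centre_all B f" b] by (simp add: avg_centre_all centre_centre_all)
  also have "\<dots> = (\<lambda>x. influence I B (avg {b} f) x + avg {b} (influence I B (centre b f)) x)"
    using f by (simp add: influence_def avg_add avg_avg)
  finally show ?thesis .
qed

lemma influence_insert_in:
  assumes "bmf f" "b \<notin> I" "B \<subseteq> I" "finite I"
  shows "influence (insert b I) (insert b B) f = influence I B (centre b f)"
proof -
  have "insert b I - insert b B = I - B" "finite B" "b \<notin> B" using assms finite_subset by auto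
  then show ?thesis using assms by (simp add: influence_def centre_all_insert)
qed

lemma avg_influence_avg:
  fixes f :: "(nat \<Rightarrow> 'a) \<Rightarrow> 'b::{real_inner,banach,second_countable_topology}"
  assumes "bmf f" shows "avg {b} (influence I B (avg {b} f)) = influence I B (avg {b} f)"
proof -
  have "avg {b} (nsq (centre_all B (avg {b} f))) = nsq (centre_all B (avg {b} f))"
    using assms by (intro avg_nsq_invariant) (auto simp: avg_centre_all avg_avg)
  then have "avg (I - B) (avg {b} (nsq (centre_all B (avg {b} f)))) = influence I B (avg {b} f)"
    by (simp add: influence_def)
  then show ?thesis using assms by (simp add: influence_def avg_avg Un_commute)
qed

text \<open>
  The influences of \<open>f\<close> on the sets avoiding \<open>b\<close> are sums of the influences of \<open>avg {b} f\<close> and averages of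
  those of \<open>centre b f\<close>; on the sets containing \<open>b\<close> they are the influences of \<open>centre b f\<close>. In the product
  of two such sums only the term with two averages is discarded.
\<close>

lemma energy_insert_ge:
  fixes f g :: "(nat \<Rightarrow> 'a) \<Rightarrow> 'b::{real_inner,banach,second_countable_topology}"
  assumes f: "bmf f" and g: "bmf g" and I: "finite I" "b \<notin> I"
  defines "a \<equiv> avg {b} f" and "d \<equiv> centre b f" and "a' \<equiv> avg {b} g" and "d' \<equiv> centre b g"
  shows "avg {b} (\<lambda>x. energy I a a' x + energy I a d' x + energy I d a' x + energy I d d' x) x
    \<le> energy (insert b I) f g x"
proof -
  have [simp]: "bmf a" "bmf a'" "bmf d" "bmf d'" using f g by (auto simp: a_def d_def a'_def d'_def)
  let ?p = "\<lambda>B u v x. influence I B u x * influence I B v x"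
  have inv: "avg {b} (influence I B a) = influence I B a" "avg {b} (influence I B a') = influence I B a'" for B
    using f g by (simp_all add: a_def a'_def avg_influence_avg)
  have notin: "avg {b} (\<lambda>x. avg I (?p B a a') x + avg I (?p B a d') x + avg I (?p B d a') x) x
      \<le> avg (insert b I) (\<lambda>x. influence (insert b I) B f x * influence (insert b I) B g x) x"
    (is "?l \<le> ?r") if "B \<subseteq> I" for B
  proof -
    have 1: "avg {b} (?p B a d') = (\<lambda>x. influence I B a x * avg {b} (influence I B d') x)"
      by (rule avg_mult_left) (auto simp: inv)
    have 2: "avg {b} (?p B d a') = (\<lambda>x. avg {b} (influence I B d) x * influence I B a' x)"
      using avg_mult_left[of "influence I B a'" "influence I B d" "{b}"] by (simp add: inv mult.commute)
    have 3: "avg {b} (?p B a a') = ?p B a a'"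
      using avg_mult_left[of "influence I B a'" "influence I B a" "{b}"] by (simp add: inv mult.commute)
    have "?l = avg (insert b I) (\<lambda>x. avg {b} (?p B a a') x + avg {b} (?p B a d') x + avg {b} (?p B d a') x) x"
      by (simp add: avg_add avg_avg insert_absorb)
    also have "\<dots> \<le> ?r"
    proof (rule avg_mono)
      fix x
      have "avg {b} (?p B a a') x + avg {b} (?p B a d') x + avg {b} (?p B d a') x
        \<le> (influence I B a x + avg {b} (influence I B d) x) * (influence I B a' x + avg {b} (influence I B d') x)"
        unfolding 1 2 3 by (simp add: algebra_simps avg_nonneg)
      also have "\<dots> = influence (insert b I) B f x * influence (insert b I) B g x"
        unfolding a_def a'_def d_def d'_def
        by (simp add: influence_insert_notin[OF f I(2) that] influence_insert_notin[OF g I(2) that])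
      finally show "avg {b} (?p B a a') x + avg {b} (?p B a d') x + avg {b} (?p B d a') x
        \<le> influence (insert b I) B f x * influence (insert b I) B g x" .
    qed (use f g in auto)
    finally show ?thesis .
  qed
  have "avg {b} (\<lambda>x. energy I a a' x + energy I a d' x + energy I d a' x + energy I d d' x) x
    = (\<Sum>B\<in>Pow I. avg {b} (\<lambda>x. avg I (?p B a a') x + avg I (?p B a d') x + avg I (?p B d a') x) x)
      + (\<Sum>B\<in>Pow I. avg (insert b I) (?p B d d') x)"
    by (simp add: energy_def avg_add avg_sum avg_avg sum.distrib)
  also have "\<dots> \<le> energy (insert b I) f g x"
    unfolding energy_def sum_Pow_insert[OF I]
    using f g I by (intro add_mono sum_mono notin) (auto simp: influence_insert_in d_def d'_def)
  finally show ?thesis .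
qed

text \<open>
  The last two summands disappear after averaging over a coordinate that \<open>u\<close> and \<open>u'\<close> ignore and in which
  \<open>v\<close> and \<open>v'\<close> are centred. The remaining mixed products are bounded by the Cauchy-Schwarz inequality.
\<close>

lemma nsq_add_mult_le:
  fixes u v u' v' :: "(nat \<Rightarrow> 'a) \<Rightarrow> 'b::real_inner"
  shows "nsq (\<lambda>x. u x + v x) x * nsq (\<lambda>x. u' x + v' x) x
    \<le> nsq u x * nsq u' x + 4 * (nsq u x * nsq v' x) + 4 * (nsq v x * nsq u' x) + 3 * (nsq v x * nsq v' x)
      + 2 * (nsq u' x * (u x \<bullet> v x)) + 2 * (nsq u x * (u' x \<bullet> v' x))"
proof -
  define U V U' V' s t where defs: "U = nsq u x" "V = nsq v x" "U' = nsq u' x" "V' = nsq v' x"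
    "s = u x \<bullet> v x" "t = u' x \<bullet> v' x"
  have nn: "U \<ge> 0" "V \<ge> 0" "U' \<ge> 0" "V' \<ge> 0" by (auto simp: defs)
  have s: "2 * s \<le> U + V" and t: "2 * t \<le> U' + V'"
    using inner_ge_zero[of "u x - v x"] inner_ge_zero[of "u' x - v' x"]
    by (auto simp: defs nsq_def inner_diff_left inner_diff_right inner_commute)
  have 1: "2 * s * V' \<le> (U + V) * V'" and 2: "2 * t * V \<le> (U' + V') * V"
    using s t nn by (auto intro: mult_right_mono)
  have "2 * (s * t) \<le> 2 * ((norm (u x) * norm (v' x)) * (norm (v x) * norm (u' x)))"
  proof -
    have "\<bar>s * t\<bar> \<le> (norm (u x) * norm (v x)) * (norm (u' x) * norm (v' x))"
      unfolding abs_mult defs by (intro mult_mono Cauchy_Schwarz_ineq2) auto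
    then show ?thesis by (simp add: algebra_simps)
  qed
  also have "\<dots> \<le> (norm (u x) * norm (v' x))\<^sup>2 + (norm (v x) * norm (u' x))\<^sup>2"
    using sum_squares_bound[of "norm (u x) * norm (v' x)" "norm (v x) * norm (u' x)"] by (simp add: mult.assoc)
  also have "\<dots> = U * V' + V * U'"
    by (simp add: defs nsq_def power_mult_distrib power2_norm_eq_inner)
  finally have 3: "4 * (s * t) \<le> 2 * (U * V') + 2 * (V * U')" by simp
  have "nsq (\<lambda>x. u x + v x) x = U + 2 * s + V" "nsq (\<lambda>x. u' x + v' x) x = U' + 2 * t + V'"
    by (auto simp: defs nsq_def inner_add_left inner_add_right inner_commute)
  then show ?thesis
    using 1 2 3 by (simp add: defs[symmetric] algebra_simps)
qed

text \<open>
  Global hypercontractivity for fourth moments. The statement has to be bilinear in \<open>f\<close> and \<open>g\<close>: in the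
  induction step the mixed term pairs \<open>avg {b} f\<close> with \<open>centre b g\<close>, and for a bilinear energy the average
  over \<open>b\<close> of the energy of this pair is the mixed term of the energy on \<open>insert b I\<close>. The weights
  \<open>1/4\<close> absorb the constants \<open>4\<close> and \<open>3\<close> of \<open>nsq_add_mult_le\<close>, because the order of the
  centred part is smaller by one.
\<close>

lemma fourth_moment_chaos_le_energy:
  fixes f g :: "(nat \<Rightarrow> 'a) \<Rightarrow> 'b::{real_inner,banach,second_countable_topology}"
  assumes "finite I" "bmf f" "bmf g"
  shows "(1/4) ^ k * (1/4) ^ l * avg I (\<lambda>x. nsq (chaos I k f) x * nsq (chaos I l g) x) x \<le> energy I f g x"
  using assms
proof (induction I arbitrary: k l f g x rule: finite_induct)
  case empty
  have c: "nsq (chaos {} k f) x \<le> nsq f x" if "bmf f" for k and f :: "(nat \<Rightarrow> 'a) \<Rightarrow> 'b"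
    using avg_nsq_chaos_le[of "{}" f k x] that by simp
  have "(1/4) ^ k * (1/4) ^ l * (nsq (chaos {} k f) x * nsq (chaos {} l g) x) \<le> 1 * (nsq f x * nsq g x)"
    using empty by (intro mult_mono c mult_le_one power_le_one) auto
  then show ?case using empty by (simp add: energy_def influence_def)
next
  case (insert b I)
  note f = insert.prems(1) and g = insert.prems(2) and I = insert.hyps(1,2)
  \<comment> \<open>The two terms of the recursion for \<open>chaos\<close>; the second one is absent in order \<open>0\<close>.\<close>
  define upper where "upper k f = chaos I k (avg {b} f)" for k and f :: "(nat \<Rightarrow> 'a) \<Rightarrow> 'b"
  define lower where "lower k f = (case k of 0 \<Rightarrow> \<lambda>_. 0 | Suc j \<Rightarrow> chaos I j (centre b f))"
    for k and f :: "(nat \<Rightarrow> 'a) \<Rightarrow> 'b"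
  have split: "chaos (insert b I) k f = (\<lambda>x. upper k f x + lower k f x)" if "bmf f"
    for k and f :: "(nat \<Rightarrow> 'a) \<Rightarrow> 'b"
    using that I by (cases k) (auto simp: upper_def lower_def chaos_insert_0 chaos_insert_Suc)
  have [simp]: "bmf (upper k f)" "bmf (lower k f)" if "bmf f" for k and f :: "(nat \<Rightarrow> 'a) \<Rightarrow> 'b"
    using that by (auto simp: upper_def lower_def split: nat.split)
  have inv: "avg {b} (upper k f) = upper k f" and null: "avg {b} (lower k f) = (\<lambda>_. 0)" if "bmf f"
    for k and f :: "(nat \<Rightarrow> 'a) \<Rightarrow> 'b"
    using that by (auto simp: upper_def lower_def avg_chaos avg_avg avg_centre_eq_0 split: nat.split)
  define a d a' d' where ops: "a = avg {b} f" "d = centre b f" "a' = avg {b} g" "d' = centre b g"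
  have [simp]: "bmf a" "bmf a'" "bmf d" "bmf d'" using f g by (auto simp: ops)
  define u v u' v' where defs: "u = upper k f" "v = lower k f" "u' = upper l g" "v' = lower l g"
  have [simp]: "bmf u" "bmf v" "bmf u'" "bmf v'" using f g by (auto simp: defs)
  define w :: real where "w = (1/4) ^ k * (1/4) ^ l"
  have w: "w \<ge> 0" by (simp add: w_def)
  have uu: "w * avg I (\<lambda>x. nsq u x * nsq u' x) x \<le> energy I a a' x" for x
    using insert.IH[of a a' k l x] f g by (simp add: defs upper_def ops w_def)
  have uv: "w * (4 * avg I (\<lambda>x. nsq u x * nsq v' x) x) \<le> energy I a d' x" for x
  proof (cases l)
    case (Suc j)
    then show ?thesis using insert.IH[of a d' k j x] f g by (simp add: defs upper_def lower_def ops w_def)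
  qed (simp add: defs lower_def nsq_def)
  have vu: "w * (4 * avg I (\<lambda>x. nsq v x * nsq u' x) x) \<le> energy I d a' x" for x
  proof (cases k)
    case (Suc j)
    then show ?thesis using insert.IH[of d a' j l x] f g by (simp add: defs upper_def lower_def ops w_def)
  qed (simp add: defs lower_def nsq_def)
  have vv: "w * (3 * avg I (\<lambda>x. nsq v x * nsq v' x) x) \<le> energy I d d' x" for x
  proof (cases "k = 0 \<or> l = 0")
    case False
    then obtain i j where ij: "k = Suc i" "l = Suc j" by (metis not0_implies_Suc)
    have "w * (3 * avg I (\<lambda>x. nsq v x * nsq v' x) x) \<le> w * (16 * avg I (\<lambda>x. nsq v x * nsq v' x) x)"
      using w by (intro mult_left_mono mult_right_mono avg_nonneg) auto
    also have "\<dots> \<le> energy I d d' x"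
      using insert.IH[of d d' i j x] f g by (simp add: defs upper_def lower_def ops w_def ij)
    finally show ?thesis .
  qed (auto simp: defs lower_def nsq_def)
  let ?main = "\<lambda>x. nsq u x * nsq u' x + 4 * (nsq u x * nsq v' x) + 4 * (nsq v x * nsq u' x) + 3 * (nsq v x * nsq v' x)"
  have lin: "avg {b} (\<lambda>x. nsq p x * (q x \<bullet> r x)) = (\<lambda>_. 0)"
    if "bmf p" "avg {b} p = p" "bmf q" "avg {b} q = q" "bmf r" "avg {b} r = (\<lambda>_. 0)"
    for p q r :: "(nat \<Rightarrow> 'a) \<Rightarrow> 'b"
    using that avg_inner_left[of q r "{b}"]
    by (subst avg_mult_left) (auto simp: avg_nsq_invariant)
  have "avg (insert b I) (\<lambda>x. nsq (chaos (insert b I) k f) x * nsq (chaos (insert b I) l g) x) x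
    \<le> avg (insert b I) (\<lambda>x. ?main x + 2 * (nsq u' x * (u x \<bullet> v x)) + 2 * (nsq u x * (u' x \<bullet> v' x))) x"
    unfolding split[OF f] split[OF g] defs[symmetric] by (intro avg_mono nsq_add_mult_le) auto
  also have "\<dots> = avg (insert b I) (avg {b} (\<lambda>x. ?main x + 2 * (nsq u' x * (u x \<bullet> v x)) + 2 * (nsq u x * (u' x \<bullet> v' x)))) x"
    by (simp add: avg_avg insert_absorb)
  also have "avg {b} (\<lambda>x. ?main x + 2 * (nsq u' x * (u x \<bullet> v x)) + 2 * (nsq u x * (u' x \<bullet> v' x))) = avg {b} ?main"
  proof -
    have "avg {b} (\<lambda>x. nsq u' x * (u x \<bullet> v x)) = (\<lambda>_. 0)" "avg {b} (\<lambda>x. nsq u x * (u' x \<bullet> v' x)) = (\<lambda>_. 0)"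
      using f g by (auto intro!: lin simp: defs inv null)
    then show ?thesis by (simp add: avg_add avg_cmult)
  qed
  also have "avg (insert b I) (avg {b} ?main) x = avg {b} (avg I ?main) x"
    by (simp add: avg_avg insert_absorb)
  finally have "w * avg (insert b I) (\<lambda>x. nsq (chaos (insert b I) k f) x * nsq (chaos (insert b I) l g) x) x
    \<le> w * avg {b} (avg I ?main) x" using w by (rule mult_left_mono)
  also have "\<dots> = avg {b} (\<lambda>x. w * avg I ?main x) x" by (simp add: avg_cmult)
  also have "\<dots> \<le> avg {b} (\<lambda>x. energy I a a' x + energy I a d' x + energy I d a' x + energy I d d' x) x"
  proof (rule avg_mono)
    fix x
    have "avg I ?main x = avg I (\<lambda>x. nsq u x * nsq u' x) x + 4 * avg I (\<lambda>x. nsq u x * nsq v' x) x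
      + 4 * avg I (\<lambda>x. nsq v x * nsq u' x) x + 3 * avg I (\<lambda>x. nsq v x * nsq v' x) x"
      by (simp add: avg_add avg_cmult)
    then have "w * avg I ?main x = w * avg I (\<lambda>x. nsq u x * nsq u' x) x + w * (4 * avg I (\<lambda>x. nsq u x * nsq v' x) x)
      + w * (4 * avg I (\<lambda>x. nsq v x * nsq u' x) x) + w * (3 * avg I (\<lambda>x. nsq v x * nsq v' x) x)"
      by (simp add: distrib_left)
    then show "w * avg I ?main x \<le> energy I a a' x + energy I a d' x + energy I d a' x + energy I d d' x"
      using uu[of x] uv[of x] vu[of x] vv[of x] by linarith
  qed auto
  also have "\<dots> \<le> energy (insert b I) f g x"
    unfolding ops by (rule energy_insert_ge[OF f g I])
  finally show ?case unfolding w_def .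
qed

lemma centre_chaos_insert:
  assumes "bmf f" "finite I" "b \<notin> I"
  shows "centre b (chaos (insert b I) k f) = (case k of 0 \<Rightarrow> \<lambda>_. 0 | Suc j \<Rightarrow> chaos I j (centre b f))"
  using assms
  by (cases k) (auto simp: chaos_insert_0 chaos_insert_Suc centre_add centre_chaos centre_idem centre_avg_eq_0)

text \<open>
  A component of order \<open>k\<close> cannot depend genuinely on more than \<open>k\<close> coordinates.
\<close>

lemma centre_all_chaos_eq_0:
  assumes "finite I" "bmf f" "B \<subseteq> I" "k < card B"
  shows "centre_all B (chaos I k f) = (\<lambda>x. 0)"
  using assms
proof (induction I arbitrary: B k f rule: finite_induct)
  case (insert b I)
  have finB: "finite B" using insert.prems(2) insert.hyps(1) by (auto intro: finite_subset)
  show ?case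
  proof (cases "b \<in> B")
    case True
    then have "centre_all B (chaos (insert b I) k f) = centre_all (B - {b}) (centre b (chaos (insert b I) k f))"
      using insert finB by (intro centre_all_Diff) auto
    then show ?thesis
    proof (cases k)
      case (Suc j)
      have "centre_all (B - {b}) (chaos I j (centre b f)) = (\<lambda>x. 0)"
        using insert True finB Suc by (intro insert.IH) auto
      then show ?thesis using insert Suc
        using \<open>centre_all B _ = _\<close> by (simp add: centre_chaos_insert)
    qed (use insert in \<open>simp add: centre_chaos_insert\<close>)
  next
    case False
    then have B: "B \<subseteq> I" using insert by auto
    show ?thesis
    proof (cases k)
      case 0
      then show ?thesis using insert B by (simp add: chaos_insert_0)
    next
      case (Suc j)
      then show ?thesis using insert B by (simp add: chaos_insert_Suc centre_all_add)
    qed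
  qed
qed simp

text \<open>
  A component with coordinates \<open>A\<close> survives \<open>centre_all B\<close> only for \<open>B \<subseteq> A\<close>, so it is counted \<open>2\<^sup>k\<close> times.
\<close>

lemma sum_nsq_centre_all_chaos_le:
  fixes f :: "(nat \<Rightarrow> 'a) \<Rightarrow> 'b::{real_inner,banach,second_countable_topology}"
  assumes "finite I" "bmf f"
  shows "(\<Sum>B\<in>Pow I. avg I (nsq (centre_all B (chaos I k f))) x) \<le> 2 ^ k * avg I (nsq (chaos I k f)) x"
  using assms
proof (induction I arbitrary: k f x rule: finite_induct)
  case empty
  have "1 * nsq (chaos {} k f) x \<le> 2 ^ k * nsq (chaos {} k f) x" by (intro mult_right_mono) auto
  then show ?case using empty by simp
next
  case (insert b I)
  note f = insert.prems and I = insert.hyps(1,2)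
  let ?Q = "chaos (insert b I) k f"
  have avg_b: "avg (insert b I) h = avg I (avg {b} h)" if "bmf h" for h :: "(nat \<Rightarrow> 'a) \<Rightarrow> real"
    using that by (simp add: avg_avg)
  have ins: "avg (insert b I) (nsq (centre_all (insert b B) ?Q)) = avg (insert b I) (nsq (centre_all B (centre b ?Q)))"
    if "B \<in> Pow I" for B
  proof -
    have "finite B" "b \<notin> B" using that I finite_subset by auto
    then show ?thesis using f by (simp add: centre_all_insert)
  qed
  show ?case
  proof (cases k)
    case 0
    have "centre b ?Q = (\<lambda>_. 0)" using f I by (simp add: 0 centre_chaos_insert)
    then have "(\<Sum>B\<in>Pow I. avg (insert b I) (nsq (centre_all (insert b B) ?Q)) x) = 0"
      using ins by (simp add: nsq_def)
    moreover have inv: "avg {b} (nsq (centre_all B ?Q)) = nsq (centre_all B ?Q)" for B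
      using f I by (intro avg_nsq_invariant) (auto simp: 0 chaos_insert_0 avg_centre_all avg_chaos avg_avg)
    moreover have "avg {b} (nsq ?Q) = nsq ?Q" using inv[of "{}"] f by simp
    ultimately show ?thesis
      using insert.IH[of "avg {b} f" k x] f I
      by (simp add: sum_Pow_insert avg_b inv) (simp add: 0 chaos_insert_0)
  next
    case (Suc j)
    let ?u = "chaos I k (avg {b} f)" and ?v = "chaos I j (centre b f)"
    have c: "centre b ?Q = ?v" using f I by (simp add: Suc centre_chaos_insert)
    have a: "avg {b} ?Q = ?u"
      using f I by (simp add: Suc chaos_insert_Suc avg_add avg_chaos avg_avg avg_centre_eq_0)
    have split: "avg (insert b I) (nsq (centre_all B ?Q)) x
      = avg I (nsq (centre_all B ?u)) x + avg {b} (avg I (nsq (centre_all B ?v))) x" for B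
    proof -
      have "avg {b} (nsq (centre_all B ?Q)) = (\<lambda>x. nsq (centre_all B ?u) x + avg {b} (nsq (centre_all B ?v)) x)"
        using avg_nsq_avg_centre[of "centre_all B ?Q" b] f a c by (simp add: avg_centre_all centre_centre_all)
      then show ?thesis using f by (simp add: avg_b avg_add) (simp add: avg_avg Un_commute)
    qed
    have "(\<Sum>B\<in>Pow (insert b I). avg (insert b I) (nsq (centre_all B ?Q)) x)
      = (\<Sum>B\<in>Pow I. avg I (nsq (centre_all B ?u)) x) + 2 * (\<Sum>B\<in>Pow I. avg {b} (avg I (nsq (centre_all B ?v))) x)"
    proof -
      have "(\<Sum>B\<in>Pow I. avg (insert b I) (nsq (centre_all (insert b B) ?Q)) x)
        = (\<Sum>B\<in>Pow I. avg {b} (avg I (nsq (centre_all B ?v))) x)"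
        using f by (intro sum.cong refl) (simp only: ins c, simp add: avg_avg)
      moreover have "(\<Sum>B\<in>Pow I. avg (insert b I) (nsq (centre_all B ?Q)) x)
        = (\<Sum>B\<in>Pow I. avg I (nsq (centre_all B ?u)) x) + (\<Sum>B\<in>Pow I. avg {b} (avg I (nsq (centre_all B ?v))) x)"
        unfolding split by (rule sum.distrib)
      ultimately show ?thesis using I by (simp add: sum_Pow_insert)
    qed
    also have "(\<Sum>B\<in>Pow I. avg {b} (avg I (nsq (centre_all B ?v))) x)
      = avg {b} (\<lambda>x. \<Sum>B\<in>Pow I. avg I (nsq (centre_all B ?v)) x) x"
      using f by (subst avg_sum) auto
    also have "\<dots> \<le> avg {b} (\<lambda>x. 2 ^ j * avg I (nsq ?v) x) x"
      using f by (intro avg_mono insert.IH) auto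
    also have "\<dots> = 2 ^ j * avg {b} (avg I (nsq ?v)) x" by (simp add: avg_cmult)
    also have "(\<Sum>B\<in>Pow I. avg I (nsq (centre_all B ?u)) x) \<le> 2 ^ k * avg I (nsq ?u) x"
      using f by (intro insert.IH) auto
    finally show ?thesis
      using split[of "{}"] f by (simp add: Suc algebra_simps)
  qed
qed

lemma nsq_centre_all_le_of_global:
  fixes f :: "(nat \<Rightarrow> 'a) \<Rightarrow> 'b::{real_inner,banach,second_countable_topology}"
  assumes "finite B" "finite I" "B \<inter> I = {}" "bmf f" "global (I \<union> B) k c f" "card B \<le> k"
  shows "avg I (nsq (centre_all B f)) x \<le> 4 ^ card B * c"
  using assms
proof (induction B arbitrary: k c f rule: finite_induct)
  case empty
  then show ?case using globalD[of I k c f "{}" x] by simp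
next
  case (insert b B)
  then obtain j where k: "k = Suc j" by (cases k) auto
  have "avg I (nsq (centre_all B (centre b f))) x \<le> 4 ^ card B * (4 * c)"
    using insert global_centre[of f b "I \<union> B" j c] by (intro insert.IH[of "centre b f" j "4 * c"]) (auto simp: k)
  then show ?case using insert by (simp add: centre_all_insert)
qed

text \<open>
  In the energy one factor of each product of influences is bounded by \<open>4\<^sup>k c\<close> because of globalness (it
  vanishes for sets with more than \<open>k\<close> elements), and the other factors sum up to at most \<open>2\<^sup>k\<close> times the mean
  square. The constant is \<open>128 = 16 \<sqdot> 4 \<sqdot> 2\<close>.
\<close>

lemma fourth_moment_le_of_global:
  fixes f :: "(nat \<Rightarrow> 'a) \<Rightarrow> 'b::{real_inner,banach,second_countable_topology}"
  assumes I: "finite I" and f: "bmf f" and Q: "chaos I k f = f" and g: "global I k c f"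
  shows "avg I (\<lambda>x. (nsq f x)\<^sup>2) x \<le> 128 ^ k * c * avg I (nsq f) x"
proof -
  note c = global_nonneg[OF g]
  have infl: "influence I B f x \<le> 4 ^ k * c" if "B \<subseteq> I" for B x
  proof (cases "card B \<le> k")
    case True
    have "I - B \<union> B = I" "finite B" using that I finite_subset by auto
    then have "influence I B f x \<le> 4 ^ card B * c"
      unfolding influence_def using True I f g
      by (intro nsq_centre_all_le_of_global[of _ _ _ k]) auto
    also have "\<dots> \<le> 4 ^ k * c" using True c by (intro mult_right_mono power_increasing) auto
    finally show ?thesis .
  next
    case False
    then have "centre_all B f = (\<lambda>_. 0)" using centre_all_chaos_eq_0[OF I f that, of k] Q by simp
    then show ?thesis using c by (simp add: influence_def nsq_def)
  qed
  have "(1/16) ^ k * avg I (\<lambda>x. (nsq f x)\<^sup>2) x \<le> energy I f f x"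
    using fourth_moment_chaos_le_energy[OF I f f, of k k x]
    by (simp add: Q power2_eq_square flip: power_mult_distrib)
  also have "\<dots> \<le> (\<Sum>B\<in>Pow I. avg I (\<lambda>x. (4 ^ k * c) * influence I B f x) x)"
    unfolding energy_def using f by (intro sum_mono avg_mono mult_right_mono infl) auto
  also have "\<dots> = (4 ^ k * c) * (\<Sum>B\<in>Pow I. avg I (nsq (centre_all B f)) x)"
    using f by (simp add: avg_cmult sum_distrib_left influence_def avg_avg Un_absorb2 Diff_subset)
  also have "\<dots> \<le> (4 ^ k * c) * (2 ^ k * avg I (nsq f) x)"
    using sum_nsq_centre_all_chaos_le[OF I f, of k x] c Q by (intro mult_left_mono) auto
  finally have "16 ^ k * ((1/16) ^ k * avg I (\<lambda>x. (nsq f x)\<^sup>2) x) \<le> 16 ^ k * ((4 ^ k * c) * (2 ^ k * avg I (nsq f) x))"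
    by (intro mult_left_mono) auto
  moreover have "16 ^ k * ((4 ^ k * c) * (2 ^ k * avg I (nsq f) x)) = 128 ^ k * c * avg I (nsq f) x"
    by (simp add: algebra_simps flip: power_mult_distrib)
  ultimately show ?thesis by (simp add: power_one_over)
qed

text \<open>
  The fourth moment with the coordinates in \<open>B\<close> frozen. The frozen function is a sum of chaoses of orders
  up to \<open>k\<close> in the coordinates \<open>I\<close>, obtained by averaging over or centring in the elements of \<open>B\<close> one by one;
  globalness is passed on in such a way that each of them is global to the order that its fourth moment estimate
  requires. Each step costs the factor \<open>8 (1 + 4\<^sup>2)\<close>.
\<close>

lemma fourth_moment_chaos_le_of_global:
  fixes f :: "(nat \<Rightarrow> 'a) \<Rightarrow> 'b::{real_inner,banach,second_countable_topology}"
  assumes "finite B" "finite I" "B \<inter> I = {}" "bmf f" "global (I \<union> B) k c f"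
  shows "avg I (\<lambda>x. (nsq (chaos (I \<union> B) k f) x)\<^sup>2) x \<le> 136 ^ card B * 12800 ^ k * c\<^sup>2"
  using assms
proof (induction B arbitrary: k c f x rule: finite_induct)
  case empty
  then have g: "global I k c f" by simp
  note c = global_nonneg[OF g]
  have "avg I (\<lambda>x. (nsq (chaos I k f) x)\<^sup>2) x \<le> 128 ^ k * (10 ^ k * c) * avg I (nsq (chaos I k f)) x"
    using empty by (intro fourth_moment_le_of_global) (auto simp: chaos_idem global_chaos)
  also have "\<dots> \<le> 128 ^ k * (10 ^ k * c) * (10 ^ k * c)"
    using globalD[OF global_chaos[OF _ _ g], of "{}" x] empty c by (intro mult_left_mono) auto
  also have "\<dots> = 12800 ^ k * c\<^sup>2" by (simp add: power2_eq_square algebra_simps flip: power_mult_distrib)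
  finally show ?case by simp
next
  case (insert b B)
  have fin: "finite (I \<union> B)" and b: "b \<notin> I \<union> B" using insert by auto
  have g: "global (insert b (I \<union> B)) k c f" using insert.prems by simp
  note c = global_nonneg[OF g] and f = insert.prems(3)
  let ?K = "136 ^ card B * 12800 ^ k * c\<^sup>2"
  have *: "avg I (\<lambda>x. (nsq (chaos (I \<union> B) k (avg {b} f)) x)\<^sup>2) x \<le> ?K"
    by (rule insert.IH) (use insert.prems global_avg[OF _ g b] in auto)
  show ?case
  proof (cases k)
    case 0
    have "136 ^ card B * 12800 ^ k * c\<^sup>2 \<le> 136 ^ card (insert b B) * 12800 ^ k * c\<^sup>2"
      using insert.hyps by (intro mult_right_mono power_increasing) auto
    then show ?thesis using * fin f by (simp add: 0 chaos_insert_0)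
  next
    case (Suc j)
    let ?u = "chaos (I \<union> B) k (avg {b} f)" and ?v = "chaos (I \<union> B) j (centre b f)"
    have "avg I (\<lambda>x. (nsq ?v x)\<^sup>2) x \<le> 136 ^ card B * 12800 ^ j * (4 * c)\<^sup>2"
      by (rule insert.IH) (use insert.prems global_centre[OF _ g[unfolded Suc] b fin] in auto)
    also have "\<dots> = 16 * (136 ^ card B * 12800 ^ j * c\<^sup>2)" by (simp add: power_mult_distrib)
    also have "\<dots> \<le> 16 * ?K" unfolding Suc by (intro mult_left_mono mult_right_mono) auto
    finally have **: "avg I (\<lambda>x. (nsq ?v x)\<^sup>2) x \<le> 16 * ?K" .
    have "avg I (\<lambda>x. (nsq (chaos (I \<union> insert b B) k f) x)\<^sup>2) x
        \<le> avg I (\<lambda>x. 8 * (nsq ?u x)\<^sup>2 + 8 * (nsq ?v x)\<^sup>2) x"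
    proof (rule avg_mono)
      fix x
      have "nsq (chaos (I \<union> insert b B) k f) x \<le> 2 * nsq ?u x + 2 * nsq ?v x"
        using fin b f by (simp add: Suc chaos_insert_Suc nsq_add_le)
      then have "(nsq (chaos (I \<union> insert b B) k f) x)\<^sup>2 \<le> (2 * nsq ?u x + 2 * nsq ?v x)\<^sup>2"
        by (intro power_mono) auto
      also have "\<dots> \<le> 8 * (nsq ?u x)\<^sup>2 + 8 * (nsq ?v x)\<^sup>2"
        using sum_squares_bound[of "nsq ?u x" "nsq ?v x"] by (simp add: power2_sum power_mult_distrib)
      finally show "(nsq (chaos (I \<union> insert b B) k f) x)\<^sup>2 \<le> 8 * (nsq ?u x)\<^sup>2 + 8 * (nsq ?v x)\<^sup>2" .
    qed (use f in auto)
    also have "\<dots> = 8 * avg I (\<lambda>x. (nsq ?u x)\<^sup>2) x + 8 * avg I (\<lambda>x. (nsq ?v x)\<^sup>2) x"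
      using f by (simp add: avg_add avg_cmult)
    also have "\<dots> \<le> 8 * ?K + 8 * (16 * ?K)"
      using * ** by (intro add_mono mult_left_mono) auto
    finally show ?thesis using insert.hyps by (simp add: algebra_simps)
  qed
qed

end

section \<open>The dual estimate\<close>

lemma sqrt_le_tangent:
  assumes "A > 0" "A + r \<ge> 0" shows "sqrt (A + r) \<le> sqrt A + r / (2 * sqrt A)"
proof (rule real_le_lsqrt)
  have s: "sqrt A > 0" "sqrt A * sqrt A = A" using assms by auto
  have "sqrt A + r / (2 * sqrt A) = (2 * A + r) / (2 * sqrt A)" using s by (simp add: field_simps)
  then show "0 \<le> sqrt A + r / (2 * sqrt A)" using assms by simp
  have "(sqrt A + r / (2 * sqrt A))\<^sup>2 = A + r + (r / (2 * sqrt A))\<^sup>2"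
    using s by (simp add: power2_sum)
  then show "A + r \<le> (sqrt A + r / (2 * sqrt A))\<^sup>2" by simp
qed

text \<open>
  The loss from pairing a number with its smoothed sign is at most the smoothing parameter.
\<close>

lemma le_square_over_sqrt:
  assumes "z \<ge> 0" "d > 0" shows "z \<le> z\<^sup>2 / sqrt (z\<^sup>2 + d\<^sup>2) + (d::real)"
proof (cases "z \<le> d")
  case True
  have "0 \<le> z\<^sup>2 / sqrt (z\<^sup>2 + d\<^sup>2)" by simp
  then show ?thesis using True by linarith
next
  case False
  have s: "sqrt (z\<^sup>2 + d\<^sup>2) > 0" using assms by (simp add: sum_power2_gt_zero_iff)
  have "(z - d) * sqrt (z\<^sup>2 + d\<^sup>2) \<le> (z - d) * (z + d)"
    using False assms by (intro mult_left_mono real_le_lsqrt) (auto simp: power2_sum)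
  also have "\<dots> \<le> z\<^sup>2" by (simp add: algebra_simps power2_eq_square)
  finally have "z - d \<le> z\<^sup>2 / sqrt (z\<^sup>2 + d\<^sup>2)" by (simp only: pos_le_divide_eq[OF s])
  then show ?thesis by simp
qed

context coordinate_space
begin

lemma
  fixes u v :: "(nat \<Rightarrow> 'a) \<Rightarrow> 'b::{real_inner,banach,second_countable_topology}"
  assumes [measurable]: "u \<in> borel_measurable P" "v \<in> borel_measurable P"
    and u: "integrable P (nsq u)" and v: "integrable P (nsq v)"
  shows integrable_inner: "integrable P (\<lambda>x. u x \<bullet> v x)"
    and integral_Cauchy_Schwarz: "(\<integral>x. u x \<bullet> v x \<partial>P) \<le> sqrt (integral\<^sup>L P (nsq u)) * sqrt (integral\<^sup>L P (nsq v))"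
proof -
  show uv: "integrable P (\<lambda>x. u x \<bullet> v x)"
  proof (rule Bochner_Integration.integrable_bound)
    show "integrable P (\<lambda>x. nsq u x + nsq v x)" using u v by simp
    show "AE x in P. norm (u x \<bullet> v x) \<le> norm (nsq u x + nsq v x)"
    proof (intro AE_I2)
      fix x
      have "\<bar>u x \<bullet> v x\<bar> \<le> norm (u x) * norm (v x)" by (rule Cauchy_Schwarz_ineq2)
      also have "\<dots> \<le> (norm (u x))\<^sup>2 + (norm (v x))\<^sup>2"
        using sum_squares_bound[of "norm (u x)" "norm (v x)"] mult_nonneg_nonneg[OF norm_ge_zero norm_ge_zero, of "u x" "v x"]
        by linarith
      finally show "norm (u x \<bullet> v x) \<le> norm (nsq u x + nsq v x)"
        by (simp add: nsq_def power2_norm_eq_inner)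
    qed
  qed simp
  let ?A = "integral\<^sup>L P (nsq u)" and ?B = "\<integral>x. u x \<bullet> v x \<partial>P" and ?C = "integral\<^sup>L P (nsq v)"
  have quad: "0 \<le> ?A - 2 * s * ?B + s\<^sup>2 * ?C" for s
  proof -
    have "0 \<le> (\<integral>x. nsq (\<lambda>x. u x - s *\<^sub>R v x) x \<partial>P)" by (rule Bochner_Integration.integral_nonneg) simp
    also have "nsq (\<lambda>x. u x - s *\<^sub>R v x) = (\<lambda>x. nsq u x - 2 * s * (u x \<bullet> v x) + s\<^sup>2 * nsq v x)"
      by (auto simp: nsq_def inner_diff_left inner_diff_right inner_commute power2_eq_square)
    finally show ?thesis using u v uv by simp
  qed
  have "?A \<ge> 0" "?C \<ge> 0" by (auto intro!: Bochner_Integration.integral_nonneg)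
  have "?B\<^sup>2 \<le> ?A * ?C"
  proof (cases "?C = 0")
    case True
    have "?B = 0"
    proof (rule ccontr)
      assume "?B \<noteq> 0"
      then show False using quad[of "(?A + 1) / (2 * ?B)"] True by simp
    qed
    then show ?thesis by (simp add: True)
  next
    case False
    then have "?C > 0" using \<open>?C \<ge> 0\<close> by linarith
    then show ?thesis using quad[of "?B / ?C"] by (simp add: field_simps power2_eq_square)
  qed
  then have "sqrt (?B\<^sup>2) \<le> sqrt (?A * ?C)" by (rule real_sqrt_le_mono)
  then show "?B \<le> sqrt ?A * sqrt ?C" by (simp add: real_sqrt_mult)
qed

lemma avg_eq_self_iff:
  assumes "bmf f"
  shows "avg J f = f \<longleftrightarrow> (\<forall>x\<in>space P. \<forall>y\<in>space P. f (merge_coords J x y) = f x)"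
proof
  assume eq: "avg J f = f"
  have "avg J f (merge_coords J x y) = avg J f x" if "x \<in> space P" "y \<in> space P" for x y
    using that by (simp add: avg_def merge_coords_same_left)
  then show "\<forall>x\<in>space P. \<forall>y\<in>space P. f (merge_coords J x y) = f x" by (simp add: eq)
next
  assume inv: "\<forall>x\<in>space P. \<forall>y\<in>space P. f (merge_coords J x y) = f x"
  show "avg J f = f"
  proof
    fix x show "avg J f x = f x"
    proof (cases "x \<in> space P")
      case True
      have "(\<integral>y. f (merge_coords J x y) \<partial>P) = (\<integral>y. f x \<partial>P)"
        using inv True by (intro Bochner_Integration.integral_cong) auto
      then show ?thesis using True by (simp add: avg_def P.prob_space)
    qed (use assms in \<open>simp add: avg_def bmf_outside\<close>)
  qed
qed

lemma global_scaleR: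
  fixes f :: "(nat \<Rightarrow> 'a) \<Rightarrow> 'b::{real_inner,banach,second_countable_topology}"
  shows "global I k c f \<Longrightarrow> a\<^sup>2 * c \<le> d \<Longrightarrow> global I k d (\<lambda>x. a *\<^sub>R f x)"
  unfolding global_def nsq_scaleR avg_cmult by (meson mult_left_mono order_trans zero_le_power2)

text \<open>
  Small enough for the truncation argument: \<open>17408000 = 10 \<sqdot> 136 \<sqdot> 12800\<close> collects the constants of
  \<open>global_chaos\<close> and of \<open>fourth_moment_chaos_le_of_global\<close>.
\<close>

definition dual_radius :: "nat \<Rightarrow> real"
  where "dual_radius m = 1 / (4 * 17408000 ^ m)"

lemma dual_radius: "0 < dual_radius m" "dual_radius m \<le> 1" "128 ^ m * dual_radius m \<le> 1 / 4"
  "10 ^ m * (136 ^ m * 12800 ^ m * (dual_radius m)\<^sup>2) = dual_radius m / 4"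
proof -
  have 1: "1 \<le> (17408000::real) ^ m" and 2: "(128::real) ^ m \<le> 17408000 ^ m"
    by (auto intro: power_mono)
  show "0 < dual_radius m" by (simp add: dual_radius_def)
  have "1 \<le> 4 * (17408000::real) ^ m" using 1 by linarith
  then show "dual_radius m \<le> 1" by (simp add: dual_radius_def divide_le_eq)
  show "128 ^ m * dual_radius m \<le> 1 / 4" using 2 by (simp add: dual_radius_def field_simps)
  have "(10::real) ^ m * (136 ^ m * 12800 ^ m) = 17408000 ^ m" by (simp flip: power_mult_distrib)
  then have "10 ^ m * (136 ^ m * 12800 ^ m * (dual_radius m)\<^sup>2) = 17408000 ^ m * (dual_radius m)\<^sup>2"
    by (metis mult.assoc)
  then show "10 ^ m * (136 ^ m * 12800 ^ m * (dual_radius m)\<^sup>2) = dual_radius m / 4"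
    by (simp add: dual_radius_def power2_eq_square)
qed

text \<open>
  On the chaos of order \<open>m\<close>, globalness replaces (up to constants) the dual norm of the \<open>L\<^sup>1\<close> norm, that is
  the norm \<open>inf {\<parallel>h\<parallel>\<^sub>\<infinity> | \<phi> = Q h}\<close>; so this is essentially a multiple of the unit ball of the dual of the chaos
  under the norm \<open>f \<mapsto> K(f, t)\<close>.
\<close>

definition dual_ball :: "nat set \<Rightarrow> nat \<Rightarrow> real \<Rightarrow> ((nat \<Rightarrow> 'a) \<Rightarrow> 'b::{real_inner,banach,second_countable_topology}) set"
  where "dual_ball I m t = {\<phi>. bmf \<phi> \<and> chaos I m \<phi> = \<phi> \<and> global I m (dual_radius m) \<phi> \<and>
    integral\<^sup>L P (nsq \<phi>) \<le> dual_radius m * t\<^sup>2}"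

text \<open>
  The part of \<open>\<phi>\<close> above height \<open>1\<close> is dominated by \<open>|\<phi>|\<^sup>4\<close> in square. By hypercontractivity its global bound
  is quadratic in that of \<open>\<phi>\<close>, and its mean square is a small multiple of that of \<open>\<phi>\<close>. This leaves room
  for the factor \<open>2\<close>.
\<close>

lemma dual_ball_truncate:
  fixes \<phi> :: "(nat \<Rightarrow> 'a) \<Rightarrow> 'b::{real_inner,banach,second_countable_topology}"
  assumes I: "finite I" and \<phi>: "\<phi> \<in> dual_ball I m t"
  obtains h where "bmf h" "\<And>x. norm (h x) \<le> 1" "integral\<^sup>L P (nsq h) \<le> t\<^sup>2"
    "(\<lambda>x. 2 *\<^sub>R (\<phi> x - chaos I m h x)) \<in> dual_ball I m t"
proof -
  let ?c = "dual_radius m"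
  have b: "bmf \<phi>" and Q: "chaos I m \<phi> = \<phi>" and g: "global I m ?c \<phi>"
    and n: "integral\<^sup>L P (nsq \<phi>) \<le> ?c * t\<^sup>2"
    using \<phi> by (auto simp: dual_ball_def)
  define h where "h = (\<lambda>x. if norm (\<phi> x) \<le> 1 then \<phi> x else 0)"
  define r where "r = (\<lambda>x. \<phi> x - h x)"
  have [measurable]: "\<phi> \<in> borel_measurable P" using b by (rule bmf_measurable)
  have h: "bmf h"
    unfolding h_def by (rule bmfI[of _ 1]) (auto simp: bmf_outside[OF b])
  have r: "bmf r" unfolding r_def using b h by auto
  have nh: "nsq h x \<le> nsq \<phi> x" for x by (simp add: h_def nsq_def)
  have nr: "nsq r x \<le> (nsq \<phi> x)\<^sup>2" for x
  proof (cases "norm (\<phi> x) \<le> 1")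
    case False
    then have "1 \<le> nsq \<phi> x" by (simp add: nsq_def flip: power2_norm_eq_inner)
    then have "1 * nsq \<phi> x \<le> nsq \<phi> x * nsq \<phi> x" by (intro mult_right_mono) auto
    then show ?thesis using False by (simp add: r_def h_def power2_eq_square) (simp add: nsq_def)
  qed (simp add: r_def h_def nsq_def)
  have e: "chaos I m r = (\<lambda>x. \<phi> x - chaos I m h x)"
    unfolding r_def using b h by (simp add: chaos_diff Q)
  have "global I m (136 ^ m * 12800 ^ m * ?c\<^sup>2) r"
    unfolding global_def
  proof safe
    fix K x assume K: "K \<subseteq> I" "card K \<le> m"
    have IK: "I - K \<union> K = I" "finite K" using K I finite_subset by auto
    have "avg (I - K) (nsq r) x \<le> avg (I - K) (\<lambda>x. (nsq \<phi> x)\<^sup>2) x"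
      using r b by (intro avg_mono nr) auto
    also have "\<dots> \<le> 136 ^ card K * 12800 ^ m * ?c\<^sup>2"
      using fourth_moment_chaos_le_of_global[of K "I - K" \<phi> m ?c x] IK I b g Q by simp
    also have "\<dots> \<le> 136 ^ m * 12800 ^ m * ?c\<^sup>2"
      using K by (intro mult_right_mono power_increasing) auto
    finally show "avg (I - K) (nsq r) x \<le> 136 ^ m * 12800 ^ m * ?c\<^sup>2" .
  qed
  then have "global I m (?c / 4) (chaos I m r)"
    using global_chaos[OF I r] by (simp only: dual_radius(4)[symmetric])
  then have ge: "global I m ?c (\<lambda>x. 2 *\<^sub>R chaos I m r x)"
    by (rule global_scaleR) simp
  have "integral\<^sup>L P (nsq (chaos I m r)) \<le> integral\<^sup>L P (nsq r)"
    using I r by (rule integral_nsq_chaos_le)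
  also have "\<dots> \<le> integral\<^sup>L P (\<lambda>x. (nsq \<phi> x)\<^sup>2)"
    using r b by (intro integral_mono nr) auto
  also have "\<dots> = integral\<^sup>L P (avg I (\<lambda>x. (nsq \<phi> x)\<^sup>2))"
    using b by (intro integral_avg[symmetric]) auto
  also have "\<dots> \<le> integral\<^sup>L P (\<lambda>x. 128 ^ m * ?c * avg I (nsq \<phi>) x)"
    using b I Q g by (intro integral_mono fourth_moment_le_of_global) auto
  also have "\<dots> = 128 ^ m * ?c * integral\<^sup>L P (nsq \<phi>)" using b by (simp add: integral_avg)
  also have "\<dots> \<le> 1 / 4 * (?c * t\<^sup>2)"
    using dual_radius[of m] n by (intro mult_mono) (auto intro!: Bochner_Integration.integral_nonneg)
  finally have ne: "integral\<^sup>L P (nsq (\<lambda>x. 2 *\<^sub>R chaos I m r x)) \<le> ?c * t\<^sup>2"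
    by (simp add: nsq_scaleR)
  have "integral\<^sup>L P (nsq h) \<le> integral\<^sup>L P (nsq \<phi>)" using h b by (intro integral_mono nh) auto
  also have "\<dots> \<le> 1 * t\<^sup>2" using n dual_radius(2)[of m] by (intro order_trans[OF n] mult_right_mono) auto
  finally have "integral\<^sup>L P (nsq h) \<le> t\<^sup>2" by simp
  moreover have "(\<lambda>x. 2 *\<^sub>R (\<phi> x - chaos I m h x)) \<in> dual_ball I m t"
  proof -
    have "(\<lambda>x. 2 *\<^sub>R (\<phi> x - chaos I m h x)) = (\<lambda>x. 2 *\<^sub>R chaos I m r x)" by (simp add: e)
    then show ?thesis using r ge ne I unfolding dual_ball_def by (simp add: chaos_scaleR chaos_idem)
  qed
  ultimately show ?thesis using h by (intro that[of h]) (auto simp: h_def)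
qed

text \<open>
  Split \<open>\<phi>\<close> into the projection of its truncation \<open>h\<close>, which pairs with \<open>f\<close> as \<open>h\<close> does, and half of another
  element of the ball. With \<open>S\<close> the supremum of the left-hand side over the ball and \<open>\<kappa>\<close> half of the
  right-hand side this gives \<open>S \<le> \<kappa> + S/2\<close>.
\<close>

lemma dual_ball_bound:
  fixes f :: "(nat \<Rightarrow> 'a) \<Rightarrow> 'b::{real_inner,banach,second_countable_topology}"
  assumes I: "finite I" and f: "bmf f" and Q: "chaos I m f = f" and t: "t > 0"
    and g0: "integrable P g0" and h0 [measurable]: "h0 \<in> borel_measurable P" and h0': "integrable P (nsq h0)"
    and ae: "AE x in P. f x = g0 x + h0 x"
    and \<phi>: "\<phi> \<in> dual_ball I m t"
  shows "(\<integral>x. f x \<bullet> \<phi> x \<partial>P) \<le> 2 * ((\<integral>x. norm (g0 x) \<partial>P) + t * sqrt (integral\<^sup>L P (nsq h0)))"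
proof -
  define \<kappa> where "\<kappa> = (\<integral>x. norm (g0 x) \<partial>P) + t * sqrt (integral\<^sup>L P (nsq h0))"
  define S where "S = (SUP \<phi>\<in>dual_ball I m t. \<integral>x. f x \<bullet> \<phi> x \<partial>P)"
  have bdd: "bdd_above ((\<lambda>\<phi>. \<integral>x. f x \<bullet> \<phi> x \<partial>P) ` dual_ball I m t)"
  proof (rule bdd_aboveI2)
    fix \<psi> :: "(nat \<Rightarrow> 'a) \<Rightarrow> 'b" assume \<psi>: "\<psi> \<in> dual_ball I m t"
    then have "bmf \<psi>" by (simp add: dual_ball_def)
    then have "(\<integral>x. f x \<bullet> \<psi> x \<partial>P) \<le> sqrt (integral\<^sup>L P (nsq f)) * sqrt (integral\<^sup>L P (nsq \<psi>))"
      using f by (intro integral_Cauchy_Schwarz) auto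
    also have "\<dots> \<le> sqrt (integral\<^sup>L P (nsq f)) * sqrt (dual_radius m * t\<^sup>2)"
      using \<psi> by (intro mult_left_mono real_sqrt_le_mono)
        (auto simp: dual_ball_def intro!: Bochner_Integration.integral_nonneg)
    finally show "(\<integral>x. f x \<bullet> \<psi> x \<partial>P) \<le> sqrt (integral\<^sup>L P (nsq f)) * sqrt (dual_radius m * t\<^sup>2)" .
  qed
  have step: "(\<integral>x. f x \<bullet> \<psi> x \<partial>P) \<le> \<kappa> + S / 2" if \<psi>: "\<psi> \<in> dual_ball I m t" for \<psi>
  proof -
    obtain h where h: "bmf h" and h1: "\<And>x. norm (h x) \<le> 1" and h2: "integral\<^sup>L P (nsq h) \<le> t\<^sup>2"
      and e: "(\<lambda>x. 2 *\<^sub>R (\<psi> x - chaos I m h x)) \<in> dual_ball I m t"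
      using dual_ball_truncate[OF I \<psi>] by blast
    note [measurable] = bmf_measurable[OF h] bmf_measurable[OF f] borel_measurable_integrable[OF g0]
    have b: "bmf \<psi>" using \<psi> by (simp add: dual_ball_def)
    have "integrable P (\<lambda>x. h0 x \<bullet> h x)" using h h0' by (intro integrable_inner) auto
    moreover have g0h: "integrable P (\<lambda>x. g0 x \<bullet> h x)"
    proof (rule Bochner_Integration.integrable_bound[OF g0])
      show "AE x in P. norm (g0 x \<bullet> h x) \<le> norm (g0 x)"
      proof (intro AE_I2)
        fix x
        have "\<bar>g0 x \<bullet> h x\<bar> \<le> norm (g0 x) * norm (h x)" by (rule Cauchy_Schwarz_ineq2)
        also have "\<dots> \<le> norm (g0 x) * 1" by (intro mult_left_mono h1) auto
        finally show "norm (g0 x \<bullet> h x) \<le> norm (g0 x)" by simp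
      qed
    qed measurable
    moreover have "(\<integral>x. f x \<bullet> h x \<partial>P) = (\<integral>x. g0 x \<bullet> h x + h0 x \<bullet> h x \<partial>P)"
      by (rule integral_cong_AE) (use ae in \<open>auto simp: inner_add_left\<close>)
    ultimately have "(\<integral>x. f x \<bullet> h x \<partial>P) = (\<integral>x. g0 x \<bullet> h x \<partial>P) + (\<integral>x. h0 x \<bullet> h x \<partial>P)" by simp
    also have "(\<integral>x. g0 x \<bullet> h x \<partial>P) \<le> (\<integral>x. norm (g0 x) \<partial>P)"
    proof (rule integral_mono[OF g0h])
      fix x
      have "g0 x \<bullet> h x \<le> norm (g0 x) * norm (h x)" by (rule norm_cauchy_schwarz)
      also have "\<dots> \<le> norm (g0 x) * 1" by (intro mult_left_mono h1) auto
      finally show "g0 x \<bullet> h x \<le> norm (g0 x)" by simp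
    qed (use g0 in simp)
    also have "(\<integral>x. h0 x \<bullet> h x \<partial>P) \<le> sqrt (integral\<^sup>L P (nsq h0)) * sqrt (integral\<^sup>L P (nsq h))"
      using h h0' by (intro integral_Cauchy_Schwarz) auto
    also have "\<dots> \<le> sqrt (integral\<^sup>L P (nsq h0)) * t"
      using h2 t by (intro mult_left_mono real_le_lsqrt)
        (auto intro!: Bochner_Integration.integral_nonneg)
    finally have fh: "(\<integral>x. f x \<bullet> h x \<partial>P) \<le> \<kappa>" by (simp add: \<kappa>_def mult.commute)
    have "(\<integral>x. f x \<bullet> (2 *\<^sub>R (\<psi> x - chaos I m h x)) \<partial>P) \<le> S"
      unfolding S_def by (rule cSUP_upper[OF e bdd])
    moreover have "(\<integral>x. f x \<bullet> (2 *\<^sub>R (\<psi> x - chaos I m h x)) \<partial>P)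
        = 2 * ((\<integral>x. f x \<bullet> \<psi> x \<partial>P) - (\<integral>x. f x \<bullet> chaos I m h x \<partial>P))"
      using f b h by (simp add: inner_diff_right)
    moreover have "(\<integral>x. f x \<bullet> chaos I m h x \<partial>P) = (\<integral>x. f x \<bullet> h x \<partial>P)"
      using integral_chaos_inner[OF f h, of I m] by (simp add: Q)
    ultimately show ?thesis using fh by simp
  qed
  have "S \<le> \<kappa> + S / 2"
    unfolding S_def by (rule cSUP_least) (use \<phi> step in \<open>auto simp: S_def\<close>)
  moreover have "(\<integral>x. f x \<bullet> \<phi> x \<partial>P) \<le> S" unfolding S_def by (rule cSUP_upper[OF \<phi> bdd])
  ultimately show ?thesis unfolding \<kappa>_def by simp
qed

section \<open>Decomposition of finite chaoses\<close>

definition finite_chaos :: "nat set \<Rightarrow> nat \<Rightarrow> ((nat \<Rightarrow> 'a) \<Rightarrow> 'b::{banach,second_countable_topology}) set"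
  where "finite_chaos I m = {u. bmf u \<and> chaos I m u = u \<and> avg (- I) u = u}"

lemma finite_chaos_add:
  "u \<in> finite_chaos I m \<Longrightarrow> v \<in> finite_chaos I m \<Longrightarrow> (\<lambda>x. u x + v x) \<in> finite_chaos I m"
  by (simp add: finite_chaos_def chaos_add avg_add)

lemma finite_chaos_diff:
  "u \<in> finite_chaos I m \<Longrightarrow> v \<in> finite_chaos I m \<Longrightarrow> (\<lambda>x. u x - v x) \<in> finite_chaos I m"
  by (simp add: finite_chaos_def chaos_diff avg_diff)

lemma finite_chaos_scaleR:
  "u \<in> finite_chaos I m \<Longrightarrow> (\<lambda>x. a *\<^sub>R u x) \<in> finite_chaos I m"
  by (simp add: finite_chaos_def chaos_scaleR avg_scaleR)

lemma finite_chaos_zero: "(\<lambda>x. 0) \<in> finite_chaos I m"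
  by (simp add: finite_chaos_def)

lemma chaos_in_finite_chaos:
  "bmf h \<Longrightarrow> finite I \<Longrightarrow> avg (- I) h = h \<Longrightarrow> chaos I m h \<in> finite_chaos I m"
  by (simp add: finite_chaos_def chaos_idem avg_chaos)

lemma integrable_sqrt_nsq:
  fixes u :: "(nat \<Rightarrow> 'a) \<Rightarrow> 'b::{real_inner,banach,second_countable_topology}"
  assumes "bmf u" "d \<ge> 0" shows "integrable P (\<lambda>x. sqrt (nsq u x + d\<^sup>2))"
proof (rule Bochner_Integration.integrable_bound)
  show "integrable P (\<lambda>x. norm (u x) + d)" using assms by simp
  have [measurable]: "nsq u \<in> borel_measurable P" using assms by (intro bmf_measurable) auto
  show "(\<lambda>x. sqrt (nsq u x + d\<^sup>2)) \<in> borel_measurable P" by measurable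
  show "AE x in P. norm (sqrt (nsq u x + d\<^sup>2)) \<le> norm (norm (u x) + d)"
    using assms(2) by (intro AE_I2)
      (auto simp: nsq_def power2_sum simp flip: power2_norm_eq_inner intro!: real_le_lsqrt)
qed

text \<open>
  The functional \<open>J u = \<integral> sqrt (|f - u|\<^sup>2 + d\<^sup>2) + t sqrt (\<parallel>u\<parallel>\<^sub>2\<^sup>2 + d\<^sup>2)\<close> on the chaos has a gradient \<open>G\<close>
  that is Lipschitz with constant \<open>L = (1 + t)/d\<close>. Hence a step \<open>- G/L\<close> decreases it by at least
  \<open>\<parallel>G\<parallel>\<^sub>2\<^sup>2/(2L)\<close>, and the gradient is small at every near-minimiser. Working with near-minimisers
  avoids any completeness or compactness argument.
\<close>

lemma near_stationary_point:
  fixes f :: "(nat \<Rightarrow> 'a) \<Rightarrow> 'b::{real_inner,banach,second_countable_topology}"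
  assumes I: "finite I" and f: "f \<in> finite_chaos I m" and t: "t > 0" and d: "d > 0" and \<gamma>: "\<gamma> > 0"
  obtains u h where "u \<in> finite_chaos I m" "bmf h" "\<And>x. norm (h x) \<le> 1"
    "\<And>x. h x = (1 / sqrt (nsq (\<lambda>x. f x - u x) x + d\<^sup>2)) *\<^sub>R (f x - u x)"
    "t * sqrt (integral\<^sup>L P (nsq u)) \<le> (\<integral>x. sqrt (nsq f x + d\<^sup>2) \<partial>P) + t * d + 1"
    "integral\<^sup>L P (nsq (\<lambda>x. (t / sqrt (integral\<^sup>L P (nsq u) + d\<^sup>2)) *\<^sub>R u x - chaos I m h x)) \<le> \<gamma>"
proof -
  define J where "J u = (\<integral>x. sqrt (nsq (\<lambda>x. f x - u x) x + d\<^sup>2) \<partial>P) + t * sqrt (integral\<^sup>L P (nsq u) + d\<^sup>2)"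
    for u
  have W_bmf: "bmf u" if "u \<in> finite_chaos I m" for u :: "(nat \<Rightarrow> 'a) \<Rightarrow> 'b"
    using that by (simp add: finite_chaos_def)
  have bf: "bmf f" using W_bmf[OF f] .
  have norm_nonneg: "0 \<le> integral\<^sup>L P (nsq u)" for u :: "(nat \<Rightarrow> 'a) \<Rightarrow> 'b"
    by (rule Bochner_Integration.integral_nonneg) simp
  have J_ge: "t * sqrt (integral\<^sup>L P (nsq u)) \<le> J u" for u
  proof -
    have "0 \<le> (\<integral>x. sqrt (nsq (\<lambda>x. f x - u x) x + d\<^sup>2) \<partial>P)" by (rule Bochner_Integration.integral_nonneg) simp
    moreover have "t * sqrt (integral\<^sup>L P (nsq u)) \<le> t * sqrt (integral\<^sup>L P (nsq u) + d\<^sup>2)"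
      using t by (intro mult_left_mono real_sqrt_le_mono) auto
    ultimately show ?thesis unfolding J_def by linarith
  qed
  have J_nonneg: "0 \<le> J u" for u
    using J_ge[of u] t norm_nonneg[of u] by (meson mult_nonneg_nonneg less_imp_le order_trans real_sqrt_ge_zero)
  have bdd: "bdd_below (J ` finite_chaos I m)" using J_nonneg by (intro bdd_belowI2)
  define L where "L = (1 + t) / d"
  have L: "L > 0" using t d by (simp add: L_def)
  define \<eta> where "\<eta> = min 1 (\<gamma> / (2 * L))"
  have \<eta>: "\<eta> > 0" "\<eta> \<le> 1" "\<eta> \<le> \<gamma> / (2 * L)" using \<gamma> L by (auto simp: \<eta>_def)
  have "\<exists>y\<in>J ` finite_chaos I m. y < Inf (J ` finite_chaos I m) + \<eta>"
    using \<eta> finite_chaos_zero by (intro cInf_lessD) auto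
  then obtain u where u: "u \<in> finite_chaos I m" and "J u < Inf (J ` finite_chaos I m) + \<eta>"
    by blast
  then have near: "J u \<le> J v + \<eta>" if "v \<in> finite_chaos I m" for v
    using cInf_lower[OF imageI[OF that, of J] bdd] by linarith
  have bu: "bmf u" using W_bmf[OF u] .
  define R where "R x = sqrt (nsq (\<lambda>x. f x - u x) x + d\<^sup>2)" for x
  define s where "s = sqrt (integral\<^sup>L P (nsq u) + d\<^sup>2)"
  define h where "h x = (1 / R x) *\<^sub>R (f x - u x)" for x
  have R: "R x \<ge> d" "R x > 0" for x
  proof -
    show "R x \<ge> d" unfolding R_def using d by (intro real_le_rsqrt) simp
    then show "R x > 0" using d by linarith
  qed
  have s: "s \<ge> d" "s > 0"
  proof -
    show "s \<ge> d" unfolding s_def using d norm_nonneg[of u] by (intro real_le_rsqrt) simp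
    then show "s > 0" using d by linarith
  qed
  have h1: "norm (h x) \<le> 1" for x
  proof -
    have "norm (f x - u x) \<le> R x"
      unfolding R_def by (rule real_le_rsqrt) (simp add: nsq_def power2_norm_eq_inner)
    then show ?thesis using R(2)[of x] by (simp add: h_def)
  qed
  have h: "bmf h"
  proof (rule bmfI[of _ 1])
    have [measurable]: "f \<in> borel_measurable P" "u \<in> borel_measurable P" "nsq (\<lambda>x. f x - u x) \<in> borel_measurable P"
      using bf bu by (auto intro: bmf_measurable)
    show "h \<in> borel_measurable P" unfolding h_def R_def by measurable
  qed (use h1 bf bu in \<open>auto simp: h_def bmf_outside\<close>)
  have avg_h: "avg (- I) h = h"
    using f u unfolding avg_eq_self_iff[OF h] finite_chaos_def
    by (auto simp: avg_eq_self_iff h_def R_def nsq_def)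
  define G where "G = (\<lambda>x. (t / s) *\<^sub>R u x - chaos I m h x)"
  have G: "G \<in> finite_chaos I m"
    unfolding G_def using u h avg_h I
    by (intro finite_chaos_diff finite_chaos_scaleR chaos_in_finite_chaos) auto
  \<comment> \<open>one step of gradient descent\<close>
  define v where "v = (\<lambda>x. (- 1 / L) *\<^sub>R G x)"
  have v: "v \<in> finite_chaos I m" unfolding v_def using G by (rule finite_chaos_scaleR)
  have bv: "bmf v" using W_bmf[OF v] .
  have bG: "bmf G" using W_bmf[OF G] .
  have 1: "(\<integral>x. sqrt (nsq (\<lambda>x. f x - (u x + v x)) x + d\<^sup>2) \<partial>P)
      \<le> (\<integral>x. sqrt (nsq (\<lambda>x. f x - u x) x + d\<^sup>2) - h x \<bullet> v x + 1 / (2 * d) * nsq v x \<partial>P)"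
  proof (rule integral_mono)
    show "integrable P (\<lambda>x. sqrt (nsq (\<lambda>x. f x - (u x + v x)) x + d\<^sup>2))"
      using bf bu bv d by (intro integrable_sqrt_nsq) auto
    show "integrable P (\<lambda>x. sqrt (nsq (\<lambda>x. f x - u x) x + d\<^sup>2) - h x \<bullet> v x + 1 / (2 * d) * nsq v x)"
      using bf bu bv h d
      by (intro Bochner_Integration.integrable_add Bochner_Integration.integrable_diff integrable_sqrt_nsq) auto
    fix x
    let ?A = "nsq (\<lambda>x. f x - u x) x + d\<^sup>2" and ?r = "nsq v x - 2 * ((f x - u x) \<bullet> v x)"
    have eq: "nsq (\<lambda>x. f x - (u x + v x)) x + d\<^sup>2 = ?A + ?r"
      by (simp add: nsq_def algebra_simps inner_diff_left inner_diff_right inner_add_left inner_add_right inner_commute)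
    have "0 < ?A" using R(2)[of x] by (simp add: R_def)
    then have "sqrt (?A + ?r) \<le> sqrt ?A + ?r / (2 * sqrt ?A)"
      by (rule sqrt_le_tangent) (simp flip: eq)
    also have "?r / (2 * sqrt ?A) = nsq v x / (2 * R x) - h x \<bullet> v x"
      using R(2)[of x] by (simp add: h_def flip: R_def) (simp add: field_simps)
    also have "nsq v x / (2 * R x) \<le> nsq v x / (2 * d)"
      using R[of x] d by (intro divide_left_mono) auto
    finally show "sqrt (nsq (\<lambda>x. f x - (u x + v x)) x + d\<^sup>2)
        \<le> sqrt (nsq (\<lambda>x. f x - u x) x + d\<^sup>2) - h x \<bullet> v x + 1 / (2 * d) * nsq v x"
      unfolding eq by simp
  qed
  have 2: "sqrt (integral\<^sup>L P (nsq (\<lambda>x. u x + v x)) + d\<^sup>2)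
      \<le> s + (\<integral>x. u x \<bullet> v x \<partial>P) / s + 1 / (2 * d) * integral\<^sup>L P (nsq v)"
  proof -
    let ?A = "integral\<^sup>L P (nsq u) + d\<^sup>2" and ?r = "2 * (\<integral>x. u x \<bullet> v x \<partial>P) + integral\<^sup>L P (nsq v)"
    have "nsq (\<lambda>x. u x + v x) = (\<lambda>x. nsq u x + 2 * (u x \<bullet> v x) + nsq v x)"
      by (auto simp: nsq_def inner_add_left inner_add_right inner_commute)
    then have eq: "integral\<^sup>L P (nsq (\<lambda>x. u x + v x)) + d\<^sup>2 = ?A + ?r"
      using bu bv by simp
    have "0 < ?A" using s by (simp add: s_def)
    then have "sqrt (?A + ?r) \<le> sqrt ?A + ?r / (2 * sqrt ?A)"
      by (rule sqrt_le_tangent) (use norm_nonneg in \<open>simp flip: eq\<close>)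
    also have "?r / (2 * sqrt ?A) = (\<integral>x. u x \<bullet> v x \<partial>P) / s + integral\<^sup>L P (nsq v) / (2 * s)"
      by (simp add: add_divide_distrib flip: s_def)
    also have "integral\<^sup>L P (nsq v) / (2 * s) \<le> integral\<^sup>L P (nsq v) / (2 * d)"
      using s d norm_nonneg by (intro divide_left_mono) auto
    finally show ?thesis unfolding eq by (simp add: s_def)
  qed
  have "J (\<lambda>x. u x + v x)
      \<le> (\<integral>x. sqrt (nsq (\<lambda>x. f x - u x) x + d\<^sup>2) - h x \<bullet> v x + 1 / (2 * d) * nsq v x \<partial>P)
      + t * (s + (\<integral>x. u x \<bullet> v x \<partial>P) / s + 1 / (2 * d) * integral\<^sup>L P (nsq v))"
    unfolding J_def using t by (intro add_mono 1 mult_left_mono 2) auto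
  also have "\<dots> = J u + ((t / s) * (\<integral>x. u x \<bullet> v x \<partial>P) - (\<integral>x. h x \<bullet> v x \<partial>P)) + L / 2 * integral\<^sup>L P (nsq v)"
    using bf bu bv h d integrable_sqrt_nsq[of "\<lambda>x. f x - u x" d]
    by (simp add: J_def L_def s_def field_simps)
  also have "(t / s) * (\<integral>x. u x \<bullet> v x \<partial>P) - (\<integral>x. h x \<bullet> v x \<partial>P) = (\<integral>x. G x \<bullet> v x \<partial>P)"
  proof -
    have "(\<integral>x. h x \<bullet> v x \<partial>P) = (\<integral>x. chaos I m h x \<bullet> v x \<partial>P)"
      using integral_chaos_inner[OF h bv, of I m] v by (simp add: finite_chaos_def)
    then show ?thesis using bu bv h by (simp add: G_def inner_diff_left)
  qed
  also have "\<dots> = - (1 / L) * integral\<^sup>L P (nsq G)"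
    using bG by (simp add: v_def nsq_def)
  also have "integral\<^sup>L P (nsq v) = (1 / L)\<^sup>2 * integral\<^sup>L P (nsq G)"
    unfolding v_def nsq_scaleR using bG by (simp add: power2_eq_square)
  finally have "J (\<lambda>x. u x + v x) \<le> J u - integral\<^sup>L P (nsq G) / (2 * L)"
    using L by (simp add: field_simps power2_eq_square)
  moreover have "J u \<le> J (\<lambda>x. u x + v x) + \<eta>" using u v by (intro near finite_chaos_add)
  ultimately have "integral\<^sup>L P (nsq G) / (2 * L) \<le> \<gamma> / (2 * L)" using \<eta> by linarith
  then have "integral\<^sup>L P (nsq G) \<le> \<gamma>" using L by (simp add: divide_le_cancel)
  moreover have "t * sqrt (integral\<^sup>L P (nsq u)) \<le> (\<integral>x. sqrt (nsq f x + d\<^sup>2) \<partial>P) + t * d + 1"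
  proof -
    have "t * sqrt (integral\<^sup>L P (nsq u)) \<le> J (\<lambda>x. 0) + \<eta>"
      using J_ge[of u] near[OF finite_chaos_zero] by linarith
    then show ?thesis using \<eta> d by (simp add: J_def nsq_def)
  qed
  ultimately show ?thesis
    using u h h1 by (intro that[of u h]) (auto simp: h_def R_def G_def s_def)
qed

text \<open>
  The projection of a function bounded by \<open>1\<close> is global with bound \<open>10\<^sup>m\<close>, and here its squared norm is at most
  \<open>4 t\<^sup>2\<close>; the denominator is the factor that scales it into the dual ball, and the numerator comes from
  \<open>dual_ball_bound\<close>.
\<close>

definition K_constant :: "nat \<Rightarrow> real"
  where "K_constant m = 2 / sqrt (dual_radius m / (4 * 10 ^ m))"

lemma K_constant_pos: "K_constant m > 0"
  using dual_radius(1)[of m] by (simp add: K_constant_def)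

text \<open>
  For a near-stationary point \<open>u\<close> with smoothed sign \<open>h\<close> of \<open>f - u\<close> and \<open>\<phi> = chaos I m h\<close>, the quantity to be
  bounded is \<open>\<langle>f - u, h\<rangle> + \<langle>u, t u/\<parallel>u\<parallel>\<^sub>2\<rangle>\<close> up to small errors, hence \<open>\<langle>f, \<phi>\<rangle>\<close> up to small errors. The dual
  estimate bounds the latter.
\<close>

lemma finite_chaos_decomposition:
  fixes f :: "(nat \<Rightarrow> 'a) \<Rightarrow> 'b::{real_inner,banach,second_countable_topology}"
  assumes I: "finite I" and f: "f \<in> finite_chaos I m" and t: "t > 0" and e: "e > 0"
    and g0: "integrable P g0" and h0: "h0 \<in> borel_measurable P" "integrable P (nsq h0)"
    and ae: "AE x in P. f x = g0 x + h0 x"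
  obtains u where "u \<in> finite_chaos I m"
    "(\<integral>x. norm (f x - u x) \<partial>P) + t * sqrt (integral\<^sup>L P (nsq u))
      \<le> K_constant m * ((\<integral>x. norm (g0 x) \<partial>P) + t * sqrt (integral\<^sup>L P (nsq h0))) + e"
proof -
  let ?\<kappa> = "(\<integral>x. norm (g0 x) \<partial>P) + t * sqrt (integral\<^sup>L P (nsq h0))"
  define d where "d = e / 2 / (1 + t)"
  have d: "d > 0" "(1 + t) * d = e / 2"
    using e t by (auto simp: d_def divide_simps add_pos_pos)
  define D where "D = (\<integral>x. sqrt (nsq f x + d\<^sup>2) \<partial>P) + t * d + 1"
  have "0 \<le> (\<integral>x. sqrt (nsq f x + d\<^sup>2) \<partial>P)" by (rule Bochner_Integration.integral_nonneg) simp
  moreover have "t * d > 0" using t d by simp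
  ultimately have D: "D > 0" unfolding D_def by linarith
  \<comment> \<open>The first entry makes the norm of the dual function at most \<open>2t\<close>; since \<open>\<parallel>u\<parallel>\<^sub>2 \<le> D/t\<close>, the second
    one makes the error from the gradient at most \<open>e/2\<close>.\<close>
  define \<gamma> where "\<gamma> = (min t (t * e / (2 * D)))\<^sup>2"
  have m: "min t (t * e / (2 * D)) > 0" using t e D by simp
  then have \<gamma>: "\<gamma> > 0" "sqrt \<gamma> \<le> t * e / (2 * D)" by (auto simp: \<gamma>_def)
  have \<gamma>t: "\<gamma> \<le> t\<^sup>2" unfolding \<gamma>_def using m by (intro power_mono) auto
  obtain u h where u: "u \<in> finite_chaos I m" and h: "bmf h" and h1: "\<And>x. norm (h x) \<le> 1"
    and hx: "\<And>x. h x = (1 / sqrt (nsq (\<lambda>x. f x - u x) x + d\<^sup>2)) *\<^sub>R (f x - u x)"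
    and uD: "t * sqrt (integral\<^sup>L P (nsq u)) \<le> D"
    and G: "integral\<^sup>L P (nsq (\<lambda>x. (t / sqrt (integral\<^sup>L P (nsq u) + d\<^sup>2)) *\<^sub>R u x - chaos I m h x)) \<le> \<gamma>"
    using near_stationary_point[OF I f t d(1) \<gamma>(1)] unfolding D_def by blast
  define s where "s = sqrt (integral\<^sup>L P (nsq u) + d\<^sup>2)"
  define \<phi> where "\<phi> = chaos I m h"
  define g where "g = (\<lambda>x. (t / s) *\<^sub>R u x - \<phi> x)"
  have b: "bmf u" "bmf f" "bmf \<phi>" using u f h by (auto simp: finite_chaos_def \<phi>_def)
  then have bg: "bmf g" by (auto simp: g_def)
  have g\<gamma>: "integral\<^sup>L P (nsq g) \<le> \<gamma>" using G by (simp add: g_def s_def \<phi>_def)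
  have n0: "0 \<le> integral\<^sup>L P (nsq u)" by (rule Bochner_Integration.integral_nonneg) simp
  have s: "s > 0" using n0 d by (simp add: s_def add_nonneg_pos)
  have Qf: "chaos I m f = f" and Qu: "chaos I m u = u" using f u by (auto simp: finite_chaos_def)
  have "global I m 1 h"
    unfolding global_def
  proof safe
    fix K x
    show "avg (I - K) (nsq h) x \<le> 1"
    proof (rule avg_le_const)
      fix x
      have "nsq h x = (norm (h x))\<^sup>2" by (simp add: nsq_def power2_norm_eq_inner)
      then show "nsq h x \<le> 1" using h1[of x] by (simp add: power_le_one)
    qed (use h in auto)
  qed
  then have glob: "global I m (10 ^ m) \<phi>"
    using global_chaos[OF I h, of m 1] by (simp add: \<phi>_def)
  have norm\<phi>: "integral\<^sup>L P (nsq \<phi>) \<le> 4 * t\<^sup>2"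
  proof -
    have "integral\<^sup>L P (nsq \<phi>) \<le> (\<integral>x. 2 * nsq (\<lambda>x. (t / s) *\<^sub>R u x) x + 2 * nsq g x \<partial>P)"
    proof (rule integral_mono)
      fix x
      have "nsq \<phi> x = nsq (\<lambda>x. (t / s) *\<^sub>R u x - g x) x" by (simp add: g_def nsq_def)
      then show "nsq \<phi> x \<le> 2 * nsq (\<lambda>x. (t / s) *\<^sub>R u x) x + 2 * nsq g x"
        using nsq_diff_le[of "\<lambda>x. (t / s) *\<^sub>R u x" g x] by simp
    qed (use b bg in auto)
    also have "\<dots> = 2 * ((t / s)\<^sup>2 * integral\<^sup>L P (nsq u)) + 2 * integral\<^sup>L P (nsq g)"
      unfolding nsq_scaleR using b bg by simp
    also have "(t / s)\<^sup>2 * integral\<^sup>L P (nsq u) \<le> t\<^sup>2"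
    proof -
      have "s\<^sup>2 = integral\<^sup>L P (nsq u) + d\<^sup>2" unfolding s_def using n0 by simp
      then have "integral\<^sup>L P (nsq u) \<le> s\<^sup>2" by simp
      then have "t\<^sup>2 * integral\<^sup>L P (nsq u) \<le> t\<^sup>2 * s\<^sup>2" by (intro mult_left_mono) auto
      then show ?thesis using s by (simp add: power_divide divide_le_eq)
    qed
    finally show ?thesis using g\<gamma> \<gamma>t by simp
  qed
  define \<epsilon> where "\<epsilon> = sqrt (dual_radius m / (4 * 10 ^ m))"
  have \<epsilon>: "\<epsilon> > 0" "\<epsilon>\<^sup>2 = dual_radius m / (4 * 10 ^ m)" using dual_radius(1)[of m] by (auto simp: \<epsilon>_def)
  have "(\<lambda>x. \<epsilon> *\<^sub>R \<phi> x) \<in> dual_ball I m t"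
  proof -
    have "\<epsilon>\<^sup>2 * 10 ^ m \<le> dual_radius m" using dual_radius(1)[of m] by (simp add: \<epsilon>)
    moreover have "\<epsilon>\<^sup>2 * integral\<^sup>L P (nsq \<phi>) \<le> dual_radius m * t\<^sup>2"
    proof -
      have "\<epsilon>\<^sup>2 * integral\<^sup>L P (nsq \<phi>) \<le> \<epsilon>\<^sup>2 * (4 * t\<^sup>2)" using norm\<phi> by (intro mult_left_mono) auto
      also have "\<dots> = (dual_radius m * t\<^sup>2) / 10 ^ m" by (simp add: \<epsilon>)
      also have "\<dots> \<le> dual_radius m * t\<^sup>2"
        using dual_radius(1)[of m] divide_left_mono[of 1 "10 ^ m" "dual_radius m * t\<^sup>2"] by simp
      finally show ?thesis .
    qed
    ultimately show ?thesis
      using b glob I h unfolding dual_ball_def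
      by (auto simp: chaos_scaleR nsq_scaleR intro: global_scaleR) (simp_all add: \<phi>_def chaos_idem)
  qed
  then have "(\<integral>x. f x \<bullet> (\<epsilon> *\<^sub>R \<phi> x) \<partial>P) \<le> 2 * ?\<kappa>"
    by (intro dual_ball_bound[OF I b(2) Qf t g0 h0 ae])
  then have "\<epsilon> * (\<integral>x. f x \<bullet> \<phi> x \<partial>P) \<le> 2 * ?\<kappa>" by simp
  then have dual: "(\<integral>x. f x \<bullet> \<phi> x \<partial>P) \<le> K_constant m * ?\<kappa>"
    using \<epsilon> by (simp add: K_constant_def \<epsilon>_def[symmetric] field_simps)
  have 1: "(\<integral>x. norm (f x - u x) \<partial>P) \<le> (\<integral>x. (f x - u x) \<bullet> h x \<partial>P) + d"
  proof -
    have "(\<integral>x. norm (f x - u x) \<partial>P) \<le> (\<integral>x. (f x - u x) \<bullet> h x + d \<partial>P)"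
    proof (rule integral_mono)
      fix x
      have "(f x - u x) \<bullet> h x = (norm (f x - u x))\<^sup>2 / sqrt ((norm (f x - u x))\<^sup>2 + d\<^sup>2)"
        by (simp add: hx nsq_def power2_norm_eq_inner)
      then show "norm (f x - u x) \<le> (f x - u x) \<bullet> h x + d"
        using le_square_over_sqrt[of "norm (f x - u x)" d] d by simp
    qed (use b h in auto)
    also have "\<dots> = (\<integral>x. (f x - u x) \<bullet> h x \<partial>P) + d" using b h by (simp add: P.prob_space)
    finally show ?thesis .
  qed
  have 2: "t * sqrt (integral\<^sup>L P (nsq u)) \<le> (t / s) * integral\<^sup>L P (nsq u) + t * d"
  proof -
    have "sqrt (integral\<^sup>L P (nsq u)) \<le> integral\<^sup>L P (nsq u) / s + d"
      using le_square_over_sqrt[of "sqrt (integral\<^sup>L P (nsq u))" d] d n0 by (simp add: s_def)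
    then have "t * sqrt (integral\<^sup>L P (nsq u)) \<le> t * (integral\<^sup>L P (nsq u) / s + d)"
      using t by (intro mult_left_mono) auto
    then show ?thesis by (simp add: distrib_left)
  qed
  have 3: "(\<integral>x. (f x - u x) \<bullet> h x \<partial>P) = (\<integral>x. f x \<bullet> \<phi> x \<partial>P) - (\<integral>x. u x \<bullet> \<phi> x \<partial>P)"
    using integral_chaos_inner[of "\<lambda>x. f x - u x" h I m] b h
    by (simp add: chaos_diff Qf Qu \<phi>_def inner_diff_left)
  have 4: "(t / s) * integral\<^sup>L P (nsq u) = (\<integral>x. u x \<bullet> g x \<partial>P) + (\<integral>x. u x \<bullet> \<phi> x \<partial>P)"
  proof -
    have "(\<lambda>x. (t / s) * nsq u x) = (\<lambda>x. u x \<bullet> g x + u x \<bullet> \<phi> x)"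
      by (auto simp: g_def nsq_def inner_diff_right)
    then have "(\<integral>x. (t / s) * nsq u x \<partial>P) = (\<integral>x. u x \<bullet> g x + u x \<bullet> \<phi> x \<partial>P)" by simp
    then show ?thesis using b bg by simp
  qed
  have 5: "(\<integral>x. u x \<bullet> g x \<partial>P) \<le> e / 2"
  proof -
    have "(\<integral>x. u x \<bullet> g x \<partial>P) \<le> sqrt (integral\<^sup>L P (nsq u)) * sqrt (integral\<^sup>L P (nsq g))"
      using b bg by (intro integral_Cauchy_Schwarz) auto
    also have "\<dots> \<le> (D / t) * (t * e / (2 * D))"
    proof (rule mult_mono)
      show "sqrt (integral\<^sup>L P (nsq u)) \<le> D / t" using uD t by (simp add: field_simps)
      show "sqrt (integral\<^sup>L P (nsq g)) \<le> t * e / (2 * D)"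
        using g\<gamma> \<gamma>(2) real_sqrt_le_mono order_trans by blast
    qed (use D t in \<open>auto intro!: Bochner_Integration.integral_nonneg\<close>)
    also have "\<dots> = e / 2" using D t by simp
    finally show ?thesis .
  qed
  have "d + t * d = e / 2" using d(2) by (simp add: algebra_simps)
  then have "(\<integral>x. norm (f x - u x) \<partial>P) + t * sqrt (integral\<^sup>L P (nsq u)) \<le> K_constant m * ?\<kappa> + e"
    using 1 2 3 4 5 dual by linarith
  then show ?thesis using u by (rule that[rotated])
qed

end

section \<open>Functions of few coordinates\<close>

lemma fun_span_base: "g \<in> S \<Longrightarrow> g \<in> fun_span S"
  unfolding fun_span_def by (rule CollectI, rule exI[of _ "{g}"], rule exI[of _ "\<lambda>_. 1"]) auto

lemma fun_span_zero: "(\<lambda>x. 0) \<in> fun_span S"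
  unfolding fun_span_def by (rule CollectI, rule exI[of _ "{}"]) auto

lemma fun_span_mono: "S \<subseteq> T \<Longrightarrow> fun_span S \<subseteq> fun_span T"
  unfolding fun_span_def by blast

lemma fun_span_add:
  assumes "f \<in> fun_span S" "g \<in> fun_span S"
  shows "(\<lambda>x. f x + g x) \<in> fun_span S"
proof -
  obtain F c G d where F: "finite F" "F \<subseteq> S" "f = (\<lambda>x. \<Sum>h\<in>F. c h * h x)"
    and G: "finite G" "G \<subseteq> S" "g = (\<lambda>x. \<Sum>h\<in>G. d h * h x)"
    using assms unfolding fun_span_def by blast
  define c' d' where "c' h = (if h \<in> F then c h else 0)" and "d' h = (if h \<in> G then d h else 0)" for h
  have "f x + g x = (\<Sum>h\<in>F \<union> G. (c' h + d' h) * h x)" for x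
  proof -
    have "f x = (\<Sum>h\<in>F \<union> G. c' h * h x)"
      unfolding F(3) using F(1) G(1) by (intro sum.mono_neutral_cong_left) (auto simp: c'_def)
    moreover have "g x = (\<Sum>h\<in>F \<union> G. d' h * h x)"
      unfolding G(3) using F(1) G(1) by (intro sum.mono_neutral_cong_left) (auto simp: d'_def)
    ultimately show ?thesis by (simp add: distrib_right sum.distrib)
  qed
  then show ?thesis
    unfolding fun_span_def using F G by (intro CollectI exI[of _ "F \<union> G"] exI[of _ "\<lambda>h. c' h + d' h"]) auto
qed

lemma fun_span_sum:
  "(\<And>i. i \<in> A \<Longrightarrow> f i \<in> fun_span S) \<Longrightarrow> (\<lambda>x. \<Sum>i\<in>A. f i x) \<in> fun_span S"
  by (induction A rule: infinite_finite_induct) (auto simp: fun_span_zero fun_span_add)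

lemma norm_sum_mult_power2_le:
  fixes c a :: "'i \<Rightarrow> 'b::real_normed_field"
  shows "(norm (\<Sum>i\<in>F. c i * a i))\<^sup>2 \<le> card F * (\<Sum>i\<in>F. (norm (c i))\<^sup>2 * (norm (a i))\<^sup>2)"
proof -
  have "(norm (\<Sum>i\<in>F. c i * a i))\<^sup>2 \<le> (\<Sum>i\<in>F. norm (c i) * norm (a i))\<^sup>2"
    by (intro power_mono order_trans[OF norm_sum]) (auto simp: norm_mult)
  also have "\<dots> \<le> card F * (\<Sum>i\<in>F. (norm (c i) * norm (a i))\<^sup>2)"
    using sum_squared_le_sum_of_squares[of "\<lambda>i. norm (c i) * norm (a i)" F] by (simp only: mult.commute)
  finally show ?thesis by (simp add: power_mult_distrib)
qed

context coordinate_space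
begin

lemma norm_powr_2: "norm x powr 2 = x \<bullet> (x::'b::real_inner)"
  by (cases "x = 0") (auto simp: powr_numeral power2_norm_eq_inner)

lemma Lp_2_iff:
  fixes f :: "(nat \<Rightarrow> 'a) \<Rightarrow> 'b::{real_normed_field,real_inner,banach,second_countable_topology}"
  shows "f \<in> Lp P 2 \<longleftrightarrow> f \<in> borel_measurable P \<and> integrable P (nsq f)"
  by (simp add: Lp_def norm_powr_2 nsq_def)

lemma Lp_norm_2:
  fixes f :: "(nat \<Rightarrow> 'a) \<Rightarrow> 'b::{real_normed_field,real_inner,banach,second_countable_topology}"
  shows "Lp_norm P 2 f = sqrt (integral\<^sup>L P (nsq f))"
proof -
  have "0 \<le> integral\<^sup>L P (nsq f)" by (rule Bochner_Integration.integral_nonneg) simp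
  then show ?thesis by (simp add: Lp_norm_def norm_powr_2 nsq_def powr_half_sqrt)
qed

lemma Lp_1_iff:
  fixes f :: "(nat \<Rightarrow> 'a) \<Rightarrow> 'b::{real_normed_field,banach,second_countable_topology}"
  shows "f \<in> Lp P 1 \<longleftrightarrow> integrable P f"
  by (auto simp: Lp_def integrable_norm_iff)

lemma Lp_norm_1:
  fixes f :: "(nat \<Rightarrow> 'a) \<Rightarrow> 'b::{real_normed_field,banach,second_countable_topology}"
  shows "Lp_norm P 1 f = (\<integral>x. norm (f x) \<partial>P)"
  by (simp add: Lp_norm_def)

lemma
  fixes f :: "(nat \<Rightarrow> 'a) \<Rightarrow> 'b::{real_inner,banach,second_countable_topology}"
  assumes [measurable]: "f \<in> borel_measurable P" and "integrable P (nsq f)"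
  shows integrable_of_nsq: "integrable P f"
    and integral_norm_le: "(\<integral>x. norm (f x) \<partial>P) \<le> sqrt (integral\<^sup>L P (nsq f))"
proof -
  have eq: "nsq (\<lambda>x. norm (f x)) = nsq f" "nsq (\<lambda>x. 1::real) = (\<lambda>x. 1)"
    by (auto simp: nsq_def power2_norm_eq_inner simp flip: power2_eq_square)
  have "integrable P (\<lambda>x. norm (f x) \<bullet> 1)"
    using assms by (intro integrable_inner) (auto simp: eq)
  then show "integrable P f" by (simp add: integrable_norm_iff)
  have "(\<integral>x. norm (f x) \<bullet> 1 \<partial>P) \<le> sqrt (integral\<^sup>L P (nsq (\<lambda>x. norm (f x)))) * sqrt (integral\<^sup>L P (nsq (\<lambda>x. 1::real)))"
    using assms by (intro integral_Cauchy_Schwarz) (auto simp: eq)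
  then show "(\<integral>x. norm (f x) \<partial>P) \<le> sqrt (integral\<^sup>L P (nsq f))"
    by (simp add: eq P.prob_space)
qed

lemma integrable_nsq_diff:
  fixes u v :: "(nat \<Rightarrow> 'a) \<Rightarrow> 'b::{real_inner,banach,second_countable_topology}"
  assumes [measurable]: "u \<in> borel_measurable P" "v \<in> borel_measurable P"
    and "integrable P (nsq u)" "integrable P (nsq v)"
  shows "integrable P (nsq (\<lambda>x. u x - v x))"
proof (rule Bochner_Integration.integrable_bound)
  show "integrable P (\<lambda>x. 2 * nsq u x + 2 * nsq v x)" using assms by simp
  show "nsq (\<lambda>x. u x - v x) \<in> borel_measurable P" unfolding nsq_def by measurable
  show "AE x in P. norm (nsq (\<lambda>x. u x - v x) x) \<le> norm (2 * nsq u x + 2 * nsq v x)"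
    using nsq_diff_le[of u v] by (intro AE_I2) (simp add: abs_le_iff)
qed

definition low_degree :: "nat \<Rightarrow> ((nat \<Rightarrow> 'a) \<Rightarrow> 'b::{real_normed_field,banach,second_countable_topology}) set"
  where "low_degree k = {f \<in> Lp P 2. \<exists>J. finite J \<and> card J \<le> k \<and> depends_on M J f}"

lemma U2_le_eq: "U2_le M m = Lp_closure P 2 (fun_span (low_degree m))"
  by (simp add: U2_le_def low_degree_def)

lemma depends_on_iff_avg:
  assumes "bmf f" shows "depends_on M J f \<longleftrightarrow> avg (- J) f = f"
proof
  assume dep: "depends_on M J f"
  show "avg (- J) f = f"
    unfolding avg_eq_self_iff[OF assms]
  proof (intro ballI)
    fix x y assume xy: "x \<in> space P" "y \<in> space P"
    have "\<forall>j\<in>J. merge_coords (- J) x y j = x j" by (simp add: merge_coords_def)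
    then show "f (merge_coords (- J) x y) = f x"
      using dep xy merge_coords_space[OF xy] unfolding depends_on_def by blast
  qed
next
  assume eq: "avg (- J) f = f"
  show "depends_on M J f"
    unfolding depends_on_def
  proof (intro ballI impI)
    fix x y assume xy: "x \<in> space P" "y \<in> space P" "\<forall>j\<in>J. x j = y j"
    then have "merge_coords (- J) x y = y" by (auto simp: merge_coords_def fun_eq_iff)
    moreover have "f (merge_coords (- J) x y) = f x" using eq xy unfolding avg_eq_self_iff[OF assms] by blast
    ultimately show "f x = f y" by simp
  qed
qed

lemma bmf_in_low_degree:
  fixes f :: "(nat \<Rightarrow> 'a) \<Rightarrow> 'b::{real_normed_field,real_inner,banach,second_countable_topology}"
  assumes "bmf f" "finite J" "card J \<le> k" "avg (- J) f = f" shows "f \<in> low_degree k"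
  using assms unfolding low_degree_def by (auto simp: Lp_2_iff depends_on_iff_avg bmf_measurable)

lemma low_degree_mono: "j \<le> k \<Longrightarrow> low_degree j \<subseteq> low_degree k"
  unfolding low_degree_def by fastforce

text \<open>
  The coordinates that have been centred are moved from \<open>I\<close> to the set \<open>J\<close> of parameters; the order left over plus
  the number of parameters stays constant.
\<close>

lemma chaos_in_span:
  fixes f :: "(nat \<Rightarrow> 'a) \<Rightarrow> 'b::{real_normed_field,real_inner,banach,second_countable_topology}"
  assumes "finite I" "finite J" "I \<inter> J = {}" "bmf f" "avg (- (I \<union> J)) f = f"
  shows "chaos I k f \<in> fun_span (low_degree (k + card J))"
  using assms
proof (induction I arbitrary: J k f rule: finite_induct)
  case empty
  show ?case
  proof (cases k)
    case 0
    have "f \<in> low_degree (card J)" using empty by (intro bmf_in_low_degree[of _ J]) auto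
    then show ?thesis using empty by (simp add: 0 fun_span_base)
  qed (simp add: fun_span_zero)
next
  case (insert b I)
  note f = insert.prems(3) and dep = insert.prems(4)
  have b: "- (I \<union> J) \<union> {b} = {b} \<union> - (insert b I \<union> J)" using insert by auto
  have "avg (- (I \<union> J)) (avg {b} f) = avg {b} f"
  proof -
    have "avg (- (I \<union> J)) (avg {b} f) = avg {b} (avg (- (insert b I \<union> J)) f)"
      by (simp only: avg_avg[OF f] b)
    then show ?thesis by (simp only: dep)
  qed
  then have *: "chaos I k (avg {b} f) \<in> fun_span (low_degree (k + card J))"
    using insert by (intro insert.IH) auto
  show ?case
  proof (cases k)
    case 0
    then show ?thesis using * insert by (simp add: chaos_insert_0)
  next
    case (Suc j)
    have "I \<union> insert b J = insert b I \<union> J" by auto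
    then have "avg (- (I \<union> insert b J)) (centre b f) = centre b f"
      using f by (simp only: avg_centre dep)
    then have "chaos I j (centre b f) \<in> fun_span (low_degree (j + card (insert b J)))"
      using insert by (intro insert.IH) auto
    then show ?thesis using * insert by (simp add: Suc chaos_insert_Suc fun_span_add)
  qed
qed

lemma
  fixes s :: "(nat \<Rightarrow> 'a) \<Rightarrow> 'b::{real_normed_field,real_inner,banach,second_countable_topology}"
  assumes "s \<in> fun_span (low_degree k)"
  shows span_low_degree_measurable: "s \<in> borel_measurable P"
    and span_low_degree_integrable: "integrable P (nsq s)"
proof -
  obtain F c where F: "F \<subseteq> low_degree k" and s: "s = (\<lambda>x. \<Sum>h\<in>F. c h * h x)"
    using assms unfolding fun_span_def by blast
  have h: "h \<in> borel_measurable P" "integrable P (nsq h)" if "h \<in> F" for h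
    using rev_subsetD[OF that F] by (auto simp: low_degree_def Lp_2_iff)
  show [measurable]: "s \<in> borel_measurable P" unfolding s using h by measurable
  show "integrable P (nsq s)"
  proof (rule Bochner_Integration.integrable_bound)
    show "integrable P (\<lambda>x. card F * (\<Sum>h\<in>F. (norm (c h))\<^sup>2 * nsq h x))"
      using h by (intro integrable_mult_right Bochner_Integration.integrable_sum) auto
    show "nsq s \<in> borel_measurable P" unfolding nsq_def by measurable
    show "AE x in P. norm (nsq s x) \<le> norm (card F * (\<Sum>h\<in>F. (norm (c h))\<^sup>2 * nsq h x))"
    proof (intro AE_I2)
      fix x
      have "nsq s x \<le> card F * (\<Sum>h\<in>F. (norm (c h))\<^sup>2 * nsq h x)"
        using norm_sum_mult_power2_le[of c "\<lambda>h. h x" F] by (simp add: s nsq_def power2_norm_eq_inner)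
      then show "norm (nsq s x) \<le> norm (card F * (\<Sum>h\<in>F. (norm (c h))\<^sup>2 * nsq h x))"
        using nsq_nonneg[of s x] by (simp del: nsq_nonneg)
    qed
  qed
qed

lemma span_low_degree_in_U2_le:
  fixes f :: "(nat \<Rightarrow> 'a) \<Rightarrow> 'b::{real_normed_field,real_inner,banach,second_countable_topology}"
  assumes "f \<in> fun_span (low_degree k)" "bmf f" shows "f \<in> U2_le M k"
  unfolding U2_le_eq Lp_closure_def
proof (intro CollectI conjI allI impI)
  show "f \<in> Lp P 2" using assms(2) by (simp add: Lp_2_iff bmf_measurable)
  fix e :: real assume "e > 0"
  then show "\<exists>g\<in>fun_span (low_degree k). Lp_norm P 2 (\<lambda>x. f x - g x) < e"
    using assms(1) by (intro bexI[of _ f]) (auto simp: Lp_norm_2 nsq_def)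
qed

text \<open>
  A function is the sum of its Hoeffding components, and those of order higher than the number of its variables
  vanish.
\<close>

lemma sum_chaos:
  assumes "finite I" "bmf f" "avg (I - J) f = f" "card (J \<inter> I) \<le> n"
  shows "(\<lambda>x. \<Sum>k\<le>n. chaos I k f x) = f"
  using assms
proof (induction I arbitrary: f n rule: finite_induct)
  case empty
  have "(\<Sum>k\<le>n. chaos {} k f x) = f x" for x
    using empty by (simp add: sum.atMost_shift)
  then show ?case by auto
next
  case (insert b I)
  note f = insert.prems(1)
  show ?case
  proof (cases "b \<in> J")
    case True
    then have d: "insert b I - J = I - J" and c: "J \<inter> insert b I = insert b (J \<inter> I)" by auto
    then obtain n' where n: "n = Suc n'" using insert by (cases n) auto
    have "card (J \<inter> I) \<le> n'" using insert c n by simp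
    then have "(\<lambda>x. \<Sum>k\<le>n'. chaos I k (centre b f) x) = centre b f"
      using insert d f by (intro insert.IH) (auto simp: avg_centre)
    moreover have "(\<lambda>x. \<Sum>k\<le>n. chaos I k (avg {b} f) x) = avg {b} f"
    proof (rule insert.IH)
      have "avg (I - J) (avg {b} f) = avg {b} (avg (I - J) f)" using f by (simp add: avg_avg)
      then show "avg (I - J) (avg {b} f) = avg {b} f" using insert.prems d by simp
    qed (use insert \<open>card (J \<inter> I) \<le> n'\<close> n f in auto)
    moreover have "(\<Sum>k\<le>n. chaos (insert b I) k f x)
        = (\<Sum>k\<le>n. chaos I k (avg {b} f) x) + (\<Sum>k\<le>n'. chaos I k (centre b f) x)" for x
      using insert f by (simp add: n sum.atMost_Suc_shift chaos_insert_0 chaos_insert_Suc sum.distrib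
          del: sum.atMost_Suc)
    ultimately show ?thesis by (simp add: fun_eq_iff centre_def)
  next
    case False
    then have d: "insert b I - J = insert b (I - J)" and c: "J \<inter> insert b I = J \<inter> I" by auto
    have dep: "avg (insert b (I - J)) f = f" using insert.prems d by simp
    have "avg {b} (avg (insert b (I - J)) f) = avg (insert b (I - J)) f" by (simp only: avg_avg[OF f]) simp
    then have inv: "avg {b} f = f" by (simp only: dep)
    have "avg (I - J) f = avg (I - J) (avg {b} f)" by (simp only: inv)
    also have "\<dots> = avg (insert b (I - J)) f" by (simp only: avg_avg[OF f]) simp
    finally have "avg (I - J) f = f" by (simp only: dep)
    then have "(\<lambda>x. \<Sum>k\<le>n. chaos I k f x) = f"
      using insert c f by (intro insert.IH) auto
    moreover have "centre b f = (\<lambda>x. 0)" by (simp add: centre_def inv)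
    then have "chaos (insert b I) k f = chaos I k f" for k
      using insert f by (cases k) (auto simp: chaos_insert_0 chaos_insert_Suc inv)
    ultimately show ?thesis by simp
  qed
qed

text \<open>
  Averaging over a coordinate that \<open>u\<close> ignores does nothing, and centring in it gives \<open>0\<close>; so in the recursion
  only the first term remains.
\<close>

lemma finite_chaos_mono:
  assumes "u \<in> finite_chaos I m" "finite I'" "I \<subseteq> I'" shows "u \<in> finite_chaos I' m"
proof -
  have u: "bmf u" "chaos I m u = u" "avg (- I) u = u" using assms by (auto simp: finite_chaos_def)
  have inv: "avg K u = u" if "K \<inter> I = {}" for K
  proof -
    have "avg K u = avg K (avg (- I) u)" by (simp only: u)
    also have "K \<union> - I = - I" using that by auto
    then have "avg K (avg (- I) u) = avg (- I) u" using u(1) by (simp add: avg_avg)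
    finally show ?thesis by (simp only: u)
  qed
  have "chaos (I \<union> K) m u = u" if "finite K" "K \<inter> I = {}" for K
    using that
  proof (induction K rule: finite_induct)
    case empty
    then show ?case using u by simp
  next
    case (insert b K)
    have fin: "finite (I \<union> K)" "b \<notin> I \<union> K"
      using insert assms finite_subset by auto
    have b: "avg {b} u = u" using insert by (intro inv) auto
    have "centre b u = (\<lambda>x. 0)" by (simp add: centre_def b)
    then show ?case
      using fin insert u(1) by (cases m) (auto simp: chaos_insert_0 chaos_insert_Suc b)
  qed
  from this[of "I' - I"] have "chaos I' m u = u"
    using assms by (auto simp: Un_absorb1)
  moreover have "avg (- I') u = u" using assms by (intro inv) auto
  ultimately show ?thesis using u(1) by (simp add: finite_chaos_def)
qed

lemma chaos_sum:
  fixes f :: "'i \<Rightarrow> (nat \<Rightarrow> 'a) \<Rightarrow> 'b::{banach,second_countable_topology}"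
  assumes "\<And>i. i \<in> A \<Longrightarrow> bmf (f i)"
  shows "chaos I k (\<lambda>x. \<Sum>i\<in>A. f i x) = (\<lambda>x. \<Sum>i\<in>A. chaos I k (f i) x)"
  using assms by (induction A rule: infinite_finite_induct) (auto simp: chaos_add)

text \<open>
  Truncating the summands separately keeps each of them dependent on at most \<open>m\<close> coordinates; truncating the sum
  would not. Convergence is dominated.
\<close>

lemma span_low_degree_approx:
  fixes s :: "(nat \<Rightarrow> 'a) \<Rightarrow> 'b::{real_normed_field,real_inner,banach,second_countable_topology}"
  assumes s: "s \<in> fun_span (low_degree m)" and e: "e > 0"
  shows "\<exists>F p. finite (F :: ((nat \<Rightarrow> 'a) \<Rightarrow> 'b) set) \<and>
    (\<forall>h\<in>F. bmf (p h) \<and> (\<exists>J. finite J \<and> card J \<le> m \<and> avg (- J) (p h) = p h)) \<and>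
    integrable P (nsq (\<lambda>x. s x - (\<Sum>h\<in>F. p h x))) \<and>
    integral\<^sup>L P (nsq (\<lambda>x. s x - (\<Sum>h\<in>F. p h x))) < e"
proof -
  obtain F c where F: "finite F" "F \<subseteq> low_degree m" and sF: "s = (\<lambda>x. \<Sum>h\<in>F. c h * h x)"
    using s unfolding fun_span_def by blast
  have hF [measurable]: "h \<in> borel_measurable P" and hF2: "integrable P (nsq h)"
    and hF3: "\<exists>J. finite J \<and> card J \<le> m \<and> depends_on M J h" if "h \<in> F" for h
  proof -
    have "h \<in> low_degree m" using that F(2) by (rule rev_subsetD)
    then show "h \<in> borel_measurable P" "integrable P (nsq h)" "\<exists>J. finite J \<and> card J \<le> m \<and> depends_on M J h"
      by (auto simp: low_degree_def Lp_2_iff)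
  qed
  define tr where "tr n h x = (if norm (h x) \<le> real n \<and> x \<in> space P then h x else 0)"
    for n and h :: "(nat \<Rightarrow> 'a) \<Rightarrow> 'b" and x
  define p where "p n h x = c h * tr n h x" for n h x
  have p: "bmf (p n h)" if "h \<in> F" for n h
  proof (rule bmfI)
    have [measurable]: "h \<in> borel_measurable P" using hF[OF that] .
    have "tr n h \<in> borel_measurable P" unfolding tr_def by measurable
    then show "p n h \<in> borel_measurable P" unfolding p_def by measurable
    show "norm (p n h x) \<le> norm (c h) * real n" for x
      by (auto simp: p_def tr_def norm_mult intro!: mult_left_mono)
  qed (simp add: p_def tr_def)
  have dep: "\<exists>J. finite J \<and> card J \<le> m \<and> avg (- J) (p n h) = p n h" if h: "h \<in> F" for n h
  proof -
    obtain J where J: "finite J" "card J \<le> m" and d: "depends_on M J h" using hF3[OF h] by blast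
    have "depends_on M J (p n h)"
      unfolding depends_on_def
    proof (intro ballI impI)
      fix x y assume xy: "x \<in> space P" "y \<in> space P" "\<forall>j\<in>J. x j = y j"
      then have "h x = h y" using d unfolding depends_on_def by blast
      then show "p n h x = p n h y" using xy by (simp add: p_def tr_def)
    qed
    then show ?thesis using J depends_on_iff_avg[OF p[OF h]] by blast
  qed
  have diff: "s x - (\<Sum>h\<in>F. p n h x) = (\<Sum>h\<in>F. c h * (h x - tr n h x))" for n x
    by (simp add: sF p_def sum_subtractf right_diff_distrib)
  let ?w = "\<lambda>x. card F * (\<Sum>h\<in>F. (norm (c h))\<^sup>2 * nsq h x)"
  have w: "integrable P ?w"
    using hF2 by (intro integrable_mult_right Bochner_Integration.integrable_sum) auto
  have sm [measurable]: "s \<in> borel_measurable P" unfolding sF using hF by measurable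
  have sp [measurable]: "(\<lambda>x. \<Sum>h\<in>F. p n h x) \<in> borel_measurable P" for n
    using p by (intro bmf_measurable bmf_sum)
  have meas: "nsq (\<lambda>x. s x - (\<Sum>h\<in>F. p n h x)) \<in> borel_measurable P" for n
    unfolding nsq_def by measurable
  have bound: "norm (nsq (\<lambda>x. s x - (\<Sum>h\<in>F. p n h x)) x) \<le> ?w x" if "x \<in> space P" for n x
  proof -
    have "nsq (\<lambda>x. s x - (\<Sum>h\<in>F. p n h x)) x = (norm (\<Sum>h\<in>F. c h * (h x - tr n h x)))\<^sup>2"
      by (simp add: nsq_def power2_norm_eq_inner diff)
    also have "\<dots> \<le> card F * (\<Sum>h\<in>F. (norm (c h))\<^sup>2 * (norm (h x - tr n h x))\<^sup>2)"
      by (rule norm_sum_mult_power2_le)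
    also have "\<dots> \<le> card F * (\<Sum>h\<in>F. (norm (c h))\<^sup>2 * (norm (h x))\<^sup>2)"
      using that by (intro mult_left_mono sum_mono power_mono) (auto simp: tr_def)
    finally show ?thesis by (simp add: nsq_def power2_norm_eq_inner)
  qed
  have "(\<lambda>n. integral\<^sup>L P (nsq (\<lambda>x. s x - (\<Sum>h\<in>F. p n h x)))) \<longlonglongrightarrow> integral\<^sup>L P (\<lambda>x. 0)"
  proof (rule integral_dominated_convergence[OF _ meas w])
    show "AE x in P. (\<lambda>n. nsq (\<lambda>x. s x - (\<Sum>h\<in>F. p n h x)) x) \<longlonglongrightarrow> 0"
    proof (intro AE_I2)
      fix x assume x: "x \<in> space P"
      define N where "N = nat \<lceil>Max (insert 0 ((\<lambda>h. norm (h x)) ` F))\<rceil>"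
      have "nsq (\<lambda>x. s x - (\<Sum>h\<in>F. p n h x)) x = 0" if "n \<ge> N" for n
      proof -
        have "tr n h x = h x" if h: "h \<in> F" for h
        proof -
          have "norm (h x) \<le> Max (insert 0 ((\<lambda>h. norm (h x)) ` F))" using F h by (intro Max_ge) auto
          also have "\<dots> \<le> real N" unfolding N_def by linarith
          also have "\<dots> \<le> real n" using \<open>n \<ge> N\<close> by simp
          finally show ?thesis using x by (simp add: tr_def)
        qed
        then show ?thesis by (simp add: nsq_def diff)
      qed
      then show "(\<lambda>n. nsq (\<lambda>x. s x - (\<Sum>h\<in>F. p n h x)) x) \<longlonglongrightarrow> 0"
        by (intro tendsto_eventually eventually_sequentiallyI[of N])
    qed
    show "AE x in P. norm (nsq (\<lambda>x. s x - (\<Sum>h\<in>F. p n h x)) x) \<le> ?w x" for n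
      using bound by auto
  qed simp
  then have "(\<lambda>n. integral\<^sup>L P (nsq (\<lambda>x. s x - (\<Sum>h\<in>F. p n h x)))) \<longlonglongrightarrow> 0" by simp
  then have "\<forall>\<^sub>F n in sequentially. integral\<^sup>L P (nsq (\<lambda>x. s x - (\<Sum>h\<in>F. p n h x))) < e"
    using e by (rule order_tendstoD(2))
  then obtain n where n: "integral\<^sup>L P (nsq (\<lambda>x. s x - (\<Sum>h\<in>F. p n h x))) < e"
    by (auto simp: eventually_sequentially)
  have "integrable P (nsq (\<lambda>x. s x - (\<Sum>h\<in>F. p n h x)))"
    by (rule Bochner_Integration.integrable_bound[OF w meas]) (use bound[of _ n] in \<open>force simp: abs_le_iff\<close>)
  then show ?thesis using F(1) p dep n by (intro exI[of _ F] exI[of _ "p n"]) auto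
qed

end

section \<open>K-closedness\<close>

text \<open>
  The algebraic facts shared by the reals with the identity and the complex numbers with \<open>cnj\<close>.
\<close>

locale scalar_conjugation =
  fixes cj :: "'b \<Rightarrow> 'b::{real_normed_field,real_inner,banach,second_countable_topology}"
    and re :: "'b \<Rightarrow> real"
  assumes cj_linear: "bounded_linear cj" and cj_mult: "cj (x * y) = cj x * cj y"
    and norm_cj: "norm (cj x) = norm x"
    and re_linear: "bounded_linear re" and inner_eq: "x \<bullet> y = re (x * cj y)"

locale chaos_spaces = coordinate_space M + scalar_conjugation cj re
  for M :: "'a measure" and cj :: "'b \<Rightarrow> 'b::{real_normed_field,real_inner,banach,second_countable_topology}"
    and re :: "'b \<Rightarrow> real"
begin

lemma cj_measurable [measurable]: "cj \<in> borel_measurable borel"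
  by (intro borel_measurable_continuous_onI linear_continuous_on cj_linear)

lemma integrable_mult_cj:
  assumes u: "bmf u" and [measurable]: "w \<in> borel_measurable P" and w: "integrable P (nsq w)"
  shows "integrable P (\<lambda>x. u x * cj (w x))"
proof -
  obtain c where c: "c \<ge> 0" "\<And>x. norm (u x) \<le> c" using bmf_bounded[OF u] by blast
  have [measurable]: "u \<in> borel_measurable P" using u by (rule bmf_measurable)
  show ?thesis
  proof (rule Bochner_Integration.integrable_bound)
    show "integrable P (\<lambda>x. c * norm (w x))" using w by (simp add: integrable_of_nsq)
    show "AE x in P. norm (u x * cj (w x)) \<le> norm (c * norm (w x))"
      using c by (auto simp: norm_mult norm_cj intro!: mult_right_mono)
  qed measurable
qed

lemma integral_avg_mult_cj:
  assumes u: "bmf u" and [measurable]: "w \<in> borel_measurable P" and w: "integrable P (nsq w)"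
    and dep: "depends_on M J w" and b: "b \<notin> J"
  shows "(\<integral>x. avg {b} u x * cj (w x) \<partial>P) = (\<integral>x. u x * cj (w x) \<partial>P)"
proof -
  have "(\<integral>x. u x * cj (w x) \<partial>P)
      = (\<integral>x. \<integral>y. u (merge_coords {b} x y) * cj (w (merge_coords {b} x y)) \<partial>P \<partial>P)"
    using integral_merge_coords[OF integrable_mult_cj[OF u _ w], of "{b}"] by simp
  also have "\<dots> = (\<integral>x. avg {b} u x * cj (w x) \<partial>P)"
  proof (rule Bochner_Integration.integral_cong[OF refl])
    fix x assume x: "x \<in> space P"
    have "w (merge_coords {b} x y) = w x" if "y \<in> space P" for y
    proof -
      have "\<forall>j\<in>J. merge_coords {b} x y j = x j" using b by (auto simp: merge_coords_def)
      then show ?thesis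
        using dep x merge_coords_space[OF x that, of "{b}"] unfolding depends_on_def by blast
    qed
    then have "(\<integral>y. u (merge_coords {b} x y) * cj (w (merge_coords {b} x y)) \<partial>P)
        = (\<integral>y. u (merge_coords {b} x y) * cj (w x) \<partial>P)"
      by (intro Bochner_Integration.integral_cong) auto
    then show "(\<integral>y. u (merge_coords {b} x y) * cj (w (merge_coords {b} x y)) \<partial>P) = avg {b} u x * cj (w x)"
      using x bmf_section_integrable[OF u x] by (simp add: avg_def)
  qed
  finally show ?thesis ..
qed

text \<open>
  Each Hoeffding component of order \<open>k\<close> is centred in some coordinate on which \<open>w\<close> does not depend.
\<close>

lemma chaos_orthogonal_low_degree:
  assumes "finite I" "bmf u" and [measurable]: "w \<in> borel_measurable P" and w: "integrable P (nsq w)"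
    and dep: "depends_on M J w" and "card (J \<inter> I) < k"
  shows "(\<integral>x. chaos I k u x * cj (w x) \<partial>P) = 0"
  using assms(1,2,6)
proof (induction I arbitrary: k u rule: finite_induct)
  case empty
  then obtain j where "k = Suc j" by (cases k) auto
  then show ?case by simp
next
  case (insert b I)
  then obtain j where k: "k = Suc j" by (cases k) auto
  note u = insert.prems(1)
  have int: "integrable P (\<lambda>x. p x * cj (w x))" if "bmf p" for p
    using that by (intro integrable_mult_cj assms(3) w)
  have split: "(\<integral>x. chaos (insert b I) k u x * cj (w x) \<partial>P)
      = (\<integral>x. chaos I k (avg {b} u) x * cj (w x) \<partial>P) + (\<integral>x. chaos I j (centre b u) x * cj (w x) \<partial>P)"
    using insert u int by (simp add: k chaos_insert_Suc distrib_right)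
  have "card (J \<inter> I) \<le> card (J \<inter> insert b I)"
    using insert.hyps by (intro card_mono) auto
  then have 1: "(\<integral>x. chaos I k (avg {b} u) x * cj (w x) \<partial>P) = 0"
    using insert by (intro insert.IH) auto
  have 2: "(\<integral>x. chaos I j (centre b u) x * cj (w x) \<partial>P) = 0"
  proof (cases "b \<in> J")
    case True
    then have "J \<inter> insert b I = insert b (J \<inter> I)" by auto
    then show ?thesis using insert k by (intro insert.IH) auto
  next
    case False
    have "chaos I j (centre b u) = (\<lambda>x. chaos I j u x - avg {b} (chaos I j u) x)"
      using centre_chaos[OF u, of b I j] by (simp add: centre_def)
    then show ?thesis
      using integral_avg_mult_cj[OF _ _ w dep False, of "chaos I j u"] u int
      by (simp add: left_diff_distrib)
  qed
  show ?case using split 1 2 by simp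
qed

lemma finite_chaos_subset_U2:
  assumes I: "finite I" and u: "u \<in> finite_chaos I m" shows "u \<in> U2 cj M m"
proof -
  have b: "bmf u" and Q: "chaos I m u = u" and dep: "avg (- I) u = u"
    using u by (auto simp: finite_chaos_def)
  note [measurable] = bmf_measurable[OF b]
  have "chaos I m u \<in> fun_span (low_degree (m + card ({}::nat set)))"
    using I b dep by (intro chaos_in_span) auto
  then have le: "u \<in> U2_le M m" using b Q by (intro span_low_degree_in_U2_le) auto
  show ?thesis
  proof (cases m)
    case (Suc j)
    have "(\<integral>x. u x * cj (w x) \<partial>P) = 0" if w: "w \<in> U2_le M j" for w
    proof -
      have wL: "w \<in> Lp P 2" using w by (auto simp: U2_le_eq Lp_closure_def)
      then have [measurable]: "w \<in> borel_measurable P" and iw: "integrable P (nsq w)" by (auto simp: Lp_2_iff)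
      define N where "N = sqrt (integral\<^sup>L P (nsq u))"
      have N: "N \<ge> 0" by (auto simp: N_def intro!: Bochner_Integration.integral_nonneg)
      have "norm (\<integral>x. u x * cj (w x) \<partial>P) \<le> 0 + e" if e: "e > 0" for e
      proof -
        obtain g where g: "g \<in> fun_span (low_degree j)" and "Lp_norm P 2 (\<lambda>x. w x - g x) < e / (N + 1)"
          using w e N unfolding U2_le_eq Lp_closure_def by (auto dest!: spec[of _ "e / (N + 1)"])
        then have ge: "sqrt (integral\<^sup>L P (nsq (\<lambda>x. w x - g x))) < e / (N + 1)" by (simp add: Lp_norm_2)
        obtain F c where F: "finite F" "F \<subseteq> low_degree j" and gF: "g = (\<lambda>x. \<Sum>h\<in>F. c h * h x)"
          using g unfolding fun_span_def by blast
        have hF: "h \<in> borel_measurable P" "integrable P (nsq h)" "(\<integral>x. u x * cj (h x) \<partial>P) = 0" if "h \<in> F" for h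
        proof -
          have "h \<in> low_degree j" using that F(2) by (rule rev_subsetD)
          then obtain J where J: "finite J" "card J \<le> j" "depends_on M J h" and h: "h \<in> Lp P 2"
            by (auto simp: low_degree_def)
          show *: "h \<in> borel_measurable P" "integrable P (nsq h)" using h by (auto simp: Lp_2_iff)
          have "card (J \<inter> I) \<le> card J" using J by (intro card_mono) auto
          then show "(\<integral>x. u x * cj (h x) \<partial>P) = 0"
            using chaos_orthogonal_low_degree[OF I b * J(3), of m] J Suc Q by simp
        qed
        have cg: "u x * cj (g x) = (\<Sum>h\<in>F. cj (c h) * (u x * cj (h x)))" for x
          unfolding gF using bounded_linear.linear[OF cj_linear]
          by (simp add: linear_sum cj_mult sum_distrib_left mult.left_commute)
        have ig: "integrable P (\<lambda>x. u x * cj (g x))"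
          unfolding cg using hF by (intro Bochner_Integration.integrable_sum integrable_mult_right integrable_mult_cj b) auto
        have "(\<integral>x. u x * cj (g x) \<partial>P) = (\<Sum>h\<in>F. cj (c h) * (\<integral>x. u x * cj (h x) \<partial>P))"
          unfolding cg using hF
          by (subst Bochner_Integration.integral_sum)
            (auto intro!: integrable_mult_right integrable_mult_cj b)
        also have "\<dots> = 0" using hF by simp
        finally have zero: "(\<integral>x. u x * cj (g x) \<partial>P) = 0" .
        have [measurable]: "g \<in> borel_measurable P" using g by (rule span_low_degree_measurable)
        have inq: "integrable P (nsq (\<lambda>x. w x - g x))"
          using iw span_low_degree_integrable[OF g] by (intro integrable_nsq_diff) auto
        have cj_diff: "cj (x - y) = cj x - cj y" for x y
          using bounded_linear.linear[OF cj_linear] by (rule linear_diff)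
        have "(\<integral>x. u x * cj (w x) \<partial>P) = (\<integral>x. u x * cj (w x - g x) \<partial>P)"
          using zero ig integrable_mult_cj[OF b _ iw] by (simp add: cj_diff right_diff_distrib)
        then have "norm (\<integral>x. u x * cj (w x) \<partial>P) \<le> (\<integral>x. norm (u x * cj (w x - g x)) \<partial>P)"
          by (simp add: integral_norm_bound)
        also have "\<dots> = (\<integral>x. norm (u x) \<bullet> norm (w x - g x) \<partial>P)" by (simp add: norm_mult norm_cj)
        also have "\<dots> \<le> sqrt (integral\<^sup>L P (nsq (\<lambda>x. norm (u x)))) * sqrt (integral\<^sup>L P (nsq (\<lambda>x. norm (w x - g x))))"
          using inq b by (intro integral_Cauchy_Schwarz)
            (auto simp: nsq_def power2_norm_eq_inner simp flip: power2_eq_square)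
        also have "\<dots> = N * sqrt (integral\<^sup>L P (nsq (\<lambda>x. w x - g x)))"
          by (simp add: N_def nsq_def power2_norm_eq_inner flip: power2_eq_square)
        also have "\<dots> \<le> (N + 1) * (e / (N + 1))"
          using ge N e by (intro mult_mono) (auto intro!: Bochner_Integration.integral_nonneg)
        also have "\<dots> = 0 + e" using N by simp
        finally show ?thesis .
      qed
      then have "norm (\<integral>x. u x * cj (w x) \<partial>P) \<le> 0" by (rule field_le_epsilon)
      then show ?thesis by simp
    qed
    then show ?thesis using le by (simp add: Suc L2_inner_def)
  qed (use le in simp)
qed

text \<open>
  The difference consists of the Hoeffding components of \<open>p\<close> of order below \<open>m\<close>, so it lies in the space to which
  \<open>v\<close> is orthogonal.
\<close>

lemma U2_orthogonal:
  assumes v: "v \<in> U2 cj M m" and J: "finite J" "card J \<le> m" and I: "finite I" "J \<subseteq> I"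
    and p: "bmf p" "avg (- J) p = p"
  shows "(\<integral>x. v x \<bullet> (p x - chaos I m p x) \<partial>P) = 0"
proof -
  have inv: "avg K p = p" if "K \<inter> J = {}" for K
  proof -
    have "K \<union> - J = - J" using that by auto
    then have "avg K (avg (- J) p) = avg (- J) p" using p(1) by (simp add: avg_avg)
    then show ?thesis by (simp only: p(2))
  qed
  have "(\<lambda>x. \<Sum>k\<le>m. chaos I k p x) = p"
    using I J p inv[of "I - J"] by (intro sum_chaos[of _ _ J]) (auto simp: Int_absorb2)
  then have eq: "p x = (\<Sum>k\<le>m. chaos I k p x)" for x by metis
  show ?thesis
  proof (cases m)
    case 0
    then have "p x - chaos I m p x = 0" for x using eq[of x] by simp
    then show ?thesis by simp
  next
    case (Suc j)
    have "p x - chaos I m p x = (\<Sum>k\<le>j. chaos I k p x)" for x using eq[of x] by (simp add: Suc)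
    then have q: "(\<lambda>x. p x - chaos I m p x) = (\<lambda>x. \<Sum>k\<le>j. chaos I k p x)" by simp
    have "(\<lambda>x. \<Sum>k\<le>j. chaos I k p x) \<in> fun_span (low_degree j)"
    proof (rule fun_span_sum)
      fix k assume "k \<in> {..j}"
      then have "fun_span (low_degree k) \<subseteq> (fun_span (low_degree j) :: ((nat \<Rightarrow> 'a) \<Rightarrow> 'b) set)"
        by (intro fun_span_mono low_degree_mono) auto
      moreover have "chaos I k p \<in> fun_span (low_degree (k + card ({}::nat set)))"
        using I p inv[of "- I"] by (intro chaos_in_span) auto
      ultimately show "chaos I k p \<in> fun_span (low_degree j)" by auto
    qed
    then have "(\<lambda>x. p x - chaos I m p x) \<in> U2_le M j"
      unfolding q using p by (intro span_low_degree_in_U2_le) auto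
    then have zero: "(\<integral>x. v x * cj (p x - chaos I m p x) \<partial>P) = 0"
      using v by (simp add: Suc L2_inner_def)
    have vL: "v \<in> Lp P 2" using v by (auto simp: Suc U2_le_eq Lp_closure_def)
    then have [measurable]: "v \<in> borel_measurable P" and iv: "integrable P v"
      by (auto simp: Lp_2_iff integrable_of_nsq)
    obtain c where c: "c \<ge> 0" "\<And>x. norm (p x - chaos I m p x) \<le> c"
      using bmf_bounded[of "\<lambda>x. p x - chaos I m p x"] p by blast
    have [measurable]: "p \<in> borel_measurable P" "chaos I m p \<in> borel_measurable P"
      using p by (auto intro: bmf_measurable)
    have int: "integrable P (\<lambda>x. v x * cj (p x - chaos I m p x))"
    proof (rule Bochner_Integration.integrable_bound)
      show "integrable P (\<lambda>x. c * norm (v x))" using iv by simp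
      show "AE x in P. norm (v x * cj (p x - chaos I m p x)) \<le> norm (c * norm (v x))"
      proof (intro AE_I2)
        fix x
        have "norm (v x) * norm (p x - chaos I m p x) \<le> norm (v x) * c"
          by (intro mult_left_mono c(2)) simp
        then show "norm (v x * cj (p x - chaos I m p x)) \<le> norm (c * norm (v x))"
          using c(1) by (simp add: norm_mult norm_cj mult.commute)
      qed
    qed measurable
    have "(\<integral>x. v x \<bullet> (p x - chaos I m p x) \<partial>P) = re (\<integral>x. v x * cj (p x - chaos I m p x) \<partial>P)"
      unfolding inner_eq by (rule integral_bounded_linear[OF re_linear int])
    then show ?thesis using zero bounded_linear.linear[OF re_linear] by (simp add: linear_0)
  qed
qed

text \<open>
  Approximation in \<open>L\<^sup>1\<close> by finite chaoses. Asking for it with all large coordinate sets allows to choose a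
  common set for several functions.
\<close>

definition chaos_approximable :: "nat \<Rightarrow> ((nat \<Rightarrow> 'a) \<Rightarrow> 'b) \<Rightarrow> bool"
  where "chaos_approximable m f \<longleftrightarrow> integrable P f \<and> (\<forall>e>0. \<exists>I0. finite I0 \<and>
    (\<forall>I. finite I \<longrightarrow> I0 \<subseteq> I \<longrightarrow> (\<exists>u\<in>finite_chaos I m. (\<integral>x. norm (f x - u x) \<partial>P) < e)))"

lemma U2_Lp: "v \<in> U2 cj M m \<Longrightarrow> v \<in> Lp P 2"
  by (cases m) (auto simp: U2_le_eq Lp_closure_def)

text \<open>
  Approximate \<open>v\<close> in \<open>L\<^sup>2\<close> by a sum \<open>q\<close> of bounded functions of at most \<open>m\<close> coordinates. Since \<open>v\<close> and the projection
  \<open>u\<close> of \<open>q\<close> are both orthogonal to \<open>q - u\<close>, the projection is at least as close to \<open>v\<close> as \<open>q\<close>.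
\<close>

lemma U2_approximable:
  assumes v: "v \<in> U2 cj M m" shows "chaos_approximable m v"
  unfolding chaos_approximable_def
proof (intro conjI allI impI)
  have [measurable]: "v \<in> borel_measurable P" and iv: "integrable P (nsq v)"
    using U2_Lp[OF v] by (auto simp: Lp_2_iff)
  show "integrable P v" using iv by (simp add: integrable_of_nsq)
  fix e :: real assume e: "e > 0"
  have "v \<in> U2_le M m" using v by (cases m) auto
  then obtain s where s: "s \<in> fun_span (low_degree m)" and "Lp_norm P 2 (\<lambda>x. v x - s x) < e / 4"
    using e unfolding U2_le_eq Lp_closure_def by (auto dest!: spec[of _ "e / 4"])
  then have vs: "sqrt (integral\<^sup>L P (nsq (\<lambda>x. v x - s x))) < e / 4" by (simp add: Lp_norm_2)
  have e4: "(e / 4)\<^sup>2 > 0" using e by simp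
  obtain F :: "((nat \<Rightarrow> 'a) \<Rightarrow> 'b) set" and p where F: "finite F"
    and pF: "\<forall>h\<in>F. bmf (p h) \<and> (\<exists>J. finite J \<and> card J \<le> m \<and> avg (- J) (p h) = p h)"
    and i1: "integrable P (nsq (\<lambda>x. s x - (\<Sum>h\<in>F. p h x)))"
    and s1: "integral\<^sup>L P (nsq (\<lambda>x. s x - (\<Sum>h\<in>F. p h x))) < (e / 4)\<^sup>2"
    using span_low_degree_approx[OF s e4] by (elim exE conjE)
  have p: "bmf (p h)" and dep: "\<exists>J. finite J \<and> card J \<le> m \<and> avg (- J) (p h) = p h" if "h \<in> F" for h
    using pF that by auto
  have "\<exists>J. \<forall>h\<in>F. finite (J h) \<and> card (J h) \<le> m \<and> avg (- J h) (p h) = p h"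
    by (rule bchoice, rule ballI, rule dep)
  then obtain J where J: "\<And>h. h \<in> F \<Longrightarrow> finite (J h)" "\<And>h. h \<in> F \<Longrightarrow> card (J h) \<le> m"
    "\<And>h. h \<in> F \<Longrightarrow> avg (- J h) (p h) = p h" by blast
  define q where "q = (\<lambda>x. \<Sum>h\<in>F. p h x)"
  have q: "bmf q" unfolding q_def using p by auto
  have vs2: "integral\<^sup>L P (nsq (\<lambda>x. v x - s x)) < (e / 4)\<^sup>2"
  proof -
    have "0 \<le> integral\<^sup>L P (nsq (\<lambda>x. v x - s x))" by (rule Bochner_Integration.integral_nonneg) simp
    then show ?thesis using power_strict_mono[OF vs, of 2] by simp
  qed
  have ivq: "integrable P (nsq (\<lambda>x. v x - q x))"
    using iv q by (intro integrable_nsq_diff) auto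
  have ivs: "integrable P (nsq (\<lambda>x. v x - s x))"
    using iv span_low_degree_measurable[OF s] span_low_degree_integrable[OF s]
    by (intro integrable_nsq_diff) auto
  have "integral\<^sup>L P (nsq (\<lambda>x. v x - q x)) \<le> (\<integral>x. 2 * nsq (\<lambda>x. v x - s x) x + 2 * nsq (\<lambda>x. s x - q x) x \<partial>P)"
  proof (rule integral_mono[OF ivq])
    show "integrable P (\<lambda>x. 2 * nsq (\<lambda>x. v x - s x) x + 2 * nsq (\<lambda>x. s x - q x) x)"
      using ivs i1 by (simp add: q_def)
    show "nsq (\<lambda>x. v x - q x) x \<le> 2 * nsq (\<lambda>x. v x - s x) x + 2 * nsq (\<lambda>x. s x - q x) x" for x
      using nsq_add_le[of "\<lambda>x. v x - s x" "\<lambda>x. s x - q x" x] by simp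
  qed
  also have "\<dots> = 2 * integral\<^sup>L P (nsq (\<lambda>x. v x - s x)) + 2 * integral\<^sup>L P (nsq (\<lambda>x. s x - q x))"
    using ivs i1 by (simp add: q_def)
  also have "\<dots> < 2 * (e / 4)\<^sup>2 + 2 * (e / 4)\<^sup>2"
    using vs2 s1 by (simp add: q_def)
  also have "\<dots> = (e / 2)\<^sup>2" by (simp add: power_divide)
  finally have vq: "integral\<^sup>L P (nsq (\<lambda>x. v x - q x)) < (e / 2)\<^sup>2" .
  show "\<exists>I0. finite I0 \<and> (\<forall>I. finite I \<longrightarrow> I0 \<subseteq> I \<longrightarrow> (\<exists>u\<in>finite_chaos I m. (\<integral>x. norm (v x - u x) \<partial>P) < e))"
  proof (intro exI[of _ "\<Union>h\<in>F. J h"] conjI allI impI)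
    show "finite (\<Union>h\<in>F. J h)" using F J by auto
    fix I assume I: "finite I" "(\<Union>h\<in>F. J h) \<subseteq> I"
    define u where "u = chaos I m q"
    have bu: "bmf u" using q by (simp add: u_def)
    have "avg (- I) (p h) = p h" if h: "h \<in> F" for h
    proof -
      have "- I \<union> - J h = - J h" using I h by auto
      then have "avg (- I) (avg (- J h) (p h)) = avg (- J h) (p h)" using p[OF h] by (simp add: avg_avg)
      then show ?thesis by (simp only: J(3)[OF h])
    qed
    then have "avg (- I) q = q" unfolding q_def using p by (simp add: avg_sum)
    then have u: "u \<in> finite_chaos I m" unfolding u_def using q I by (intro chaos_in_finite_chaos)
    define w where "w = (\<lambda>x. q x - u x)"
    have bw: "bmf w" using q bu by (auto simp: w_def)
    have iin: "integrable P (\<lambda>x. v x \<bullet> r x)" if "bmf r" for r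
      using iv that by (intro integrable_inner) auto
    have "(\<integral>x. v x \<bullet> w x \<partial>P) = (\<Sum>h\<in>F. \<integral>x. v x \<bullet> (p h x - chaos I m (p h) x) \<partial>P)"
    proof -
      have "w = (\<lambda>x. \<Sum>h\<in>F. p h x - chaos I m (p h) x)"
        unfolding w_def u_def q_def using p by (simp add: chaos_sum sum_subtractf)
      then show ?thesis using p iin by (simp add: inner_sum_right)
    qed
    also have "\<dots> = 0"
    proof (intro sum.neutral ballI)
      fix h assume h: "h \<in> F"
      show "(\<integral>x. v x \<bullet> (p h x - chaos I m (p h) x) \<partial>P) = 0"
        by (rule U2_orthogonal[OF v J(1)[OF h] J(2)[OF h] I(1) _ p[OF h] J(3)[OF h]]) (use I h in auto)
    qed
    finally have vw: "(\<integral>x. v x \<bullet> w x \<partial>P) = 0" .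
    have "chaos I m w = (\<lambda>x. 0)"
      unfolding w_def u_def using q I by (simp add: chaos_diff chaos_idem)
    then have uw: "(\<integral>x. u x \<bullet> w x \<partial>P) = 0"
      using integral_chaos_inner[OF q bw, of I m] by (simp add: u_def)
    have eq: "nsq (\<lambda>x. v x - q x) = (\<lambda>x. nsq (\<lambda>x. v x - u x) x - 2 * (v x \<bullet> w x) + 2 * (u x \<bullet> w x) + nsq w x)"
      by (auto simp: nsq_def w_def inner_diff_left inner_diff_right inner_commute)
    have [measurable]: "u \<in> borel_measurable P" using bu by (rule bmf_measurable)
    have ivu: "integrable P (nsq (\<lambda>x. v x - u x))"
      using iv bu by (intro integrable_nsq_diff) auto
    have "integral\<^sup>L P (nsq (\<lambda>x. v x - q x)) = integral\<^sup>L P (nsq (\<lambda>x. v x - u x)) + integral\<^sup>L P (nsq w)"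
      unfolding eq using ivu iin[OF bw] bu bw by (simp add: vw uw)
    moreover have "0 \<le> integral\<^sup>L P (nsq w)" by (rule Bochner_Integration.integral_nonneg) simp
    ultimately have "integral\<^sup>L P (nsq (\<lambda>x. v x - u x)) < (e / 2)\<^sup>2" using vq by linarith
    then have "sqrt (integral\<^sup>L P (nsq (\<lambda>x. v x - u x))) < sqrt ((e / 2)\<^sup>2)" by (rule real_sqrt_less_mono)
    then have "sqrt (integral\<^sup>L P (nsq (\<lambda>x. v x - u x))) < e" using e by simp
    then have "(\<integral>x. norm (v x - u x) \<partial>P) < e"
      using integral_norm_le[OF _ ivu] by simp
    then show "\<exists>u\<in>finite_chaos I m. (\<integral>x. norm (v x - u x) \<partial>P) < e" using u by blast
  qed
qed

lemma integral_norm_diff_triangle: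
  fixes f g h :: "(nat \<Rightarrow> 'a) \<Rightarrow> 'b"
  assumes "integrable P f" "integrable P g" "integrable P h"
  shows "(\<integral>x. norm (f x - h x) \<partial>P) \<le> (\<integral>x. norm (f x - g x) \<partial>P) + (\<integral>x. norm (g x - h x) \<partial>P)"
proof -
  have "(\<integral>x. norm (f x - h x) \<partial>P) \<le> (\<integral>x. norm (f x - g x) + norm (g x - h x) \<partial>P)"
    using assms by (intro integral_mono) (auto simp: norm_triangle_le intro: order_trans[OF _ norm_triangle_ineq])
  then show ?thesis using assms by simp
qed

lemma finite_chaos_integrable: "u \<in> finite_chaos I m \<Longrightarrow> integrable P u"
  by (simp add: finite_chaos_def)

lemma U1_approximable:
  assumes f: "f \<in> U1 cj M m" shows "chaos_approximable m f"
  unfolding chaos_approximable_def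
proof (intro conjI allI impI)
  have "f \<in> Lp P 1" using f by (simp add: U1_def Lp_closure_def)
  then show fi: "integrable P f" by (simp add: Lp_1_iff)
  fix e :: real assume e: "e > 0"
  then obtain v where v: "v \<in> U2 cj M m" and "Lp_norm P 1 (\<lambda>x. f x - v x) < e / 2"
    using f unfolding U1_def Lp_closure_def by (auto dest!: spec[of _ "e / 2"])
  then have fv: "(\<integral>x. norm (f x - v x) \<partial>P) < e / 2" by (simp add: Lp_norm_1)
  have vi: "integrable P v" using U2_approximable[OF v] by (simp add: chaos_approximable_def)
  obtain I0 where I0: "finite I0"
    and ap: "\<And>I. finite I \<Longrightarrow> I0 \<subseteq> I \<Longrightarrow> \<exists>u\<in>finite_chaos I m. (\<integral>x. norm (v x - u x) \<partial>P) < e / 2"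
    using U2_approximable[OF v] e unfolding chaos_approximable_def by (metis half_gt_zero)
  show "\<exists>I0. finite I0 \<and> (\<forall>I. finite I \<longrightarrow> I0 \<subseteq> I \<longrightarrow> (\<exists>u\<in>finite_chaos I m. (\<integral>x. norm (f x - u x) \<partial>P) < e))"
  proof (intro exI[of _ I0] conjI allI impI I0)
    fix I assume "finite I" "I0 \<subseteq> I"
    then obtain u where u: "u \<in> finite_chaos I m" and "(\<integral>x. norm (v x - u x) \<partial>P) < e / 2" using ap by blast
    then have "(\<integral>x. norm (f x - u x) \<partial>P) < e"
      using integral_norm_diff_triangle[OF fi vi finite_chaos_integrable[OF u]] fv by linarith
    then show "\<exists>u\<in>finite_chaos I m. (\<integral>x. norm (f x - u x) \<partial>P) < e" using u by blast
  qed
qed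

lemma approximable_add:
  assumes f: "chaos_approximable m f" and g: "chaos_approximable m g"
    and h: "h \<in> borel_measurable P" and ae: "AE x in P. h x = f x + g x"
  shows "chaos_approximable m h"
  unfolding chaos_approximable_def
proof (intro conjI allI impI)
  have fi [simp]: "integrable P f" and gi [simp]: "integrable P g"
    using f g by (auto simp: chaos_approximable_def)
  have "integrable P (\<lambda>x. f x + g x)" by simp
  moreover have fgm: "(\<lambda>x. f x + g x) \<in> borel_measurable P"
    using fi gi by (intro borel_measurable_add borel_measurable_integrable)
  ultimately show "integrable P h" using integrable_cong_AE[OF h fgm ae] by simp
  fix e :: real assume e: "e > 0"
  obtain I1 where I1: "finite I1"
    and ap1: "\<And>I. finite I \<Longrightarrow> I1 \<subseteq> I \<Longrightarrow> \<exists>u\<in>finite_chaos I m. (\<integral>x. norm (f x - u x) \<partial>P) < e / 2"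
    using f e unfolding chaos_approximable_def by (metis half_gt_zero)
  obtain I2 where I2: "finite I2"
    and ap2: "\<And>I. finite I \<Longrightarrow> I2 \<subseteq> I \<Longrightarrow> \<exists>u\<in>finite_chaos I m. (\<integral>x. norm (g x - u x) \<partial>P) < e / 2"
    using g e unfolding chaos_approximable_def by (metis half_gt_zero)
  show "\<exists>I0. finite I0 \<and> (\<forall>I. finite I \<longrightarrow> I0 \<subseteq> I \<longrightarrow> (\<exists>u\<in>finite_chaos I m. (\<integral>x. norm (h x - u x) \<partial>P) < e))"
  proof (intro exI[of _ "I1 \<union> I2"] conjI allI impI)
    show "finite (I1 \<union> I2)" using I1 I2 by simp
    fix I assume I: "finite I" "I1 \<union> I2 \<subseteq> I"
    obtain u where u: "u \<in> finite_chaos I m" and fu: "(\<integral>x. norm (f x - u x) \<partial>P) < e / 2" using ap1[of I] I by blast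
    obtain v where v: "v \<in> finite_chaos I m" and gv: "(\<integral>x. norm (g x - v x) \<partial>P) < e / 2" using ap2[of I] I by blast
    note [simp] = finite_chaos_integrable[OF u] finite_chaos_integrable[OF v]
    note [measurable] = h borel_measurable_integrable[OF fi] borel_measurable_integrable[OF gi]
      borel_measurable_integrable[OF finite_chaos_integrable[OF u]]
      borel_measurable_integrable[OF finite_chaos_integrable[OF v]]
    have "(\<integral>x. norm (h x - (u x + v x)) \<partial>P) = (\<integral>x. norm ((f x - u x) + (g x - v x)) \<partial>P)"
      by (intro integral_cong_AE) (use ae in \<open>auto simp: algebra_simps\<close>)
    also have "\<dots> \<le> (\<integral>x. norm (f x - u x) + norm (g x - v x) \<partial>P)"
      by (intro integral_mono norm_triangle_ineq) auto
    also have "\<dots> < e" using fu gv by simp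
    finally show "\<exists>u\<in>finite_chaos I m. (\<integral>x. norm (h x - u x) \<partial>P) < e"
      by (intro bexI[OF _ finite_chaos_add[OF u v]])
  qed
qed

text \<open>
  An approximation of \<open>f\<close> minus \<open>u\<close> is again a finite chaos, hence an element of \<open>U\<^sup>2\<^sub>m\<close>.
\<close>

lemma approximable_diff_in_U1:
  assumes f: "chaos_approximable m f" and J: "finite J" and u: "u \<in> finite_chaos J m"
  shows "(\<lambda>x. f x - u x) \<in> U1 cj M m"
  unfolding U1_def Lp_closure_def
proof (intro CollectI conjI allI impI)
  show "(\<lambda>x. f x - u x) \<in> Lp P 1"
    using f finite_chaos_integrable[OF u] by (simp add: Lp_1_iff chaos_approximable_def)
  fix e :: real assume "e > 0"
  then obtain I0 where I0: "finite I0"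
    "\<And>I. finite I \<Longrightarrow> I0 \<subseteq> I \<Longrightarrow> \<exists>u\<in>finite_chaos I m. (\<integral>x. norm (f x - u x) \<partial>P) < e"
    using f unfolding chaos_approximable_def by metis
  obtain v where v: "v \<in> finite_chaos (I0 \<union> J) m" "(\<integral>x. norm (f x - v x) \<partial>P) < e"
    using I0(2)[of "I0 \<union> J"] I0(1) J by auto
  have "u \<in> finite_chaos (I0 \<union> J) m" by (rule finite_chaos_mono[OF u]) (use I0(1) J in auto)
  then have "(\<lambda>x. v x - u x) \<in> U2 cj M m"
    using v I0(1) J by (intro finite_chaos_subset_U2[of "I0 \<union> J"] finite_chaos_diff) auto
  then show "\<exists>g\<in>U2 cj M m. Lp_norm P 1 (\<lambda>x. f x - u x - g x) < e"
    using v(2) by (intro bexI[of _ "\<lambda>x. v x - u x"]) (auto simp: Lp_norm_1)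
qed

text \<open>
  Replace \<open>f\<close> by a finite chaos \<open>v\<close> that is close in \<open>L\<^sup>1\<close>. A splitting of \<open>f\<close> gives one of \<open>v\<close> by adding the
  difference to the \<open>L\<^sup>1\<close> part; decompose \<open>v\<close> within the chaos, and put the difference back.
\<close>

lemma K_closed_chaos:
  "K_closed P (Lp_norm P 1) (Lp_norm P 2) (U1 cj M m) (U2 cj M m) (Lp P 1) (Lp P 2)"
  unfolding K_closed_def
proof (intro exI ballI allI impI)
  let ?C = "K_constant m"
  fix f :: "(nat \<Rightarrow> 'a) \<Rightarrow> 'b" and t :: real
  assume f: "f \<in> sum_space P (U1 cj M m) (U2 cj M m)" and t: "t > 0"
  have fm [measurable]: "f \<in> borel_measurable P" using f by (simp add: sum_space_def)
  obtain f0 f1 where f0: "f0 \<in> U1 cj M m" and f1: "f1 \<in> U2 cj M m" and ae: "AE x in P. f x = f0 x + f1 x"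
    using f by (auto simp: sum_space_def decompositions_def)
  have ap: "chaos_approximable m f"
    by (rule approximable_add[OF U1_approximable[OF f0] U2_approximable[OF f1] fm ae])
  then have fi [simp]: "integrable P f" by (simp add: chaos_approximable_def)
  let ?val = "\<lambda>(g, h). Lp_norm P 1 g + t * Lp_norm P 2 h"
  let ?Y = "decompositions P (U1 cj M m) (U2 cj M m) f" and ?X = "decompositions P (Lp P 1) (Lp P 2) f"
  have "(f0, f1) \<in> ?X"
    using f0 U2_Lp[OF f1] ae by (simp add: decompositions_def U1_def Lp_closure_def)
  then have ne: "?X \<noteq> {}" by blast
  have nonneg: "0 \<le> ?val gh" for gh :: "((nat \<Rightarrow> 'a) \<Rightarrow> 'b) \<times> ((nat \<Rightarrow> 'a) \<Rightarrow> 'b)"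
    using t by (cases gh) (simp add: Lp_norm_def)
  have bdd: "bdd_below (?val ` ?Y)" using nonneg by (rule bdd_belowI2)
  have main: "K_functional P (Lp_norm P 1) (Lp_norm P 2) (U1 cj M m) (U2 cj M m) f t \<le> ?C * ?val (g, h)"
    if gh: "(g, h) \<in> ?X" for g h
  proof (rule field_le_epsilon)
    fix e :: real assume e: "e > 0"
    have gi [simp]: "integrable P g" and hm [measurable]: "h \<in> borel_measurable P" and hi: "integrable P (nsq h)"
      and aeX: "AE x in P. f x = g x + h x"
      using gh by (auto simp: decompositions_def Lp_1_iff Lp_2_iff)
    define \<delta> where "\<delta> = e / (2 * (?C + 1))"
    have C: "?C > 0" by (rule K_constant_pos)
    then have \<delta>: "\<delta> > 0" "(?C + 1) * \<delta> = e / 2" using e by (auto simp: \<delta>_def divide_simps add_pos_pos)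
    obtain I where I: "finite I" "\<And>I'. finite I' \<Longrightarrow> I \<subseteq> I' \<Longrightarrow> \<exists>u\<in>finite_chaos I' m. (\<integral>x. norm (f x - u x) \<partial>P) < \<delta>"
      using ap \<delta>(1) unfolding chaos_approximable_def by metis
    obtain v where v: "v \<in> finite_chaos I m" and fv: "(\<integral>x. norm (f x - v x) \<partial>P) < \<delta>" using I by blast
    have vi [simp]: "integrable P v" using v by (rule finite_chaos_integrable)
    have "AE x in P. v x = (g x + (v x - f x)) + h x" using aeX by eventually_elim simp
    moreover have gvi: "integrable P (\<lambda>x. g x + (v x - f x))" by simp
    ultimately obtain u where u: "u \<in> finite_chaos I m"
      and bound: "(\<integral>x. norm (v x - u x) \<partial>P) + t * sqrt (integral\<^sup>L P (nsq u))
        \<le> ?C * ((\<integral>x. norm (g x + (v x - f x)) \<partial>P) + t * sqrt (integral\<^sup>L P (nsq h))) + e / 2"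
      using finite_chaos_decomposition[OF I(1) v t, of "e / 2" "\<lambda>x. g x + (v x - f x)" h] e hm hi by auto
    have ui [simp]: "integrable P u" using u by (rule finite_chaos_integrable)
    have "(\<lambda>x. f x - u x, u) \<in> ?Y"
      using approximable_diff_in_U1[OF ap I(1) u] finite_chaos_subset_U2[OF I(1) u] by (simp add: decompositions_def)
    then have "K_functional P (Lp_norm P 1) (Lp_norm P 2) (U1 cj M m) (U2 cj M m) f t \<le> ?val (\<lambda>x. f x - u x, u)"
      unfolding K_functional_def by (rule cINF_lower[OF bdd])
    also have "\<dots> = (\<integral>x. norm (f x - u x) \<partial>P) + t * sqrt (integral\<^sup>L P (nsq u))"
      by (simp add: Lp_norm_1 Lp_norm_2)
    also have "\<dots> \<le> \<delta> + ((\<integral>x. norm (v x - u x) \<partial>P) + t * sqrt (integral\<^sup>L P (nsq u)))"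
      using integral_norm_diff_triangle[OF fi vi ui] fv by linarith
    also have "\<dots> \<le> \<delta> + (?C * ((\<integral>x. norm (g x + (v x - f x)) \<partial>P) + t * sqrt (integral\<^sup>L P (nsq h))) + e / 2)"
      using bound by simp
    also have "(\<integral>x. norm (g x + (v x - f x)) \<partial>P) \<le> (\<integral>x. norm (g x) + norm (f x - v x) \<partial>P)"
    proof (rule integral_mono)
      show "norm (g x + (v x - f x)) \<le> norm (g x) + norm (f x - v x)" for x
        using norm_triangle_ineq[of "g x" "v x - f x"] by (simp add: norm_minus_commute)
    qed auto
    also have "\<dots> \<le> (\<integral>x. norm (g x) \<partial>P) + \<delta>" using fv by simp
    finally have "K_functional P (Lp_norm P 1) (Lp_norm P 2) (U1 cj M m) (U2 cj M m) f t
        \<le> \<delta> + (?C * ((\<integral>x. norm (g x) \<partial>P) + \<delta> + t * sqrt (integral\<^sup>L P (nsq h))) + e / 2)"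
      using C by simp
    also have "\<dots> = ?C * ?val (g, h) + e"
      using \<delta>(2) by (simp add: Lp_norm_1 Lp_norm_2 algebra_simps)
    finally show "K_functional P (Lp_norm P 1) (Lp_norm P 2) (U1 cj M m) (U2 cj M m) f t \<le> ?C * ?val (g, h) + e" .
  qed
  have "K_functional P (Lp_norm P 1) (Lp_norm P 2) (U1 cj M m) (U2 cj M m) f t / ?C
      \<le> K_functional P (Lp_norm P 1) (Lp_norm P 2) (Lp P 1) (Lp P 2) f t"
    unfolding K_functional_def[of _ _ _ "Lp P 1"]
  proof (rule cINF_greatest[OF ne])
    fix gh assume "gh \<in> ?X"
    then show "K_functional P (Lp_norm P 1) (Lp_norm P 2) (U1 cj M m) (U2 cj M m) f t / ?C \<le> ?val gh"
      using main[of "fst gh" "snd gh"] K_constant_pos[of m] by (simp add: divide_le_eq mult.commute case_prod_unfold)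
  qed
  then show "K_functional P (Lp_norm P 1) (Lp_norm P 2) (U1 cj M m) (U2 cj M m) f t
      \<le> ?C * K_functional P (Lp_norm P 1) (Lp_norm P 2) (Lp P 1) (Lp P 2) f t"
    using K_constant_pos[of m] by (simp add: divide_le_eq mult.commute)
qed

end

theorem theorem5:
  fixes M :: "'a measure" and m :: nat
  assumes "prob_space M"
  shows "K_closed (inf_power M) (Lp_norm (inf_power M) 1) (Lp_norm (inf_power M) 2)
           (U1 (\<lambda>x::real. x) M m) (U2 (\<lambda>x::real. x) M m)
           (Lp (inf_power M) 1) (Lp (inf_power M) 2)
       \<and> K_closed (inf_power M) (Lp_norm (inf_power M) 1) (Lp_norm (inf_power M) 2)
           (U1 cnj M m) (U2 cnj M m)
           (Lp (inf_power M) 1) (Lp (inf_power M) 2)"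
proof -
  interpret coordinate_space M using assms by (rule coordinate_space.intro)
  interpret real: chaos_spaces M "\<lambda>x::real. x" "\<lambda>x. x"
    by unfold_locales (auto intro: exI[of _ 1])
  interpret complex: chaos_spaces M cnj Re
    by unfold_locales (auto simp: inner_complex_def abs_Re_le_cmod intro!: exI[of _ 1])
  show ?thesis using real.K_closed_chaos complex.K_closed_chaos by blast
qed

end
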